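(* Let $n\ge 1$, $N\ge 0$ be integers. For $k\in[0,N]_{\mathbb Z}$ let $\mathcal S_k:\mathbb R\to\mathbb R^{2n\times 2n}$ be $C_p^1$ (continuous with piecewise continuous derivative) with $\mathcal S_k(\lambda)$ symplectic and $\Psi(\mathcal S_k(\lambda))\ge 0$ for all $\lambda\in\mathbb R$. Let $\sigma$ be the set of finite eigenvalues of the Dirichlet problem $y_{k+1}(\lambda)=\mathcal S_k(\lambda)y_k(\lambda)$, $x_0(\lambda)=0=x_{N+1}(\lambda)$. Then for any $a\in\mathbb R$ (and all $\lambda\in\mathbb R$, $k\in[0,N]_{\mathbb Z}$) the limit $\operatorname{rank}(\mathcal S_k(a)-\mathcal S_k(\lambda^-))$ exists, and for the numbers $$\rho_k(\lambda):=\operatorname{rank}(\mathcal S_k(a)-\mathcal S_k(\lambda^-))-\operatorname{rank}(\mathcal S_k(a)-\mathcal S_k(\lambda))$$ and any $b>a$ we have $$L_d^*\big((Z^{[0]}(a))^{-1}Y^{[N+1]}(b),0,N+1\big)+\sum_{a<\nu\le b}\sum_{k=0}^N\rho_k(\nu)=\#\{\nu\in\sigma\mid a<\nu\le b\},$$ where $$L_d^*\big((Z^{[0]}(a))^{-1}Y^{[N+1]}(b),0,N+1\big)=L_d\big((Z^{[N+1]}(a))^{-1}Y^{[0]}(b),0,N+1\big).$$ Moreover, if there is $\lambda_0\in\mathbb R$ such that $\operatorname{rank}\mathcal B_k(\lambda)=\operatorname{rank}\mathcal B_k(\lambda^-)$ for all $\lambda\le\lambda_0$ and $k\in[0,N]_{\mathbb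 Z}$, where $\mathcal B_k(\lambda)$ is the upper right $n\times n$ block of $\mathcal S_k(\lambda)$, then the sum $\sum_{a<\nu\le b}\sum_{k=0}^N\rho_k(\nu)$ is finite as $a\to-\infty$ (i.e. it stays bounded as $a\to-\infty$), and for $a<\lambda_1=\min\sigma$ the left-hand side of the first formula equals the number $\#\{\nu\in\sigma\mid\nu\le b\}$ of finite eigenvalues less than or equal to $b$.
   Context: Notation: $[M,N]_{\mathbb Z}=[M,N]\cap\mathbb Z$; $\mathcal J=\begin{pmatrix}0&I\\ -I&0\end{pmatrix}$ (of the appropriate size); $S\in\mathbb R^{2n\times2n}$ is symplectic if $S^T\mathcal JS=\mathcal J$; $A^\dagger$ is the Moore-Penrose inverse; $\operatorname{ind}A$ is the number of negative eigenvalues of a symmetric matrix $A$; $A\ge0$ means symmetric nonnegative definite; $\operatorname{rank}A(\lambda^-)$ is the left-hand limit of $\operatorname{rank}A(\cdot)$ at $\lambda$. For a symplectic $C^1_p$ function $S(\lambda)$ put $\Psi(S(\lambda))=\mathcal J^T\dot S(\lambda)S^{-1}(\lambda)$ (a symmetric matrix), $\dot{}=d/d\lambda$. A solution has the form $y_k=\binom{x_k}{u_k}$ with $x_k,u_k\in\mathbb R^n$. For $l\in\{0,N+1\}$, $Z_k^{[l]}(\lambda)$ is the symplectic fundamental matrix of $y_{k+1}=\mathcal S_k(\lambda)y_k$ with $Z_l^{[l]}(\lambda)=I$, and $Y_k^{[l]}(\lambda)=Z_k^{[l]}(\lambda)\binom0I=\binom{X_k^{[l]}(\lambda)}{U_k^{[l]}(\lambda)}$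 is the principal solution at $l$. A number $\lambda_0$ is a finite eigenvalue of the Dirichlet problem if $\theta(\lambda_0):=\operatorname{rank}X^{[0]}_{N+1}(\lambda_0^-)-\operatorname{rank}X^{[0]}_{N+1}(\lambda_0)\ge1$; $\#\{\nu\in\sigma\mid\dots\}$ counts finite eigenvalues with multiplicity $\theta$. (Under the hypotheses the left-hand rank limits in this definition exist.) Comparative index. For real $2m\times m$ matrices $Y=\binom XU$, $\hat Y=\binom{\hat X}{\hat U}$ of rank $m$ with $X^TU$, $\hat X^T\hat U$ symmetric, $\mu(Y,\hat Y)=\operatorname{rank}\mathcal M+\operatorname{ind}\mathcal D$, where $\mathcal M=(I-XX^\dagger)\hat X$, $\mathcal T=I-\mathcal M^\dagger\mathcal M$, $\mathcal D=\mathcal T\,w^T(Y,\hat Y)X^\dagger\hat X\,\mathcal T$, $w(Y,\hat Y)=Y^T\mathcal J\hat Y$. For a symplectic $S=\begin{pmatrix}A&B\\ C&D\end{pmatrix}\in\mathbb R^{2n\times2n}$ let $\langle S\rangle=\binom{\mathcal X}{\mathcal U}\in\mathbb R^{4n\times2n}$ with $\mathcal X=\begin{pmatrix}I&0\\ A&B\end{pmatrix}$, $\mathcal U=\begin{pmatrix}0&-I\\ C&D\end{pmatrix}$; then $\mu(\langle S\rangle,\langle\hat S\rangle)$ is defined with $m=2n$. For sequences of symplectic matrices $Z_k,\hat Z_k$, $k\in[0,N+1]_{\mathbb Z}$, with $Y_k=Z_k\binom0I$, $\hat Y_k=\hat Z_k\binom0I$, put $$L_d(\hat Z^{-1}Y,0,N+1)=\sum_{k=0}^N\mu(\langle\hat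 Z_{k+1}^{-1}Z_{k+1}\rangle,\langle\hat Z_k^{-1}Z_k\rangle),\qquad L_d^*(Z^{-1}\hat Y,0,N+1)=\sum_{k=0}^N\mu(\langle\hat Z_{k}^{-1}Z_{k}\rangle,\langle\hat Z_{k+1}^{-1}Z_{k+1}\rangle).$$ Thus in $L_d((Z^{[N+1]}(a))^{-1}Y^{[0]}(b),0,N+1)$ one takes $\hat Z_k=Z_k^{[N+1]}(a)$, $Z_k=Z_k^{[0]}(b)$, and in $L_d^*((Z^{[0]}(a))^{-1}Y^{[N+1]}(b),0,N+1)$ one takes $Z_k=Z_k^{[0]}(a)$, $\hat Z_k=Z_k^{[N+1]}(b)$. *)

theory Defs
  imports "HOL-Analysis.Analysis"
begin

text \<open>
  Square matrices of order \<open>2n\<close> are indexed by the sum type \<^typ>\<open>'n + 'n\<close> with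
  \<open>n = CARD('n)\<close>, and \<open>4n\<close> rows by the sum of two copies of that type; \<^term>\<open>Inl\<close> is the
  upper (left) half and \<^term>\<open>Inr\<close> the lower (right) half.  Since types are
  nonempty, \<open>n \<ge> 1\<close> holds automatically.
\<close>

definition vstack :: "real^'m^'a \<Rightarrow> real^'m^'b \<Rightarrow> real^'m^('a::finite + 'b::finite)" where
  "vstack X U = (\<chi> i. case i of Inl r \<Rightarrow> X $ r | Inr r \<Rightarrow> U $ r)"

definition upper :: "real^'m^('a::finite + 'b::finite) \<Rightarrow> real^'m^'a" where
  "upper Y = (\<chi> i. Y $ Inl i)"

definition lower :: "real^'m^('a::finite + 'b::finite) \<Rightarrow> real^'m^'b" where
  "lower Y = (\<chi> i. Y $ Inr i)"

definition hstack :: "real^'c^'a \<Rightarrow> real^'d^'a \<Rightarrow> real^('c::finite + 'd::finite)^'a" where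
  "hstack A B = (\<chi> i j. case j of Inl c \<Rightarrow> A $ i $ c | Inr c \<Rightarrow> B $ i $ c)"

definition upper_right :: "real^('c::finite + 'd::finite)^('a::finite + 'b::finite) \<Rightarrow> real^'d^'a" where
  "upper_right S = (\<chi> i j. S $ Inl i $ Inr j)"

definition Jmat :: "real^('m::finite + 'm)^('m::finite + 'm)" where
  "Jmat = vstack (hstack 0 (mat 1)) (hstack (- mat 1) 0)"

definition symplectic :: "real^('m::finite + 'm)^('m::finite + 'm) \<Rightarrow> bool" where
  "symplectic S \<longleftrightarrow> transpose S ** Jmat ** S = Jmat"

definition nonneg_def :: "real^'m^'m \<Rightarrow> bool" where
  "nonneg_def A \<longleftrightarrow> transpose A = A \<and> (\<forall>v. 0 \<le> v \<bullet> (A *v v))"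

text \<open>
  The Moore-Penrose inverse, as the unique solution of the four Penrose equations.
\<close>

definition pinv :: "real^'n^'m \<Rightarrow> real^'m^'n" where
  "pinv A = (THE B. A ** B ** A = A \<and> B ** A ** B = B \<and>
                    transpose (A ** B) = A ** B \<and> transpose (B ** A) = B ** A)"

lemma penrose_unique:
  fixes A :: "real^'n^'m" and B C :: "real^'m^'n"
  assumes B: "A ** B ** A = A" "B ** A ** B = B"
             "transpose (A ** B) = A ** B" "transpose (B ** A) = B ** A"
    and C: "A ** C ** A = A" "C ** A ** C = C"
           "transpose (A ** C) = A ** C" "transpose (C ** A) = C ** A"
  shows "B = C"
proof -
  have "A ** B = (A ** C) ** (A ** B)"
    by (metis C(1) matrix_mul_assoc)
  also have "\<dots> = transpose ((A ** B) ** (A ** C))"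
    by (simp only: matrix_transpose_mul[of "A ** B" "A ** C"] B(3) C(3))
  also have "\<dots> = A ** C"
    by (metis B(1) C(3) matrix_mul_assoc)
  finally have 1: "A ** B = A ** C" .
  have "B ** A = (B ** A) ** (C ** A)"
    by (metis C(1) matrix_mul_assoc)
  also have "\<dots> = transpose ((C ** A) ** (B ** A))"
    by (simp only: matrix_transpose_mul[of "C ** A" "B ** A"] B(4) C(4))
  also have "\<dots> = C ** A"
    by (metis B(1) C(4) matrix_mul_assoc)
  finally have 2: "B ** A = C ** A" .
  show ?thesis
    by (metis 1 2 B(2) C(2) matrix_mul_assoc)
qed

text \<open>
  The number of negative eigenvalues of a symmetric matrix, each counted with its
  multiplicity (for symmetric matrices, the dimension of the eigenspace).  There are only
  finitely many eigenvalues, so the sum is a finite one.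
\<close>

definition neg_eigenvalues :: "real^'m^'m \<Rightarrow> real set" where
  "neg_eigenvalues A = {c. c < 0 \<and> (\<exists>v. v \<noteq> 0 \<and> A *v v = c *\<^sub>R v)}"

definition ind :: "real^'m^'m \<Rightarrow> nat" where
  "ind A = (\<Sum>c\<in>neg_eigenvalues A. dim {v. A *v v = c *\<^sub>R v})"

definition mu :: "real^'m^('m::finite + 'm) \<Rightarrow> real^'m^('m::finite + 'm) \<Rightarrow> nat" where
  "mu Y Y' =
    (let X = upper Y; X' = upper Y';
         M = (mat 1 - X ** pinv X) ** X';
         T = mat 1 - pinv M ** M;
         w = transpose Y ** Jmat ** Y';
         D = T ** transpose w ** pinv X ** X' ** T
     in rank M + ind D)"

text \<open>
  \<open>langle S\<close> is the matrix \<open>\<langle>S\<rangle>\<close> with blocks \<open>(I, 0; A, B)\<close> and \<open>(0, -I; C, D)\<close>, where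
  \<open>(A, B)\<close> and \<open>(C, D)\<close> are the upper and lower halves of \<open>S\<close>.
\<close>

definition langle :: "real^('n::finite + 'n)^('n::finite + 'n) \<Rightarrow> real^('n::finite + 'n)^(('n::finite + 'n) + ('n::finite + 'n))" where
  "langle S = vstack (vstack (hstack (mat 1) 0) (upper S))
                     (vstack (hstack 0 (- mat 1)) (lower S))"

text \<open>
  \<open>C1p\<close>: continuous on the line with piecewise continuous derivative.  On every compact
  interval there are only finitely many exceptional points, and at each of them the
  derivative has finite one-sided limits.
\<close>

definition C1p :: "(real \<Rightarrow> 'a::real_normed_vector) \<Rightarrow> bool" where
  "C1p f \<longleftrightarrow>
     (\<forall>a b. f piecewise_C1_differentiable_on {a..b}) \<and>
     (\<forall>t. (\<exists>l. ((\<lambda>s. vector_derivative f (at s)) \<longlongrightarrow> l) (at_left t)) \<and>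
          (\<exists>l. ((\<lambda>s. vector_derivative f (at s)) \<longlongrightarrow> l) (at_right t)))"

text \<open>
  \<open>Psi S t\<close> is meaningful where \<open>S\<close> is differentiable.  At the exceptional points of a \<open>C1p\<close>
  function both one-sided versions are limits of values at nearby points of differentiability,
  so nonnegativity at all points of differentiability is nonnegativity everywhere.
\<close>

definition Psi :: "(real \<Rightarrow> real^('m::finite + 'm)^('m::finite + 'm)) \<Rightarrow> real \<Rightarrow> real^('m::finite + 'm)^('m::finite + 'm)" where
  "Psi S t = transpose Jmat ** vector_derivative S (at t) ** matrix_inv (S t)"

text \<open>
  Left-hand limit of the rank.  The rank is a natural number, so convergence means being
  eventually constant; the value is meaningful only if the limit exists.
\<close>

definition rank_left :: "(real \<Rightarrow> real^'n^'m) \<Rightarrow> real \<Rightarrow> nat" where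
  "rank_left A t = Lim (at_left t) (\<lambda>s. rank (A s))"

definition rank_left_exists :: "(real \<Rightarrow> real^'n^'m) \<Rightarrow> real \<Rightarrow> bool" where
  "rank_left_exists A t \<longleftrightarrow> (\<exists>r. ((\<lambda>s. rank (A s)) \<longlongrightarrow> r) (at_left t))"

text \<open>
  \<open>transition S k t\<close> is the product of \<open>S j t\<close> for \<open>j = k - 1, \<dots>, 0\<close>.  The fundamental matrix
  \<open>fund S l k t\<close> of the system is normalized to be the identity at \<open>k = l\<close>.
\<close>

primrec transition ::
  "(nat \<Rightarrow> real \<Rightarrow> real^('n::finite + 'n)^('n::finite + 'n)) \<Rightarrow> nat \<Rightarrow> real \<Rightarrow> real^('n::finite + 'n)^('n::finite + 'n)" where
  "transition S 0 t = mat 1"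
| "transition S (Suc k) t = S k t ** transition S k t"

definition fund ::
  "(nat \<Rightarrow> real \<Rightarrow> real^('n::finite + 'n)^('n::finite + 'n)) \<Rightarrow> nat \<Rightarrow> nat \<Rightarrow> real \<Rightarrow> real^('n::finite + 'n)^('n::finite + 'n)" where
  "fund S l k t = transition S k t ** matrix_inv (transition S l t)"

lemma fund_step: "fund S l (Suc k) t = S k t ** fund S l k t"
  by (simp add: fund_def matrix_mul_assoc)

lemma symplectic_invertible:
  fixes S :: "real^('m::finite + 'm)^('m + 'm)"
  assumes "symplectic S"
  shows "invertible S"
proof -
  have sum_split: "(\<Sum>k\<in>UNIV. g k) = (\<Sum>k\<in>UNIV. g (Inl k)) + (\<Sum>k\<in>UNIV. g (Inr k))"
    for g :: "'m + 'm \<Rightarrow> real"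
    by (simp add: UNIV_Plus_UNIV[symmetric] sum.Plus del: UNIV_Plus_UNIV)
  have JJ: "(- Jmat) ** (Jmat :: real^('m::finite + 'm)^('m + 'm)) = mat 1"
    unfolding vec_eq_iff
  proof (intro allI)
    fix i j :: "'m + 'm"
    show "((- Jmat) ** (Jmat :: real^('m::finite + 'm)^('m + 'm))) $ i $ j = mat 1 $ i $ j"
      by (cases i; cases j) (simp_all add: matrix_matrix_mult_def sum_split Jmat_def vstack_def
          hstack_def mat_def if_distrib[where f = "\<lambda>x. x * _"] sum_negf cong: if_cong)
  qed
  have "((- Jmat) ** transpose S ** Jmat) ** S = (- Jmat) ** (transpose S ** Jmat ** S)"
    by (simp only: matrix_mul_assoc)
  also have "\<dots> = mat 1"
    using assms JJ by (simp add: symplectic_def)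
  finally show ?thesis
    using invertible_left_inverse by blast
qed

lemma transition_invertible:
  assumes "\<And>j. j < l \<Longrightarrow> symplectic (S j t)"
  shows "invertible (transition S l t)"
  using assms
proof (induction l)
  case 0
  show ?case by (auto simp: invertible_def intro!: exI[of _ "mat 1"])
next
  case (Suc l)
  then show ?case by (simp add: invertible_mult symplectic_invertible)
qed

lemma fund_self:
  assumes "\<And>j. j < l \<Longrightarrow> symplectic (S j t)"
  shows "fund S l l t = mat 1"
proof -
  have "invertible (transition S l t)"
    by (rule transition_invertible) (rule assms)
  then show ?thesis
    unfolding fund_def matrix_inv_def invertible_def by (rule someI2_ex) blast
qed

definition principal ::
  "(nat \<Rightarrow> real \<Rightarrow> real^('n::finite + 'n)^('n::finite + 'n)) \<Rightarrow> nat \<Rightarrow> nat \<Rightarrow> real \<Rightarrow> real^'n^('n::finite + 'n)" where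
  "principal S l k t = fund S l k t ** vstack 0 (mat 1)"

definition theta :: "(nat \<Rightarrow> real \<Rightarrow> real^('n::finite + 'n)^('n::finite + 'n)) \<Rightarrow> nat \<Rightarrow> real \<Rightarrow> int" where
  "theta S N t = int (rank_left (\<lambda>s. upper (principal S 0 (N + 1) s)) t)
               - int (rank (upper (principal S 0 (N + 1) t)))"

definition finite_eigenvalues :: "(nat \<Rightarrow> real \<Rightarrow> real^('n::finite + 'n)^('n::finite + 'n)) \<Rightarrow> nat \<Rightarrow> real set" where
  "finite_eigenvalues S N = {t. theta S N t \<ge> 1}"

definition rho :: "(real \<Rightarrow> real^'m^'m) \<Rightarrow> real \<Rightarrow> real \<Rightarrow> int" where
  "rho S a t = int (rank_left (\<lambda>s. S a - S s) t) - int (rank (S a - S t))"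

text \<open>
  The sum of \<open>rho\<close> over all points of \<open>(a, b]\<close> is taken over the points at which some summand
  is nonzero.
\<close>

definition rho_support ::
  "(nat \<Rightarrow> real \<Rightarrow> real^'m^'m) \<Rightarrow> nat \<Rightarrow> real \<Rightarrow> real \<Rightarrow> real set" where
  "rho_support S N a b = {\<nu>. a < \<nu> \<and> \<nu> \<le> b \<and> (\<exists>k\<le>N. rho (S k) a \<nu> \<noteq> 0)}"

definition rho_sum :: "(nat \<Rightarrow> real \<Rightarrow> real^'m^'m) \<Rightarrow> nat \<Rightarrow> real \<Rightarrow> real \<Rightarrow> int" where
  "rho_sum S N a b = (\<Sum>\<nu>\<in>rho_support S N a b. \<Sum>k\<le>N. rho (S k) a \<nu>)"

text \<open>
  The first argument is always the sequence \<open>Z\<close> and the second one is the sequence with the hat.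
\<close>

definition Ld ::
  "(nat \<Rightarrow> real^('n::finite + 'n)^('n::finite + 'n)) \<Rightarrow> (nat \<Rightarrow> real^('n::finite + 'n)^('n::finite + 'n)) \<Rightarrow> nat \<Rightarrow> nat" where
  "Ld Z Zh N = (\<Sum>k\<le>N. mu (langle (matrix_inv (Zh (k + 1)) ** Z (k + 1)))
                           (langle (matrix_inv (Zh k) ** Z k)))"

definition Ld_star ::
  "(nat \<Rightarrow> real^('n::finite + 'n)^('n::finite + 'n)) \<Rightarrow> (nat \<Rightarrow> real^('n::finite + 'n)^('n::finite + 'n)) \<Rightarrow> nat \<Rightarrow> nat" where
  "Ld_star Z Zh N = (\<Sum>k\<le>N. mu (langle (matrix_inv (Zh k) ** Z k))
                                (langle (matrix_inv (Zh (k + 1)) ** Z (k + 1))))"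

end

theory Submission
  imports Defs
begin

text \<open>
  The three quantities in the formula all count how often a Lagrangian subspace that moves in one
  direction meets another one. A finite eigenvalue is a parameter at which the rank of
  \<open>X\<close> is smaller than its left-hand limit; \<open>\<rho>\<^sub>k\<close> records the same
  kind of fall for the rank of a difference \<open>S\<^sub>k(a) - S\<^sub>k(\<lambda>)\<close>, that
  is, for the graph of \<open>S\<^sub>k(\<lambda>)\<close> against the graph of
  \<open>S\<^sub>k(a)\<close>; and the comparative index turns out to be what distinguishes two such
  counts along one path.

  Local picture. If \<open>Y = (X; U)\<close> is Lagrangian, then \<open>U + c X\<close> is invertible
  for all but finitely many \<open>c\<close>, and near \<open>Y\<close> Lagrangian subspaces
  correspond to symmetric matrices \<open>Q = X (U + c X)\<^sup>-\<^sup>1\<close>. Nonnegativity of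
  \<open>\<Psi>\<close> makes \<open>Q\<close> nondecreasing. Positive eigenvalues of \<open>Q\<close>
  cannot reach zero from the left, so the rank of \<open>Q\<close> falls at \<open>t\<close> exactly
  by the number of negative eigenvalues that vanish there; negative eigenvalues cannot appear later,
  so the falls in \<open>(a,b]\<close> add up to \<open>ind Q(a) - ind Q(b)\<close> (lemma
  \<open>total_drop_rank_nondecreasing\<close>). Contact with a second Lagrangian subspace
  \<open>Y'\<close> is counted in the same way by \<open>Q - Q'\<close>.

  Comparative index. Evaluating the negative index of one block quadratic form in two ways gives
  \<open>\<mu>(Y,Y') + ind Q = ind (Q - Q') + ind Q'\<close> in every chart
  (\<open>mu_inertia\<close>). Hence the count against the vertical subspace and the count against
  \<open>Y'\<close> differ by \<open>\<mu>(Y(b),Y') - \<mu>(Y(a),Y')\<close>. This no longer mentions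
  the chart, so it adds up along the whole path (\<open>total_drop_comparison\<close>). For the graphs
  of \<open>L S\<^sub>k(\<lambda>) R\<close> it says that the falls of the rank of the upper right
  block are a comparative index of the two end points plus the sum of \<open>\<rho>\<^sub>k\<close>
  (\<open>total_drop_upper_right\<close>).

  Deformation. In a chart a count depends on the end points only. Therefore the counts around a
  rectangle in a two-parameter family cancel, first for small and then for all rectangles, and the
  count for a product \<open>A(\<lambda>) B(\<lambda>)\<close> is the sum of the counts in which first
  one factor moves and then the other (\<open>total_drop_product\<close>). Moving the factors of
  \<open>S\<^sub>N \<dots> S\<^sub>0\<close> from \<open>a\<close> to \<open>b\<close> one after the
  other, starting from the left, produces the terms of \<open>L\<^sub>d\<^sup>*\<close>; starting from
  the right it produces those of \<open>L\<^sub>d\<close>. Both sums, enlarged by the same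
  \<open>\<rho>\<close>-sum, equal the number of finite eigenvalues in \<open>(a,b]\<close>.

  Behaviour at \<open>-\<infinity>\<close>. With \<open>L = R = I\<close> the same identity bounds the
  sum of \<open>\<rho>\<^sub>k\<close> over \<open>(a,b]\<close> by the falls of the rank of
  \<open>\<B>\<^sub>k\<close> in \<open>(a,b]\<close>, which all lie to the right of
  \<open>\<lambda>\<^sub>0\<close>. Since a comparative index is bounded in terms of the dimension,
  the number of finite eigenvalues in \<open>(a,b]\<close> is bounded independently of
  \<open>a\<close>.
\<close>

section \<open>Negative index of quadratic forms and the spectral theorem\<close>

lemma dot_symmetric_matrix:
  fixes A :: "real^'m^'m"
  assumes "transpose A = A"
  shows "x \<bullet> (A *v y) = (A *v x) \<bullet> y"
  by (metis assms dot_lmul_matrix transpose_matrix_vector)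

lemma dot_matrix_transpose:
  fixes A :: "real^'n^'m"
  shows "x \<bullet> (A *v y) = (transpose A *v x) \<bullet> y"
  by (simp add: dot_lmul_matrix)

text \<open>
  For small positive \<open>t\<close> the linear term dominates the quadratic one. This is the
  first-order condition at a maximum, in the form in which the Rayleigh quotient needs it.
\<close>

lemma quadratic_nonpos_imp_linear_coeff_nonpos:
  fixes p r :: real
  assumes "\<And>t. 2 * t * p + t^2 * r \<le> 0"
  shows "p \<le> 0"
proof (rule ccontr)
  assume "\<not> p \<le> 0"
  then have p: "p > 0" by simp
  define d where "d = \<bar>r\<bar> + 1"
  have d: "d > 0" "r \<ge> - d" by (auto simp: d_def)
  \<comment> \<open>The parameter \<open>p/d\<close> is small enough for the quadratic term to cost at most half
    of the linear one.\<close>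
  have "0 < p^2 / d" using p d by simp
  also have "\<dots> \<le> 2 * (p/d) * p + (p/d)^2 * r"
  proof -
    have "(p/d)^2 * (- d) \<le> (p/d)^2 * r"
      using d by (intro mult_left_mono) auto
    moreover have "(p/d)^2 * (- d) = - (p^2/d)"
      using d by (simp add: power2_eq_square)
    moreover have "2 * (p/d) * p = 2 * (p^2/d)"
      by (simp add: power2_eq_square)
    ultimately show ?thesis by linarith
  qed
  also have "\<dots> \<le> 0" by (rule assms)
  finally show False by simp
qed

text \<open>
  A maximizer \<open>u\<close> of \<open>v \<bullet> A v\<close> on the unit sphere of
  \<open>W\<close> is an eigenvector: otherwise moving from \<open>u\<close> in the direction of the
  residual \<open>A u - c u\<close>, which stays in the invariant subspace \<open>W\<close>, would
  increase the Rayleigh quotient.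
\<close>

lemma symmetric_matrix_eigenvector:
  fixes A :: "real^'m^'m"
  assumes sym: "transpose A = A" and W: "subspace W" "\<And>w. w \<in> W \<Longrightarrow> A *v w \<in> W"
    and nz: "W \<noteq> {0}"
  obtains v c where "v \<in> W" "v \<noteq> 0" "A *v v = c *\<^sub>R v"
proof -
  define K where "K = sphere 0 1 \<inter> W"
  obtain w where w: "w \<in> W" "w \<noteq> 0"
    using nz W(1) subspace_0 by blast
  have "(1 / norm w) *\<^sub>R w \<in> K"
    using w W(1) by (simp add: K_def subspace_mul)
  moreover have "compact K"
    unfolding K_def by (intro compact_Int_closed closed_subspace W) simp
  moreover have "continuous_on K (\<lambda>v. v \<bullet> (A *v v))"
    by (intro continuous_intros linear_continuous_on linear_conv_bounded_linear[THEN iffD1]) simp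
  ultimately obtain u where u: "u \<in> K" "\<And>v. v \<in> K \<Longrightarrow> v \<bullet> (A *v v) \<le> u \<bullet> (A *v u)"
    using continuous_attains_sup[of K "\<lambda>v. v \<bullet> (A *v v)"] by blast
  define c where "c = u \<bullet> (A *v u)"
  have uW: "u \<in> W" and u1: "u \<bullet> u = 1"
    using u(1) by (auto simp: K_def norm_eq_1)
  have le: "v \<bullet> (A *v v) \<le> c * (v \<bullet> v)" if v: "v \<in> W" for v
  proof (cases "v = 0")
    case False
    have "(1 / norm v) *\<^sub>R v \<in> K"
      using v False W(1) by (simp add: K_def subspace_mul)
    then have "((1 / norm v) *\<^sub>R v) \<bullet> (A *v ((1 / norm v) *\<^sub>R v)) \<le> c"
      using u(2) c_def by blast
    then have "(v \<bullet> (A *v v)) / (norm v)^2 \<le> c"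
      by (simp add: matrix_vector_mult_scaleR power2_eq_square)
    then show ?thesis
      using False by (simp add: field_simps dot_square_norm)
  qed simp
  define e where "e = A *v u - c *\<^sub>R u"
  have eW: "e \<in> W"
    unfolding e_def using W uW by (simp add: subspace_diff subspace_mul)
  have "e \<bullet> e \<le> 0"
  proof (rule quadratic_nonpos_imp_linear_coeff_nonpos)
    fix t :: real
    have le': "(u + t *\<^sub>R e) \<bullet> (A *v (u + t *\<^sub>R e)) \<le> c * ((u + t *\<^sub>R e) \<bullet> (u + t *\<^sub>R e))"
      using uW eW W(1) by (intro le) (simp add: subspace_add subspace_mul)
    have uAe: "u \<bullet> (A *v e) = e \<bullet> (A *v u)"
      by (metis sym dot_symmetric_matrix inner_commute)
    have eAu: "e \<bullet> (A *v u) = e \<bullet> e + c * (e \<bullet> u)"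
      by (subst (2) e_def) (simp add: inner_diff_right)
    have f1: "(u + t *\<^sub>R e) \<bullet> (A *v (u + t *\<^sub>R e))
        = c + 2 * t * (e \<bullet> e + c * (e \<bullet> u)) + t^2 * (e \<bullet> (A *v e))"
      unfolding eAu[symmetric]
      by (simp add: matrix_vector_right_distrib matrix_vector_mult_scaleR inner_add_left
          inner_add_right c_def uAe power2_eq_square distrib_left)
    have f2: "(u + t *\<^sub>R e) \<bullet> (u + t *\<^sub>R e) = 1 + 2 * t * (e \<bullet> u) + t^2 * (e \<bullet> e)"
      using u1 by (simp add: inner_add_left inner_add_right power2_eq_square inner_commute[of u e] distrib_left)
    show "2 * t * (e \<bullet> e) + t^2 * (e \<bullet> (A *v e) - c * (e \<bullet> e)) \<le> 0"
      using le' unfolding f1 f2 by (simp add: algebra_simps)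
  qed
  then have "e = 0"
    by (metis inner_eq_zero_iff inner_ge_zero order_antisym)
  then show thesis
    using that[of u c] uW u1 by (cases "u = 0") (auto simp: e_def)
qed

text \<open>
  Split off one eigenvector and continue in its orthogonal complement, which is again invariant
  because \<open>A\<close> is symmetric.
\<close>

lemma symmetric_matrix_eigenbasis:
  fixes A :: "real^'m^'m"
  assumes sym: "transpose A = A" and "subspace W" "\<And>w. w \<in> W \<Longrightarrow> A *v w \<in> W"
  shows "\<exists>B. pairwise orthogonal B \<and> 0 \<notin> B \<and> span B = W \<and> (\<forall>b\<in>B. \<exists>c. A *v b = c *\<^sub>R b)"
  using assms(2,3)
proof (induction "dim W" arbitrary: W rule: less_induct)
  case less
  show ?case
  proof (cases "W = {0}")
    case True
    then show ?thesis by (intro exI[of _ "{}"]) simp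
  next
    case False
    obtain v c where v: "v \<in> W" "v \<noteq> 0" "A *v v = c *\<^sub>R v"
      using symmetric_matrix_eigenvector[OF sym less.prems False] by blast
    define W' where "W' = {w \<in> W. v \<bullet> w = 0}"
    have W'_eq: "W' = {y \<in> W. \<forall>x \<in> span {v}. orthogonal x y}"
      by (auto simp: W'_def orthogonal_def span_singleton)
    have "dim W' + dim (span {v}) = dim W"
      unfolding W'_eq using less.prems(1) v
      by (intro dim_subspace_orthogonal_to_vectors) (auto simp: span_minimal)
    moreover have "dim (span {v}) = 1"
      using v by (simp add: dim_eq_card_independent)
    ultimately have dimlt: "dim W' < dim W" by simp
    have sub: "subspace W'"
      using less.prems(1)
      by (auto simp: W'_def subspace_def inner_add_right)
    have inv: "A *v w \<in> W'" if "w \<in> W'" for w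
      using that less.prems(2) v by (simp add: W'_def dot_symmetric_matrix[OF sym])
    obtain B where B: "pairwise orthogonal B" "0 \<notin> B" "span B = W'"
        "\<forall>b\<in>B. \<exists>c. A *v b = c *\<^sub>R b"
      using less.hyps[OF dimlt sub inv] by blast
    have orth: "orthogonal v b" if "b \<in> B" for b
      using that B(3) span_base[of b B] by (auto simp: W'_def orthogonal_def)
    have "w \<in> span (insert v B)" if "w \<in> W" for w
    proof -
      define k where "k = (v \<bullet> w) / (v \<bullet> v)"
      have "w - k *\<^sub>R v \<in> W'"
        using that v less.prems(1) by (simp add: W'_def k_def inner_diff_right subspace_diff subspace_mul)
      then show ?thesis using B(3) by (subst span_insert) auto
    qed
    moreover have "span (insert v B) \<subseteq> W"
      using v less.prems(1) B(3) span_superset[of B] by (intro span_minimal) (auto simp: W'_def)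
    ultimately have "span (insert v B) = W" by blast
    then show ?thesis
      using B v orth
      by (intro exI[of _ "insert v B"]) (auto simp: pairwise_insert orthogonal_commute)
  qed
qed

lemma symmetric_matrix_diagonalization:
  fixes A :: "real^'m^'m"
  assumes sym: "transpose A = A"
  obtains B and l :: "real^'m \<Rightarrow> real" where "pairwise orthogonal B" "0 \<notin> B" "independent B"
    "finite B" "span B = UNIV" "card B = CARD('m)" "\<forall>b\<in>B. A *v b = l b *\<^sub>R b"
proof -
  obtain B where B: "pairwise orthogonal B" "0 \<notin> B" "span B = UNIV"
      "\<forall>b\<in>B. \<exists>c. A *v b = c *\<^sub>R b"
    using symmetric_matrix_eigenbasis[OF sym subspace_UNIV] by auto
  then obtain l where l: "\<forall>b\<in>B. A *v b = l b *\<^sub>R b"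
    by metis
  have ind: "independent B" using B pairwise_orthogonal_independent by blast
  then have "finite B" using independent_imp_finite by blast
  moreover have "card B = CARD('m)"
    using B ind dim_eq_card_independent[OF ind] by (metis dim_UNIV dim_span DIM_cart DIM_real mult_1_right)
  ultimately show thesis using that B ind l by blast
qed

context
  fixes A :: "real^'m^'m" and B and l :: "real^'m \<Rightarrow> real"
  assumes sym: "transpose A = A"
    and B: "pairwise orthogonal B" "0 \<notin> B" "independent B" "finite B" "span B = UNIV"
      "card B = CARD('m)" and l: "\<forall>b\<in>B. A *v b = l b *\<^sub>R b"
begin

lemma eigenbasis_expansion:
  obtains u where "v = (\<Sum>b\<in>B. u b *\<^sub>R b)" "\<And>b. b \<in> B \<Longrightarrow> b \<bullet> v = u b * (b \<bullet> b)"
proof -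
  obtain u where u: "v = (\<Sum>b\<in>B. u b *\<^sub>R b)"
    using span_finite[OF B(4)] B(5) by (metis (no_types, lifting) UNIV_I imageE)
  have "b \<bullet> v = u b * (b \<bullet> b)" if b: "b \<in> B" for b
  proof -
    have "b \<bullet> v = (\<Sum>x\<in>B. u x * (b \<bullet> x))"
      by (simp add: u inner_sum_right)
    also have "\<dots> = (\<Sum>x\<in>{b}. u x * (b \<bullet> x))"
      using b B(1,4) by (intro sum.mono_neutral_right) (auto simp: pairwise_def orthogonal_def)
    finally show ?thesis by simp
  qed
  then show thesis using u that by blast
qed

text \<open>
  Eigenvectors for different eigenvalues are orthogonal, so an eigenvector for \<open>c\<close> has no
  component along the basis vectors that belong to other eigenvalues. This turns the eigenspace
  dimensions in the definition of \<open>ind\<close> into numbers of basis vectors.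
\<close>

lemma eigenspace_eq_span: "{v. A *v v = c *\<^sub>R v} = span {b\<in>B. l b = c}"
proof (intro subset_antisym subsetI)
  fix v assume "v \<in> {v. A *v v = c *\<^sub>R v}"
  then have v: "A *v v = c *\<^sub>R v" by simp
  obtain u where u: "v = (\<Sum>b\<in>B. u b *\<^sub>R b)" "\<And>b. b \<in> B \<Longrightarrow> b \<bullet> v = u b * (b \<bullet> b)"
    using eigenbasis_expansion by blast
  have uz: "u b = 0" if b: "b \<in> B" "l b \<noteq> c" for b
  proof -
    have "c * (b \<bullet> v) = l b * (b \<bullet> v)"
      using v bspec[OF l b(1)] dot_symmetric_matrix[OF sym, of b v] by simp
    then have "b \<bullet> v = 0" using b by auto
    then show ?thesis using u(2)[OF b(1)] b B(2) by auto
  qed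
  then have "v = (\<Sum>b\<in>{b\<in>B. l b = c}. u b *\<^sub>R b)"
    unfolding u(1) using uz B(4) by (intro sum.mono_neutral_right) auto
  then show "v \<in> span {b\<in>B. l b = c}"
    by (metis (no_types, lifting) span_base span_scale span_sum)
next
  fix v assume v: "v \<in> span {b\<in>B. l b = c}"
  have "subspace {v. A *v v = c *\<^sub>R v}"
    by (auto simp: subspace_def matrix_vector_right_distrib matrix_vector_mult_scaleR algebra_simps)
  moreover have "{b\<in>B. l b = c} \<subseteq> {v. A *v v = c *\<^sub>R v}"
    using l by auto
  ultimately show "v \<in> {v. A *v v = c *\<^sub>R v}"
    using v span_minimal by blast
qed

lemma dim_span_sub_eigenbasis: "dim (span {b\<in>B. P b}) = card {b\<in>B. P b}"
  using independent_mono[OF B(3)] by (metis (no_types, lifting) dim_eq_card dim_span mem_Collect_eq subsetI)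

lemma ind_eq_card: "ind A = card {b\<in>B. l b < 0}"
proof -
  have eig: "dim {v. A *v v = c *\<^sub>R v} = card {b\<in>B. l b = c}" for c
    by (simp only: eigenspace_eq_span dim_span_sub_eigenbasis)
  have neg: "neg_eigenvalues A = l ` {b\<in>B. l b < 0}"
  proof (intro subset_antisym subsetI)
    fix c assume "c \<in> neg_eigenvalues A"
    then obtain v where v: "c < 0" "v \<noteq> 0" "v \<in> span {b\<in>B. l b = c}"
      by (auto simp: neg_eigenvalues_def eigenspace_eq_span[symmetric])
    then have "{b\<in>B. l b = c} \<noteq> {}"
      by (metis (no_types, lifting) empty_iff insert_iff span_empty)
    then show "c \<in> l ` {b\<in>B. l b < 0}" using v by auto
  next
    fix c assume "c \<in> l ` {b\<in>B. l b < 0}"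
    then show "c \<in> neg_eigenvalues A"
      using l B(2) by (auto simp: neg_eigenvalues_def) metis
  qed
  have "card {b\<in>B. l b < 0} = (\<Sum>c\<in>l ` {b\<in>B. l b < 0}. card {b\<in>{b\<in>B. l b < 0}. l b = c})"
    using sum.image_gen[of "{b\<in>B. l b < 0}" "\<lambda>_. 1::nat" l] B(4) by simp
  also have "\<dots> = (\<Sum>c\<in>l ` {b\<in>B. l b < 0}. card {b\<in>B. l b = c})"
    by (intro sum.cong refl arg_cong[of _ _ card]) auto
  finally show ?thesis by (simp add: ind_def neg eig)
qed

lemma rank_eq_card: "rank A = card {b\<in>B. l b \<noteq> 0}"
proof -
  have "range ((*v) A) = span ((*v) A ` B)"
    using B(5) by (metis linear_span_image matrix_vector_mul_linear)
  also have "\<dots> = span {b\<in>B. l b \<noteq> 0}"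
  proof (intro subset_antisym span_minimal subspace_span subsetI)
    fix v assume "v \<in> (*v) A ` B"
    then obtain b where b: "b \<in> B" "v = l b *\<^sub>R b" using l by auto
    then show "v \<in> span {b\<in>B. l b \<noteq> 0}"
      by (cases "l b = 0") (auto simp: span_zero intro: span_scale span_base)
  next
    fix b assume b: "b \<in> {b\<in>B. l b \<noteq> 0}"
    then have "b = (1 / l b) *\<^sub>R (A *v b)" using l by auto
    then show "b \<in> span ((*v) A ` B)"
      using b by (metis (no_types, lifting) image_eqI mem_Collect_eq span_base span_scale)
  qed
  finally show ?thesis by (simp only: rank_dim_range dim_span_sub_eigenbasis)
qed

lemma eigenbasis_form: "\<exists>u. v = (\<Sum>b\<in>B. u b *\<^sub>R b) \<and> v \<bullet> (A *v v) = (\<Sum>b\<in>B. l b * (u b)\<^sup>2 * (b \<bullet> b))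
    \<and> (\<forall>P. v \<in> span {b\<in>B. P b} \<longrightarrow> (\<forall>b\<in>B. \<not> P b \<longrightarrow> u b = 0))"
proof -
  obtain u where u: "v = (\<Sum>b\<in>B. u b *\<^sub>R b)" "\<And>b. b \<in> B \<Longrightarrow> b \<bullet> v = u b * (b \<bullet> b)"
    using eigenbasis_expansion by blast
  have "A *v v = (\<Sum>b\<in>B. u b *\<^sub>R (A *v b))"
    by (simp add: u(1) vec.sum matrix_vector_mult_scaleR linear_sum[OF matrix_vector_mul_linear])
  then have "A *v v = (\<Sum>b\<in>B. (u b * l b) *\<^sub>R b)"
    using l by simp
  then have "v \<bullet> (A *v v) = (\<Sum>b\<in>B. (u b * l b) * (b \<bullet> v))"
    by (simp add: inner_sum_right inner_commute)
  also have "\<dots> = (\<Sum>b\<in>B. l b * (u b)\<^sup>2 * (b \<bullet> b))"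
    by (intro sum.cong refl) (simp add: u(2) power2_eq_square)
  finally have 1: "v \<bullet> (A *v v) = (\<Sum>b\<in>B. l b * (u b)\<^sup>2 * (b \<bullet> b))" .
  have "u b = 0" if "v \<in> span {b\<in>B. P b}" "b \<in> B" "\<not> P b" for P b
  proof -
    have "subspace {w. b \<bullet> w = 0}" by (rule subspace_hyperplane)
    moreover have "{b\<in>B. P b} \<subseteq> {w. b \<bullet> w = 0}"
      using that B(1) by (auto simp: pairwise_def orthogonal_def)
    ultimately have "b \<bullet> v = 0" using that(1) span_minimal by blast
    then show ?thesis using u(2)[OF that(2)] that(2) B(2) by auto
  qed
  then show ?thesis using u(1) 1 by blast
qed

end

text \<open>
  The index as a relation between a quadratic form and a number. A negative definite and a nonnegative
  subspace of complementary dimensions certify that \<open>k\<close> is the largest dimension of a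
  negative definite subspace, so neither maxima nor eigenvalues are needed to compare forms on
  different spaces.
\<close>

definition has_index :: "('a::euclidean_space \<Rightarrow> real) \<Rightarrow> nat \<Rightarrow> bool" where
  "has_index q k \<longleftrightarrow> q 0 = 0 \<and> (\<exists>N P. subspace N \<and> subspace P \<and> (\<forall>v\<in>N. v \<noteq> 0 \<longrightarrow> q v < 0) \<and> (\<forall>v\<in>P. 0 \<le> q v)
     \<and> dim N = k \<and> dim N + dim P = DIM('a))"

lemma has_indexI:
  fixes q :: "'a::euclidean_space \<Rightarrow> real"
  assumes "q 0 = 0" "subspace N" "subspace P" "\<And>v. v \<in> N \<Longrightarrow> v \<noteq> 0 \<Longrightarrow> q v < 0"
    "\<And>v. v \<in> P \<Longrightarrow> 0 \<le> q v" "dim N = k" "dim N + dim P = DIM('a)"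
  shows "has_index q k"
  unfolding has_index_def using assms by blast

text \<open>
  A negative definite subspace meets the nonnegative one of the certificate only in zero.
\<close>

lemma negative_subspace_dim_le_index:
  fixes q :: "'a::euclidean_space \<Rightarrow> real"
  assumes "has_index q k" "subspace N" "\<And>v. v \<in> N \<Longrightarrow> v \<noteq> 0 \<Longrightarrow> q v < 0"
  shows "dim N \<le> k"
proof -
  obtain P where P: "subspace P" "\<forall>v\<in>P. 0 \<le> q v" "k + dim P = DIM('a)"
    using assms(1) unfolding has_index_def by blast
  have "N \<inter> P \<subseteq> {0}" using assms(3) P(2) by force
  then have "dim (N \<inter> P) = 0" using dim_eq_0 by blast
  moreover have "dim {x + y |x y. x \<in> N \<and> y \<in> P} \<le> DIM('a)"
    by (rule dim_subset_UNIV)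
  ultimately show ?thesis
    using dim_sums_Int[OF assms(2) P(1)] P(3) by linarith
qed

text \<open>
  The image of a negative definite subspace under \<open>T\<close> is negative definite and
  \<open>T\<close> is injective on it. With \<open>T = id\<close> this is monotonicity of the index;
  used in both directions it is Sylvester's law of inertia, even between spaces of different
  dimensions.
\<close>

lemma has_index_le:
  fixes q :: "'a::euclidean_space \<Rightarrow> real" and q' :: "'b::euclidean_space \<Rightarrow> real"
  assumes q: "has_index q k" and q': "has_index q' k'" and lin: "linear T" and le: "\<And>v. q' (T v) \<le> q v"
  shows "k \<le> k'"
proof -
  obtain N where N: "subspace N" "\<forall>v\<in>N. v \<noteq> 0 \<longrightarrow> q v < 0" "dim N = k"
    using q unfolding has_index_def by blast
  have neg: "q' (T v) < 0" if "v \<in> N" "v \<noteq> 0" for v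
    using that N(2) le[of v] by fastforce
  have inj: "inj_on T N"
  proof (subst linear_inj_on_iff_eq_0[OF lin N(1)], intro ballI impI)
    fix v assume "v \<in> N" "T v = 0"
    moreover have "q' 0 = 0" using q' by (simp add: has_index_def)
    ultimately show "v = 0" using neg[of v] by force
  qed
  have "dim (T ` N) = k"
    using dim_image_eq[OF lin, of N] inj N(1,3) by (simp add: span_eq_iff[THEN iffD2])
  moreover have "q' w < 0" if "w \<in> T ` N" "w \<noteq> 0" for w
    using that neg linear_0[OF lin] by blast
  ultimately show ?thesis
    using negative_subspace_dim_le_index[OF q' linear_subspace_image[OF lin N(1)]] by simp
qed

lemma has_index_sum:
  assumes "has_index q k" "has_index q' k'"
  shows "has_index (\<lambda>(x,y). q x + q' y) (k + k')"
proof -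
  obtain N P where N: "subspace N" "subspace P" "\<forall>v\<in>N. v \<noteq> 0 \<longrightarrow> q v < 0" "\<forall>v\<in>P. 0 \<le> q v"
      "dim N = k" "dim N + dim P = DIM('a)"
    using assms(1) unfolding has_index_def by blast
  obtain N' P' where N': "subspace N'" "subspace P'" "\<forall>v\<in>N'. v \<noteq> 0 \<longrightarrow> q' v < 0" "\<forall>v\<in>P'. 0 \<le> q' v"
      "dim N' = k'" "dim N' + dim P' = DIM('b)"
    using assms(2) unfolding has_index_def by blast
  have "q 0 = 0" "q' 0 = 0" using assms by (auto simp: has_index_def)
  then have "\<forall>v\<in>N \<times> N'. v \<noteq> 0 \<longrightarrow> (case v of (x, y) \<Rightarrow> q x + q' y) < 0"
    using N(3) N'(3) by (auto simp: zero_prod_def) (metis add_neg_neg add.right_neutral add.left_neutral)+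
  moreover have "\<forall>v\<in>P \<times> P'. 0 \<le> (case v of (x, y) \<Rightarrow> q x + q' y)"
    using N(4) N'(4) by auto
  moreover have "dim (N \<times> N') = k + k'" "dim (N \<times> N') + dim (P \<times> P') = DIM('a \<times> 'b)"
    using N N' by (simp_all add: dim_Times)
  ultimately show ?thesis
    using N N' \<open>q 0 = 0\<close> \<open>q' 0 = 0\<close>
    by (intro has_indexI[of _ "N \<times> N'" "P \<times> P'"]) (auto simp: subspace_Times zero_prod_def)
qed

lemma has_index_nonneg:
  fixes q :: "'a::euclidean_space \<Rightarrow> real"
  assumes "q 0 = 0" "\<And>v. 0 \<le> q v"
  shows "has_index q 0"
  by (rule has_indexI[of q "{0}" UNIV]) (use assms in auto)

lemma has_index_symmetric_matrix:
  fixes A :: "real^'m^'m"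
  assumes sym: "transpose A = A"
  shows "has_index (\<lambda>v. v \<bullet> (A *v v)) (ind A)"
proof -
  obtain B and l :: "real^'m \<Rightarrow> real" where B: "pairwise orthogonal B" "0 \<notin> B" "independent B"
    "finite B" "span B = UNIV" "card B = CARD('m)" and l: "\<forall>b\<in>B. A *v b = l b *\<^sub>R b"
    using symmetric_matrix_diagonalization[OF sym] by metis
  note form = eigenbasis_form[OF sym B l]
  define N where "N = span {b\<in>B. l b < 0}"
  define P where "P = span {b\<in>B. \<not> l b < 0}"
  have 1: "v \<bullet> (A *v v) < 0" if v: "v \<in> N" "v \<noteq> 0" for v
  proof -
    obtain u where u: "v = (\<Sum>b\<in>B. u b *\<^sub>R b)" "v \<bullet> (A *v v) = (\<Sum>b\<in>B. l b * (u b)\<^sup>2 * (b \<bullet> b))"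
      "\<And>b. b \<in> B \<Longrightarrow> \<not> l b < 0 \<Longrightarrow> u b = 0"
      using form[of v] v(1) unfolding N_def by (elim exE conjE allE[of _ "\<lambda>b. l b < 0"]) auto
    obtain b where b: "b \<in> B" "u b \<noteq> 0"
      using v(2) u(1) by (metis (no_types, lifting) scaleR_zero_left sum.neutral)
    have "(\<Sum>b\<in>B. l b * (u b)\<^sup>2 * (b \<bullet> b)) < (\<Sum>b\<in>B. 0)"
    proof (rule sum_strict_mono_ex1[OF B(4)])
      show "\<forall>b\<in>B. l b * (u b)\<^sup>2 * (b \<bullet> b) \<le> 0"
      proof
        fix b assume "b \<in> B"
        then show "l b * (u b)\<^sup>2 * (b \<bullet> b) \<le> 0"
          using u(3)[of b] by (cases "l b < 0") (auto simp: mult_nonpos_nonneg)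
      qed
      have "l b < 0" "b \<noteq> 0" using b u(3) B(2) by auto
      then show "\<exists>b\<in>B. l b * (u b)\<^sup>2 * (b \<bullet> b) < 0"
        using b by (intro bexI[of _ b] mult_neg_pos) (auto intro: mult_neg_pos)
    qed
    then show ?thesis using u(2) by simp
  qed
  have 2: "0 \<le> v \<bullet> (A *v v)" if v: "v \<in> P" for v
  proof -
    obtain u where u: "v \<bullet> (A *v v) = (\<Sum>b\<in>B. l b * (u b)\<^sup>2 * (b \<bullet> b))"
      "\<And>b. b \<in> B \<Longrightarrow> \<not> \<not> l b < 0 \<Longrightarrow> u b = 0"
      using form[of v] v(1) unfolding P_def by (elim exE conjE allE[of _ "\<lambda>b. \<not> l b < 0"]) auto
    show ?thesis unfolding u(1)
    proof (rule sum_nonneg)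
      fix b assume "b \<in> B"
      then show "0 \<le> l b * (u b)\<^sup>2 * (b \<bullet> b)"
        using u(2)[of b] by (cases "l b < 0") auto
    qed
  qed
  have "card {b\<in>B. l b < 0} + card {b\<in>B. \<not> l b < 0} = card B"
    using B(4) by (subst card_Un_disjoint[symmetric]) (auto intro: arg_cong[of _ _ card])
  then have "dim N + dim P = DIM(real^'m)"
    using B(6) by (simp add: N_def P_def dim_span_sub_eigenbasis[OF sym B l] del: dim_span)
  moreover have "dim N = ind A"
    by (simp add: N_def dim_span_sub_eigenbasis[OF sym B l] ind_eq_card[OF sym B l] del: dim_span)
  ultimately show ?thesis
    using 1 2 by (intro has_indexI[of _ N P]) (auto simp: N_def P_def)
qed

lemma rank_eq_ind_add_ind_uminus:
  fixes A :: "real^'m^'m"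
  assumes sym: "transpose A = A"
  shows "rank A = ind A + ind (- A)"
proof -
  obtain B and l :: "real^'m \<Rightarrow> real" where B: "pairwise orthogonal B" "0 \<notin> B" "independent B"
    "finite B" "span B = UNIV" "card B = CARD('m)" and l: "\<forall>b\<in>B. A *v b = l b *\<^sub>R b"
    using symmetric_matrix_diagonalization[OF sym] by metis
  have sym': "transpose (- A) = - A"
    using sym by (simp add: transpose_def vec_eq_iff)
  have "(- A) *v v = - (A *v v)" for v
    using matrix_vector_mult_diff_rdistrib[of 0 A v] by simp
  then have l': "\<forall>b\<in>B. (- A) *v b = (- l b) *\<^sub>R b"
    using l by simp
  have "card {b\<in>B. l b \<noteq> 0} = card {b\<in>B. l b < 0} + card {b\<in>B. - l b < 0}"
    using B(4) by (subst card_Un_disjoint[symmetric]) (auto intro: arg_cong[of _ _ card])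
  then show ?thesis
    by (simp add: rank_eq_card[OF sym B l] ind_eq_card[OF sym B l] ind_eq_card[OF sym' B l'])
qed

section \<open>The Moore-Penrose inverse and a generalized Schur complement\<close>

lemma transpose_add: "transpose (A + B) = transpose A + transpose (B :: real^'n^'m)"
  and transpose_diff: "transpose (A - B) = transpose A - transpose (B :: real^'n^'m)"
  and transpose_minus: "transpose (- A) = - transpose (A :: real^'n^'m)"
  by (simp_all add: transpose_def vec_eq_iff)

lemma matrix_diff_ldistrib: "A ** (B - C) = A ** B - A ** (C :: real^'n^'m)"
  and matrix_diff_rdistrib: "(B' - C') ** A' = B' ** A' - C' ** (A' :: real^'n^'m)"
  and matrix_add_rdistrib: "(B' + C') ** A' = B' ** A' + C' ** (A' :: real^'n^'m)"
  and matrix_minus_left: "(- B') ** A' = - (B' ** (A' :: real^'n^'m))"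
  and matrix_minus_right: "B' ** (- A') = - (B' ** (A' :: real^'n^'m))"
  by (simp_all add: matrix_matrix_mult_def vec_eq_iff algebra_simps sum_subtractf sum.distrib sum_negf)

lemma matrix_vector_minus_left: "(- A) *v v = - (A *v (v :: real^'n))"
  using matrix_vector_mult_diff_rdistrib[of 0 A v] by simp

lemmas matrix_vector_linear = matrix_vector_right_distrib matrix_vector_mult_diff_distrib
  matrix_vector_mult_scaleR matrix_vector_mult_add_rdistrib matrix_vector_mult_diff_rdistrib
  matrix_vector_minus_left

lemma matrix_inv_cancel:
  assumes "invertible A"
  shows "A ** matrix_inv A = mat 1" "matrix_inv A ** A = mat 1"
proof -
  have "\<exists>B. A ** B = mat 1 \<and> B ** A = mat 1" using assms by (simp add: invertible_def)
  then have "A ** matrix_inv A = mat 1 \<and> matrix_inv A ** A = mat 1"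
    unfolding matrix_inv_def by (rule someI_ex)
  then show "A ** matrix_inv A = mat 1" "matrix_inv A ** A = mat 1" by auto
qed

text \<open>
  The projection is assembled from an orthonormal basis of \<open>V\<close>.
\<close>

lemma orthogonal_projection_exists:
  fixes V :: "(real^'m) set"
  assumes "subspace V"
  obtains P :: "real^'m^'m" where "transpose P = P" "\<And>x. P *v x \<in> V" "\<And>x. x \<in> V \<Longrightarrow> P *v x = x"
proof -
  obtain B where B: "B \<subseteq> V" "pairwise orthogonal B" "\<And>x. x \<in> B \<Longrightarrow> norm x = 1"
      "independent B" "card B = dim V" "span B = V"
    using orthonormal_basis_subspace[OF assms] by metis
  have fin: "finite B" using B(4) independent_imp_finite by blast
  define f where "f x = (\<Sum>b\<in>B. (b \<bullet> x) *\<^sub>R b)" for x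
  have lin: "linear f"
    by (rule linearI) (simp_all add: f_def inner_add_right scaleR_add_left sum.distrib
        scaleR_sum_right)
  have fx: "matrix f *v x = f x" for x
    using lin by (simp add: matrix_works)
  have sym: "x \<bullet> f y = f x \<bullet> y" for x y
    by (simp add: f_def inner_sum_right inner_sum_left inner_commute mult.commute)
  have adj: "transpose (matrix f) *v x = matrix f *v x" for x
  proof -
    have "(transpose (matrix f) *v x) \<bullet> y = (matrix f *v x) \<bullet> y" for y
      by (metis dot_matrix_transpose fx sym)
    then show ?thesis using vector_eq_rdot by blast
  qed
  have fb: "f b = b" if "b \<in> B" for b
  proof -
    have "f b = (\<Sum>x\<in>{b}. (x \<bullet> b) *\<^sub>R x)"
      unfolding f_def using that B(2) fin
      by (intro sum.mono_neutral_right) (auto simp: pairwise_def orthogonal_def)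
    also have "\<dots> = b" using B(3)[OF that] by (simp add: norm_eq_1)
    finally show ?thesis .
  qed
  show thesis
  proof (rule that[of "matrix f"])
    show "transpose (matrix f) = matrix f"
      using adj by (simp add: matrix_eq del: transpose_matrix_vector)
    show "matrix f *v x \<in> V" for x
      unfolding fx f_def using B(1) assms by (intro subspace_sum subspace_mul) auto
    show "matrix f *v x = x" if "x \<in> V" for x
    proof -
      have "x \<in> span B" using that B(6) by simp
      then have "f x = id x"
        using linear_eq_on[OF lin linear_id, of x B] fb by simp
      then show ?thesis by (simp add: fx)
    qed
  qed
qed

text \<open>
  Let \<open>P\<close> and \<open>T\<close> be the orthogonal projections onto the ranges of
  \<open>A\<close> and of its transpose, and let \<open>G\<close> invert \<open>A\<close> from the
  right on its range. Then \<open>B = T G P\<close> satisfies \<open>A B = P\<close> and \<open>B A =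
  T\<close>, from which all four Penrose equations can be read off.
\<close>

lemma penrose_exists:
  fixes A :: "real^'n^'m"
  shows "\<exists>B. A ** B ** A = A \<and> B ** A ** B = B \<and> transpose (A ** B) = A ** B \<and> transpose (B ** A) = B ** A"
proof -
  obtain P :: "real^'m^'m" where P: "transpose P = P" "\<And>x. P *v x \<in> range ((*v) A)"
      "\<And>x. x \<in> range ((*v) A) \<Longrightarrow> P *v x = x"
    using orthogonal_projection_exists[of "range ((*v) A)"]
    by (metis linear_subspace_image matrix_vector_mul_linear subspace_UNIV)
  obtain T :: "real^'n^'n" where T: "transpose T = T" "\<And>x. T *v x \<in> range ((*v) (transpose A))"
      "\<And>x. x \<in> range ((*v) (transpose A)) \<Longrightarrow> T *v x = x"
    using orthogonal_projection_exists[of "range ((*v) (transpose A))"]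
    by (metis linear_subspace_image matrix_vector_mul_linear subspace_UNIV)
  obtain g where g: "linear g" "\<forall>v\<in>range ((*v) A). A *v (g v) = v"
    using linear_exists_right_inverse_on[OF matrix_vector_mul_linear[of A] subspace_UNIV] by blast
  define G where "G = matrix g"
  have Gx: "G *v x = g x" for x using g(1) by (simp add: G_def matrix_works)
  have AT: "A ** T = A"
  proof -
    have "T ** transpose A = transpose A"
      unfolding matrix_eq
    proof
      fix x
      show "(T ** transpose A) *v x = transpose A *v x"
        using T(3)[of "transpose A *v x"]
        by (simp add: matrix_vector_mul_assoc[symmetric] del: transpose_matrix_vector)
    qed
    then show ?thesis
      by (metis T(1) matrix_transpose_mul transpose_transpose)
  qed
  have ker: "T *v x = 0" if "A *v x = 0" for x
  proof -
    obtain y where y: "T *v x = transpose A *v y" using T(2)[of x] by auto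
    have "(T *v x) \<bullet> (T *v x) = (A *v (T *v x)) \<bullet> y"
      by (subst (2) y) (metis dot_matrix_transpose transpose_transpose)
    also have "A *v (T *v x) = 0" using that AT by (simp add: matrix_vector_mul_assoc)
    finally show ?thesis by simp
  qed
  have AGP: "A ** G ** P = P"
    unfolding matrix_eq using bspec[OF g(2) P(2)] by (simp add: matrix_vector_mul_assoc[symmetric] Gx)
  have PA: "P ** A = A"
    unfolding matrix_eq using P(3) by (simp add: matrix_vector_mul_assoc[symmetric])
  have TGA: "T ** G ** A = T"
    unfolding matrix_eq
  proof
    fix x
    have "A *v (G *v (A *v x) - x) = 0"
      using g(2) by (simp add: Gx matrix_vector_mult_diff_distrib)
    then have "T *v (G *v (A *v x) - x) = 0" by (rule ker)
    then show "(T ** G ** A) *v x = T *v x"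
      by (simp add: matrix_vector_mul_assoc[symmetric] matrix_vector_mult_diff_distrib)
  qed
  have TT: "T ** T = T"
    unfolding matrix_eq using T(2,3) by (simp add: matrix_vector_mul_assoc[symmetric])
  define B where "B = T ** G ** P"
  have AB: "A ** B = P"
    unfolding B_def by (metis AGP AT matrix_mul_assoc)
  have BA: "B ** A = T"
    unfolding B_def by (metis PA TGA matrix_mul_assoc)
  have "B ** A ** B = B"
    unfolding BA unfolding B_def by (simp add: matrix_mul_assoc TT)
  then show ?thesis using AB BA PA P(1) T(1) by (intro exI[of _ B]) simp
qed

lemma penrose_equations:
  fixes A :: "real^'n^'m"
  shows "A ** pinv A ** A = A" "pinv A ** A ** pinv A = pinv A"
    "transpose (A ** pinv A) = A ** pinv A" "transpose (pinv A ** A) = pinv A ** A"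
proof -
  have "\<exists>!B. A ** B ** A = A \<and> B ** A ** B = B \<and> transpose (A ** B) = A ** B \<and> transpose (B ** A) = B ** A"
    using penrose_exists[of A] penrose_unique[of A] by blast
  from theI'[OF this] show "A ** pinv A ** A = A" "pinv A ** A ** pinv A = pinv A"
    "transpose (A ** pinv A) = A ** pinv A" "transpose (pinv A ** A) = pinv A ** A"
    unfolding pinv_def by blast+
qed

lemma has_index_minus_projection:
  fixes R :: "real^'m^'m"
  assumes "transpose R = R" "R ** R = R" "c > 0"
  shows "has_index (\<lambda>h. - (c * (h \<bullet> (R *v h)))) (rank R)"
proof -
  have RR: "R *v (R *v x) = R *v x" for x
    by (simp add: matrix_vector_mul_assoc assms(2))
  have form: "h \<bullet> (R *v h) = (R *v h) \<bullet> (R *v h)" for h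
    by (metis RR assms(1) dot_symmetric_matrix)
  define P where "P = {y \<in> UNIV. \<forall>x \<in> range ((*v) R). orthogonal x y}"
  have "dim P + dim (range ((*v) R)) = dim (UNIV :: (real^'m) set)"
    unfolding P_def by (rule dim_subspace_orthogonal_to_vectors) (auto intro: linear_subspace_image)
  moreover have P0: "R *v y = 0" if "y \<in> P" for y
    using that by (auto simp: P_def orthogonal_def) (metis assms(1) dot_symmetric_matrix vector_eq_ldot inner_zero_right)
  moreover have "subspace P"
    unfolding P_def by (auto simp: subspace_def orthogonal_def inner_add_right)
  ultimately show ?thesis
    using assms(3)
    by (intro has_indexI[of _ "range ((*v) R)" P])
      (auto simp: form rank_dim_range RR intro: linear_subspace_image)
qed

lemma linear_pair_fun:
  assumes "linear f" "linear g"
  shows "linear (\<lambda>x. (f x, g x))"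
  using assms by (auto simp: linear_iff)

lemma isotropic_dot:
  fixes X U :: "real^'m^'m"
  assumes "transpose X ** U = transpose U ** X"
  shows "(X *v x) \<bullet> (U *v y) = (U *v x) \<bullet> (X *v y)"
proof -
  have "(X *v x) \<bullet> (U *v y) = x \<bullet> ((transpose X ** U) *v y)"
    by (metis dot_matrix_transpose matrix_vector_mul_assoc transpose_transpose)
  also have "\<dots> = (U *v x) \<bullet> (X *v y)"
    by (metis assms dot_matrix_transpose matrix_vector_mul_assoc transpose_transpose)
  finally show ?thesis .
qed

lemma isotropic_quotient_symmetric:
  fixes X U :: "real^'m^'m"
  assumes iso: "transpose X ** U = transpose U ** X" and inv: "invertible U"
  shows "transpose (X ** matrix_inv U) = X ** matrix_inv U"
proof -
  let ?V = "matrix_inv U"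
  have UV: "U *v (?V *v x) = x" for x
    by (simp add: matrix_vector_mul_assoc matrix_inv_cancel[OF inv])
  have "(transpose (X ** ?V) *v x) \<bullet> y = ((X ** ?V) *v x) \<bullet> y" for x y
  proof -
    have "(transpose (X ** ?V) *v x) \<bullet> y = x \<bullet> (X *v (?V *v y))"
      by (metis dot_matrix_transpose matrix_vector_mul_assoc)
    also have "\<dots> = (X *v (?V *v x)) \<bullet> y"
      using isotropic_dot[OF iso, of "?V *v x" "?V *v y"] by (simp add: UV)
    finally show ?thesis by (simp add: matrix_vector_mul_assoc)
  qed
  then have "transpose (X ** ?V) *v x = (X ** ?V) *v x" for x
    using vector_eq_rdot by blast
  then show ?thesis by (simp add: matrix_eq del: transpose_matrix_vector)
qed

text \<open>
  The generalized Schur complement formula for the inertia of the block form with matrix \<open>(Q,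
  Q'; Q', Q')\<close>. Evaluated at \<open>(x, U' y)\<close> this form is \<open>q x y = x \<bullet> Q
  x + 2 (x \<bullet> X' y) + U' y \<bullet> X' y\<close>.

  On one hand, in the variables \<open>x\<close> and \<open>x + U' y\<close> it is the direct sum
  \<open>qA\<close> of the forms of \<open>Q - Q'\<close> and \<open>Q'\<close>. On the other hand,
  eliminating the cross term by completing the square is possible only up to the part \<open>M\<close>
  of \<open>X'\<close> that is orthogonal to the range of \<open>X\<close>. What remains is
  \<open>Q\<close>, a cross term \<open>2 (x \<bullet> M y)\<close>, which is hyperbolic and
  contributes \<open>rank M\<close>, and the Schur complement \<open>D\<close> on the kernel of
  \<open>M\<close>; this is the form \<open>qB\<close>. Linear maps in both directions show that
  \<open>qA\<close> and \<open>qB\<close> have the same index.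
\<close>

lemma generalized_schur_inertia:
  fixes X U X' U' :: "real^'m^'m"
  assumes iso: "transpose X ** U = transpose U ** X" and iso': "transpose X' ** U' = transpose U' ** X'"
    and inv: "invertible U" and inv': "invertible U'"
  defines "M \<equiv> (mat 1 - X ** pinv X) ** X'"
  defines "T \<equiv> mat 1 - pinv M ** M"
  defines "D \<equiv> T ** transpose (transpose X ** U' - transpose U ** X') ** pinv X ** X' ** T"
  defines "Q \<equiv> X ** matrix_inv U" and "Q' \<equiv> X' ** matrix_inv U'"
  shows "rank M + ind D + ind Q = ind (Q - Q') + ind Q'"
proof -
  define G where "G = pinv X"
  define P where "P = X ** G"
  define H where "H = pinv M"
  define R where "R = M ** H"
  define V where "V = matrix_inv U"
  define V' where "V' = matrix_inv U'"
  \<comment> \<open>\<open>K\<close> is the shift that completes the square, \<open>E\<close> the Schur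
    complement that it leaves.\<close>
  define K where "K = U ** G ** X'"
  define E where "E = transpose K ** Q ** K - transpose K ** X' - transpose X' ** K + transpose U' ** X'"
  have symQ: "transpose Q = Q" and symQ': "transpose Q' = Q'"
    unfolding Q_def Q'_def using isotropic_quotient_symmetric iso iso' inv inv' by blast+
  have symP: "transpose P = P" and PX: "P ** X = X"
    unfolding P_def G_def using penrose_equations by blast+
  have symR: "transpose R = R" and RM: "R ** M = M"
    unfolding R_def H_def using penrose_equations by blast+
  have RR: "R ** R = R" unfolding R_def by (metis RM R_def matrix_mul_assoc)
  have symHM: "transpose (H ** M) = H ** M" and HMH: "H ** M ** H = H" and MHM: "M ** H ** M = M"
    unfolding H_def using penrose_equations by blast+
  have T: "T = mat 1 - H ** M" by (simp add: T_def H_def)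
  have symT: "transpose T = T" by (simp add: T transpose_diff symHM)
  have MT: "M ** T = 0" by (simp add: T matrix_diff_ldistrib matrix_mul_assoc MHM)
  have TH: "T ** H = 0" by (simp add: T matrix_diff_rdistrib HMH)
  have TT: "T ** T = T"
    by (subst (2) T) (simp add: matrix_diff_ldistrib matrix_mul_assoc TH)
  have PP: "P ** P = P" by (metis P_def PX matrix_mul_assoc)
  have M: "M = X' - P ** X'" by (simp add: M_def P_def G_def matrix_diff_rdistrib)
  have PM: "P ** M = 0" by (simp add: M matrix_diff_ldistrib matrix_mul_assoc PP)
  have PR: "P ** R = 0" by (simp add: R_def matrix_mul_assoc PM)
  have UV: "U ** V = mat 1" "V ** U = mat 1" unfolding V_def by (simp_all add: matrix_inv_cancel[OF inv])
  have UV': "U' ** V' = mat 1" "V' ** U' = mat 1" unfolding V'_def by (simp_all add: matrix_inv_cancel[OF inv'])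
  have PQ: "P ** Q = Q" by (simp add: Q_def matrix_mul_assoc PX)
  have QP: "Q ** P = Q" by (metis PQ matrix_transpose_mul symP symQ)
  have QR: "Q ** R = 0"
    by (metis PR QP matrix_mul_assoc times0_right)
  have QK: "Q ** K = P ** X'"
    by (metis K_def P_def Q_def UV(2) V_def matrix_mul_assoc matrix_mul_rid)
  have symE: "transpose E = E"
    by (simp add: E_def transpose_add transpose_diff matrix_transpose_mul matrix_mul_assoc symQ iso')
  have PXT: "P ** X' ** T = X' ** T"
    using MT by (simp add: M matrix_diff_rdistrib)
  have D: "D = T ** E ** T"
  proof -
    have "transpose K ** Q ** K ** T = transpose K ** X' ** T"
      by (metis PXT QK matrix_mul_assoc)
    then have "E ** T = transpose U' ** X' ** T - transpose X' ** K ** T"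
      by (simp add: E_def matrix_diff_rdistrib matrix_add_rdistrib)
    also have "transpose U' ** X' ** T = transpose U' ** X ** G ** X' ** T"
      by (metis PXT P_def matrix_mul_assoc)
    finally have "E ** T = transpose (transpose X ** U' - transpose U ** X') ** G ** X' ** T"
      by (simp add: transpose_diff matrix_transpose_mul matrix_diff_rdistrib K_def matrix_mul_assoc)
    then show ?thesis
      unfolding D_def G_def[symmetric] by (metis matrix_mul_assoc)
  qed
  have symD: "transpose D = D" by (simp add: D matrix_transpose_mul symT symE matrix_mul_assoc)
  have rankR: "rank R = rank M"
    by (metis RM R_def le_antisym rank_mul_le_left)
  define qA where "qA = (\<lambda>(a :: real^'m, b :: real^'m). a \<bullet> ((Q - Q') *v a) + b \<bullet> (Q' *v b))"
  \<comment> \<open>The form \<open>qB\<close> lives on four copies of the space: the hyperbolic cross term is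
    split into a positive half (variable \<open>g\<close>) and a negative half (variable \<open>h\<close>) on the
    range of \<open>M\<close>.\<close>
  define qB where "qB = (\<lambda>(p :: real^'m, w). p \<bullet> (Q *v p) + (\<lambda>(g :: real^'m, w). (1/2) * (g \<bullet> (R *v g))
    + (\<lambda>(h :: real^'m, t :: real^'m). - ((1/2) * (h \<bullet> (R *v h))) + t \<bullet> (D *v t)) w) w)"
  have "transpose (Q - Q') = Q - Q'" by (simp add: transpose_diff symQ symQ')
  then have indA: "has_index qA (ind (Q - Q') + ind Q')"
    unfolding qA_def by (intro has_index_sum has_index_symmetric_matrix symQ')
  have Rvv: "R *v (R *v x) = R *v x" for x by (simp add: matrix_vector_mul_assoc RR)
  have Rnn: "0 \<le> g \<bullet> (R *v g)" for g
    by (metis Rvv dot_symmetric_matrix inner_ge_zero symR)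
  have "has_index (\<lambda>h. - ((1/2) * (h \<bullet> (R *v h)))) (rank M)"
    using has_index_minus_projection[OF symR RR, of "1/2"] rankR by simp
  then have indB: "has_index qB (ind Q + (0 + (rank M + ind D)))"
    unfolding qB_def using Rnn
    by (intro has_index_sum has_index_symmetric_matrix symQ symD has_index_nonneg) auto
  define q where "q x y = x \<bullet> (Q *v x) + 2 * (x \<bullet> (X' *v y)) + (U' *v y) \<bullet> (X' *v y)" for x y
  define q3 where "q3 x y = x \<bullet> (Q *v x) + 2 * (x \<bullet> (M *v y)) + y \<bullet> (D *v y)" for x y
  \<comment> \<open>A second shift, inside the kernel of \<open>Q\<close>, uses the cross term with
    \<open>M\<close> to cut \<open>E\<close> down to \<open>D = T E T\<close>.\<close>
  define s where "s y = (1/2) *\<^sub>R ((mat 1 - P) *v (transpose H *v (E *v (y + T *v y))))" for y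
  have lin_s: "linear s"
    unfolding s_def
    by (rule linearI) (simp_all add: matrix_vector_linear scaleR_add_right scaleR_diff_right algebra_simps del: transpose_matrix_vector)
  have qA_q: "qA (x, x + U' *v y) = q x y" for x y
  proof -
    have QU: "Q' *v (U' *v y) = X' *v y" for y
      by (metis Q'_def UV'(2) V'_def matrix_mul_assoc matrix_mul_rid matrix_vector_mul_assoc)
    have "(U' *v y) \<bullet> (Q' *v x) = x \<bullet> (X' *v y)"
      by (metis QU dot_symmetric_matrix inner_commute symQ')
    then show ?thesis
      by (simp add: qA_def q_def matrix_vector_linear inner_add_left inner_add_right inner_diff_right QU)
  qed
  have shift1: "q (x - K *v y) y = x \<bullet> (Q *v x) + 2 * (x \<bullet> (M *v y)) + y \<bullet> (E *v y)" for x y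
  proof -
    have QKy: "Q *v (K *v y) = P *v (X' *v y)" for y
      by (simp add: matrix_vector_mul_assoc QK)
    have My: "M *v y = X' *v y - P *v (X' *v y)"
      by (simp add: M matrix_vector_linear matrix_vector_mul_assoc)
    have Ey: "y \<bullet> (E *v y) = (K *v y) \<bullet> (Q *v (K *v y)) - 2 * ((K *v y) \<bullet> (X' *v y)) + (U' *v y) \<bullet> (X' *v y)"
    proof -
      have tr: "y \<bullet> ((transpose A ** B) *v y) = (A *v y) \<bullet> (B *v y)" for A B :: "real^'m^'m"
        by (metis dot_matrix_transpose matrix_vector_mul_assoc transpose_transpose)
      have "y \<bullet> (E *v y) = y \<bullet> ((transpose K ** (Q ** K)) *v y) - y \<bullet> ((transpose K ** X') *v y)
          - y \<bullet> ((transpose X' ** K) *v y) + y \<bullet> ((transpose U' ** X') *v y)"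
        by (simp add: E_def matrix_vector_linear inner_add_right inner_diff_right matrix_mul_assoc)
      then show ?thesis
        unfolding tr by (simp add: matrix_vector_mul_assoc[symmetric] inner_commute)
    qed
    have "(K *v y) \<bullet> (Q *v x) = x \<bullet> (Q *v (K *v y))"
      by (metis dot_symmetric_matrix inner_commute symQ)
    then show ?thesis
      unfolding Ey My q_def by (simp add: matrix_vector_linear inner_add_left inner_add_right inner_diff_right
          inner_diff_left QKy algebra_simps)
  qed
  have shift2: "(x - s y) \<bullet> (Q *v (x - s y)) + 2 * ((x - s y) \<bullet> (M *v y)) + y \<bullet> (E *v y) = q3 x y" for x y
  proof -
    have Qs: "Q *v s y = 0"
    proof -
      have "Q *v ((mat 1 - P) *v z) = 0" for z
        by (simp add: matrix_vector_mul_assoc matrix_diff_ldistrib QP)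
      then show ?thesis by (simp add: s_def matrix_vector_mult_scaleR)
    qed
    have "(x - s y) \<bullet> (Q *v (x - s y)) = x \<bullet> (Q *v x)"
      using Qs by (simp add: matrix_vector_linear inner_diff_left) (metis Qs dot_symmetric_matrix inner_zero_left symQ)
    moreover have "2 * (s y \<bullet> (M *v y)) = y \<bullet> (E *v y) - y \<bullet> (D *v y)"
    proof -
      have PMy: "P *v (M *v y) = 0" by (simp add: matrix_vector_mul_assoc PM)
      have "((mat 1 - P) *v z) \<bullet> (M *v y) = z \<bullet> (M *v y)" for z
        by (simp add: matrix_vector_linear inner_diff_left) (metis PMy dot_symmetric_matrix inner_zero_right symP)
      then have "2 * (s y \<bullet> (M *v y)) = (transpose H *v (E *v (y + T *v y))) \<bullet> (M *v y)"
        by (simp add: s_def del: transpose_matrix_vector)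
      also have "\<dots> = (E *v (y + T *v y)) \<bullet> (y - T *v y)"
        by (metis T add_diff_cancel_left' diff_add_cancel dot_matrix_transpose matrix_vector_mul_assoc
            matrix_vector_mul_lid matrix_vector_mult_diff_rdistrib)
      also have "\<dots> = y \<bullet> (E *v y) - (T *v y) \<bullet> (E *v (T *v y))"
        using dot_symmetric_matrix[OF symE, of y "T *v y"]
        by (simp add: matrix_vector_linear inner_diff_left inner_diff_right inner_add_left inner_add_right inner_commute)
      also have "(T *v y) \<bullet> (E *v (T *v y)) = y \<bullet> (D *v y)"
        by (metis D dot_symmetric_matrix matrix_vector_mul_assoc symT)
      finally show ?thesis .
    qed
    ultimately show ?thesis by (simp add: q3_def inner_diff_left)
  qed
  have q_q3: "q (x - s y - K *v y) y = q3 x y" for x y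
    using shift1[of "x - s y" y] shift2[of x y] by simp
  \<comment> \<open>The two maps between the coordinates of \<open>q3\<close> and those of \<open>qB\<close>;
    they use \<open>x \<bullet> M y = (\<bar>R x + M y\<bar>\<^sup>2 - \<bar>R x - M y\<bar>\<^sup>2) / 4\<close>
    for the projection \<open>R\<close> onto the range of \<open>M\<close>.\<close>
  have into: "qB (x, x + M *v y, x - M *v y, y) = q3 x y" for x y
  proof -
    have "R *v (M *v y) = M *v y" by (simp add: matrix_vector_mul_assoc RM)
    moreover from this have "(M *v y) \<bullet> (R *v x) = x \<bullet> (M *v y)"
      by (metis dot_symmetric_matrix inner_commute symR)
    ultimately show ?thesis
      by (simp add: qB_def q3_def matrix_vector_linear inner_add_left inner_add_right inner_diff_left
          inner_diff_right field_simps)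
  qed
  define fx where "fx = (\<lambda>(p, g, h, t :: real^'m). P *v p + (1/2) *\<^sub>R (R *v (g + h)))"
  define fy where "fy = (\<lambda>(p :: real^'m, g, h, t). (1/2) *\<^sub>R (H *v (g - h)) + T *v t)"
  have lin_fx: "linear fx" and lin_fy: "linear fy"
    unfolding fx_def fy_def
    by (rule linearI; auto simp: matrix_vector_linear scaleR_add_right scaleR_diff_right algebra_simps)+
  have outof: "q3 (fx v) (fy v) = qB v" for v
  proof -
    obtain p g h t where v: "v = (p, g, h, t)" by (metis surj_pair)
    let ?x = "fx v" and ?y = "fy v"
    have x: "?x = P *v p + (1/2) *\<^sub>R (R *v (g + h))" and y: "?y = (1/2) *\<^sub>R (H *v (g - h)) + T *v t"
      by (simp_all add: fx_def fy_def v)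
    have My: "M *v ?y = (1/2) *\<^sub>R (R *v (g - h))"
      unfolding y by (simp add: matrix_vector_linear(1,3) matrix_vector_mul_assoc MT R_def)
    have Qx: "Q *v ?x = Q *v p"
      unfolding x by (simp add: matrix_vector_linear(1,3) matrix_vector_mul_assoc QP QR)
    have "?x \<bullet> (Q *v ?x) = p \<bullet> (Q *v p)"
      by (metis Qx dot_symmetric_matrix inner_commute symQ)
    moreover have "2 * (?x \<bullet> (M *v ?y)) = (1/2) * (g \<bullet> (R *v g)) - (1/2) * (h \<bullet> (R *v h))"
    proof -
      have "(P *v p) \<bullet> (R *v (g - h)) = 0"
        by (metis PR dot_symmetric_matrix inner_zero_right matrix_vector_mul_assoc matrix_vector_mult_0 symP)
      then have "2 * (?x \<bullet> (M *v ?y)) = (1/2) * ((R *v (g + h)) \<bullet> (R *v (g - h)))"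
        unfolding My x by (simp add: inner_add_left)
      also have "(R *v (g + h)) \<bullet> (R *v (g - h)) = (g + h) \<bullet> (R *v (g - h))"
        by (metis Rvv dot_symmetric_matrix symR)
      also have "\<dots> = g \<bullet> (R *v g) - h \<bullet> (R *v h)"
        using dot_symmetric_matrix[OF symR, of g h]
        by (simp add: matrix_vector_linear inner_diff_left inner_diff_right inner_add_left inner_add_right inner_commute)
      finally show ?thesis by (simp add: field_simps)
    qed
    moreover have "?y \<bullet> (D *v ?y) = t \<bullet> (D *v t)"
    proof -
      have Ty: "T *v ?y = T *v t"
        unfolding y by (simp add: matrix_vector_linear(1,3) matrix_vector_mul_assoc TH TT)
      have "z \<bullet> (D *v z) = (T *v z) \<bullet> (E *v (T *v z))" for z
        by (metis D dot_symmetric_matrix matrix_vector_mul_assoc symT)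
      then show ?thesis using Ty by simp
    qed
    ultimately show ?thesis by (simp add: q3_def qB_def v)
  qed
  have "ind Q + (0 + (rank M + ind D)) \<le> ind (Q - Q') + ind Q'"
  proof (rule has_index_le[OF indB indA])
    define x' where "x' v = fx v - s (fy v) - K *v fy v" for v
    have "linear x'"
      unfolding x'_def using lin_fx lin_fy lin_s
      by (intro linear_compose_sub linear_compose[unfolded o_def, OF lin_fy]) auto
    then show "linear (\<lambda>v. (x' v, x' v + U' *v fy v))"
      using lin_fy by (intro linear_pair_fun linear_compose_add linear_compose[unfolded o_def, OF lin_fy]) auto
    show "qA (x' v, x' v + U' *v fy v) \<le> qB v" for v
      unfolding qA_q unfolding x'_def q_q3 outof by simp
  qed
  moreover have "ind (Q - Q') + ind Q' \<le> ind Q + (0 + (rank M + ind D))"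
  proof (rule has_index_le[OF indA indB])
    define y where "y v = V' *v (snd v - fst v)" for v :: "(real^'m) \<times> (real^'m)"
    define x where "x v = fst v + K *v y v + s (y v)" for v
    have lin_y: "linear y" and lin_y2: "linear (\<lambda>v. M *v y v)" and lin_y3: "linear (\<lambda>v. K *v y v)"
      unfolding y_def by (rule linearI; simp add: matrix_vector_linear algebra_simps)+
    have lin_x: "linear x"
      unfolding x_def using lin_y3 lin_s lin_y
      by (intro linear_compose_add linear_compose[unfolded o_def, OF lin_y] linear_fst) auto
    show "linear (\<lambda>v. (x v, x v + M *v y v, x v - M *v y v, y v))"
      using lin_x lin_y lin_y2 by (intro linear_pair_fun linear_compose_add linear_compose_sub)
    show "qB (x v, x v + M *v y v, x v - M *v y v, y v) \<le> qA v" for v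
    proof -
      have "x v - s (y v) - K *v y v = fst v" by (simp add: x_def)
      then have "q3 (x v) (y v) = q (fst v) (y v)" using q_q3[of "x v" "y v"] by simp
      also have "\<dots> = qA v"
        unfolding qA_q[symmetric] by (simp add: y_def matrix_vector_mul_assoc UV')
      finally show ?thesis unfolding into by simp
    qed
  qed
  ultimately show ?thesis by linarith
qed

section \<open>Rank drops along nondecreasing symmetric matrices\<close>

lemma ind_mono:
  fixes A B :: "real^'m^'m"
  assumes "transpose A = A" "transpose B = B" "\<And>v. v \<bullet> (A *v v) \<le> v \<bullet> (B *v v)"
  shows "ind B \<le> ind A"
  using has_index_le[OF has_index_symmetric_matrix[OF assms(2)] has_index_symmetric_matrix[OF assms(1)] linear_id]
    assms(3) by simp

lemma ind_le_CARD:
  fixes A :: "real^'m^'m"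
  assumes "transpose A = A"
  shows "ind A \<le> CARD('m)"
  using has_index_symmetric_matrix[OF assms] unfolding has_index_def
  by (auto simp: DIM_cart)

lemma abs_quadratic_form_le:
  fixes B :: "real^'m^'m"
  shows "\<bar>v \<bullet> (B *v v)\<bar> \<le> (\<Sum>i\<in>UNIV. norm (B $ i)) * (norm v)\<^sup>2"
proof -
  have "norm (B *v v) \<le> (\<Sum>i\<in>UNIV. \<bar>(B *v v) $ i\<bar>)"
    by (rule norm_le_l1_cart)
  also have "\<dots> \<le> (\<Sum>i\<in>UNIV. norm (B $ i) * norm v)"
    by (intro sum_mono) (simp add: matrix_vector_mul_component Cauchy_Schwarz_ineq2)
  finally have "norm (B *v v) \<le> (\<Sum>i\<in>UNIV. norm (B $ i)) * norm v"
    by (simp add: sum_distrib_right)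
  then have "norm v * norm (B *v v) \<le> norm v * ((\<Sum>i\<in>UNIV. norm (B $ i)) * norm v)"
    by (intro mult_left_mono) auto
  moreover have "\<bar>v \<bullet> (B *v v)\<bar> \<le> norm v * norm (B *v v)"
    by (rule Cauchy_Schwarz_ineq2)
  ultimately show ?thesis by (simp add: power2_eq_square mult_ac)
qed

text \<open>
  A form that is negative definite on a subspace is at most some \<open>-e < 0\<close> on its compact
  unit sphere, and a perturbation smaller than \<open>e\<close> does not change the sign.
\<close>

lemma ind_lower_semicontinuous:
  fixes Q :: "'b \<Rightarrow> real^'m^'m"
  assumes lim: "(Q \<longlongrightarrow> A) F" and symA: "transpose A = A"
    and sym: "eventually (\<lambda>s. transpose (Q s) = Q s) F"
  shows "eventually (\<lambda>s. ind A \<le> ind (Q s)) F"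
proof -
  obtain N where N: "subspace N" "\<And>v. v \<in> N \<Longrightarrow> v \<noteq> 0 \<Longrightarrow> v \<bullet> (A *v v) < 0" "dim N = ind A"
    using has_index_symmetric_matrix[OF symA] unfolding has_index_def by blast
  define K where "K = sphere 0 1 \<inter> N"
  have "\<exists>e>0. \<forall>v\<in>K. v \<bullet> (A *v v) \<le> - e"
  proof (cases "K = {}")
    case False
    have "compact K"
      unfolding K_def by (intro compact_Int_closed closed_subspace N) simp
    moreover have "continuous_on K (\<lambda>v. v \<bullet> (A *v v))"
      by (intro continuous_intros linear_continuous_on linear_conv_bounded_linear[THEN iffD1]) simp
    ultimately obtain u where u: "u \<in> K" "\<And>v. v \<in> K \<Longrightarrow> v \<bullet> (A *v v) \<le> u \<bullet> (A *v u)"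
      using False continuous_attains_sup[of K "\<lambda>v. v \<bullet> (A *v v)"] by blast
    moreover have "u \<bullet> (A *v u) < 0" using u(1) N(2)[of u] by (cases "u = 0") (auto simp: K_def)
    ultimately show ?thesis by (intro exI[of _ "- (u \<bullet> (A *v u))"]) auto
  qed (auto intro: exI[of _ 1])
  then obtain e where e: "e > 0" "\<And>v. v \<in> K \<Longrightarrow> v \<bullet> (A *v v) \<le> - e" by blast
  have "((\<lambda>s. \<Sum>i\<in>UNIV. norm ((Q s - A) $ i)) \<longlongrightarrow> (\<Sum>i\<in>UNIV. norm ((A - A) $ i))) F"
    by (intro tendsto_intros lim)
  then have "((\<lambda>s. \<Sum>i\<in>UNIV. norm ((Q s - A) $ i)) \<longlongrightarrow> 0) F" by simp
  then have "eventually (\<lambda>s. (\<Sum>i\<in>UNIV. norm ((Q s - A) $ i)) < e) F"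
    using e(1) by (rule order_tendstoD)
  with sym show ?thesis
  proof eventually_elim
    case (elim s)
    have "v \<bullet> (Q s *v v) < 0" if v: "v \<in> N" "v \<noteq> 0" for v
    proof -
      have "(1 / norm v) *\<^sub>R v \<in> K" using v N(1) by (simp add: K_def subspace_mul)
      from e(2)[OF this] have "(v \<bullet> (A *v v)) / (norm v)\<^sup>2 \<le> - e"
        by (simp add: matrix_vector_mult_scaleR power2_eq_square)
      then have 1: "v \<bullet> (A *v v) \<le> - e * (norm v)\<^sup>2"
        using v by (simp add: field_simps)
      have "v \<bullet> ((Q s - A) *v v) \<le> (\<Sum>i\<in>UNIV. norm ((Q s - A) $ i)) * (norm v)\<^sup>2"
        using abs_quadratic_form_le[of v "Q s - A"] by linarith
      also have "\<dots> < e * (norm v)\<^sup>2"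
        using elim(2) v by (intro mult_strict_right_mono) auto
      finally show ?thesis
        using 1 by (simp add: matrix_vector_mult_diff_rdistrib inner_diff_right)
    qed
    then show ?case
      using negative_subspace_dim_le_index[OF has_index_symmetric_matrix[OF elim(1)] N(1)] N(3) by simp
  qed
qed

text \<open>
  \<open>theta\<close> and \<open>rho\<close> are both of this form. The rank may also rise at a
  point, but only from its value at the point to the values on the right of it, and such rises are not
  recorded here.
\<close>

definition left_drop :: "(real \<Rightarrow> nat) \<Rightarrow> real \<Rightarrow> int" where
  "left_drop r t = int (Lim (at_left t) r) - int (r t)"

definition drop_points :: "(real \<Rightarrow> nat) \<Rightarrow> real \<Rightarrow> real \<Rightarrow> real set" where
  "drop_points r a b = {t. a < t \<and> t \<le> b \<and> left_drop r t \<noteq> 0}"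

definition total_drop :: "(real \<Rightarrow> nat) \<Rightarrow> real \<Rightarrow> real \<Rightarrow> int" where
  "total_drop r a b = (\<Sum>t\<in>drop_points r a b. left_drop r t)"

text \<open>
  \<open>Lim\<close> and sums over infinite sets have default values; regularity says that
  \<open>total_drop\<close> is the genuine sum of genuine limits, and that no summand is negative.
\<close>

definition drop_regular :: "(real \<Rightarrow> nat) \<Rightarrow> real \<Rightarrow> real \<Rightarrow> bool" where
  "drop_regular r a b \<longleftrightarrow> finite (drop_points r a b) \<and>
     (\<forall>t. a < t \<and> t \<le> b \<longrightarrow> (\<exists>l. (r \<longlongrightarrow> l) (at_left t)) \<and> 0 \<le> left_drop r t)"

lemma left_drop_eq:
  assumes "eventually (\<lambda>s. r s = l) (at_left t)"
  shows "left_drop r t = int l - int (r t)" "(r \<longlongrightarrow> l) (at_left t)"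
proof -
  show "(r \<longlongrightarrow> l) (at_left t)"
    using assms by (simp add: tendsto_discrete)
  then have "Lim (at_left t) r = l" by (intro tendsto_Lim) auto
  then show "left_drop r t = int l - int (r t)" by (simp add: left_drop_def)
qed

lemma drop_regular_combine:
  assumes "drop_regular r a b" "drop_regular r b c" "a \<le> b" "b \<le> c"
  shows "drop_regular r a c" "total_drop r a c = total_drop r a b + total_drop r b c"
proof -
  have eq: "drop_points r a c = drop_points r a b \<union> drop_points r b c"
    using assms(3,4) by (auto simp: drop_points_def)
  have dis: "drop_points r a b \<inter> drop_points r b c = {}"
    by (auto simp: drop_points_def)
  have fin: "finite (drop_points r a b)" "finite (drop_points r b c)"
    using assms by (auto simp: drop_regular_def)
  show "total_drop r a c = total_drop r a b + total_drop r b c"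
    unfolding total_drop_def eq using sum.union_disjoint[OF fin dis] .
  show "drop_regular r a c"
    unfolding drop_regular_def eq using fin assms by (auto simp: drop_regular_def not_le dest: leI)
qed

text \<open>
  Two functions that differ near each point from the left by a constant have the same drops. The
  constant may depend on the point: it can change immediately to the right of it.
\<close>

lemma drop_cong:
  assumes reg: "drop_regular r a b" and lim: "\<And>t. a < t \<Longrightarrow> t \<le> b \<Longrightarrow> \<exists>p. r' t = r t + p \<and> eventually (\<lambda>s. r' s = r s + p) (at_left t)"
  shows "drop_regular r' a b" "total_drop r' a b = total_drop r a b"
proof -
  have *: "left_drop r' t = left_drop r t \<and> (\<exists>l. (r' \<longlongrightarrow> l) (at_left t))" if t: "a < t" "t \<le> b" for t
  proof -
    obtain p where p: "r' t = r t + p" "eventually (\<lambda>s. r' s = r s + p) (at_left t)"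
      using lim[OF t] by blast
    obtain l where "(r \<longlongrightarrow> l) (at_left t)" using reg t by (auto simp: drop_regular_def)
    then have l: "eventually (\<lambda>s. r s = l) (at_left t)" by (simp add: tendsto_discrete)
    have "eventually (\<lambda>s. r' s = l + p) (at_left t)"
      using l p(2) by eventually_elim simp
    from left_drop_eq[OF this] left_drop_eq[OF l] show ?thesis using p(1) by auto
  qed
  then have eq: "drop_points r' a b = drop_points r a b" by (auto simp: drop_points_def)
  show "drop_regular r' a b"
    using reg * by (auto simp: drop_regular_def eq)
  show "total_drop r' a b = total_drop r a b"
    unfolding total_drop_def eq by (intro sum.cong refl) (use * in \<open>auto simp: drop_points_def\<close>)
qed

lemma eventually_at_left_interval:
  assumes "a < (t::real)"
  shows "eventually (\<lambda>s. a < s \<and> s < t) (at_left t)"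
  using eventually_at_left_real[OF assms] by eventually_elim auto

lemma antitone_eventually_const_left:
  fixes f :: "real \<Rightarrow> nat"
  assumes anti: "\<And>s t. a \<le> s \<Longrightarrow> s \<le> t \<Longrightarrow> t \<le> b \<Longrightarrow> f t \<le> f s" and t: "a < t" "t \<le> b"
  obtains c where "a \<le> c" "c < t" "\<And>s. c \<le> s \<Longrightarrow> s < t \<Longrightarrow> f s = f c" "f t \<le> f c"
proof -
  define l where "l = (LEAST n. \<exists>s. a \<le> s \<and> s < t \<and> f s = n)"
  have "\<exists>s. a \<le> s \<and> s < t \<and> f s = l"
    unfolding l_def by (rule LeastI_ex) (use t in auto)
  then obtain c where c: "a \<le> c" "c < t" "f c = l" by blast
  have "f s = f c" if "c \<le> s" "s < t" for s
  proof (rule antisym)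
    show "f s \<le> f c" using anti[of c s] that c t by auto
    show "f c \<le> f s" unfolding c(3) l_def by (rule Least_le) (use that c(1) in \<open>auto intro: exI[of _ s]\<close>)
  qed
  moreover have "f t \<le> f c" using anti[of c t] c t by auto
  ultimately show thesis using that c by blast
qed

text \<open>
  A right-continuous step function loses its height only in jumps that are seen from the left. On a
  short interval around \<open>x\<close> there is at most one jump, the one at \<open>x\<close>
  itself.
\<close>

lemma total_drop_antitone:
  fixes f :: "real \<Rightarrow> nat"
  assumes ab: "a \<le> b" and anti: "\<And>s t. a \<le> s \<Longrightarrow> s \<le> t \<Longrightarrow> t \<le> b \<Longrightarrow> f t \<le> f s"
    and right: "\<And>t. a \<le> t \<Longrightarrow> t < b \<Longrightarrow> eventually (\<lambda>s. f s = f t) (at_right t)"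
  shows "drop_regular f a b \<and> total_drop f a b = int (f a) - int (f b)"
proof -
  define P where "P c d \<longleftrightarrow> (a \<le> c \<and> d \<le> b \<longrightarrow>
    drop_regular f c d \<and> total_drop f c d = int (f c) - int (f d))" for c d
  have "P a b" using ab
  proof (induction rule: Bolzano)
    case (trans x y z)
    then show ?case using drop_regular_combine[of f x y z] by (auto simp: P_def)
  next
    case (local x)
    have "\<exists>d1>0. \<forall>s s'. x - d1 < s \<and> a \<le> s \<and> s \<le> s' \<and> s' < x \<longrightarrow> f s' = f s"
    proof (cases "a < x")
      case True
      obtain c where c: "a \<le> c" "c < x" "\<And>s. c \<le> s \<Longrightarrow> s < x \<Longrightarrow> f s = f c" "f x \<le> f c"
        using antitone_eventually_const_left[of a b f x, OF _ True local(2)] anti by metis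
      have "f s' = f s" if "x - (x - c) < s" "s \<le> s'" "s' < x" for s s'
        using c(3)[of s] c(3)[of s'] that by simp
      then show ?thesis using c(2) by (intro exI[of _ "x - c"]) simp
    next
      case False
      then show ?thesis by (intro exI[of _ 1]) force
    qed
    then obtain d1 where d1: "d1 > 0"
      "\<And>s s'. x - d1 < s \<Longrightarrow> a \<le> s \<Longrightarrow> s \<le> s' \<Longrightarrow> s' < x \<Longrightarrow> f s' = f s"
      by blast
    obtain d2 where d2: "d2 > 0" "\<And>s. x \<le> s \<Longrightarrow> s < x + d2 \<Longrightarrow> s \<le> b \<Longrightarrow> f s = f x"
    proof (cases "x < b")
      case True
      obtain y where "y > x" "\<forall>s>x. s < y \<longrightarrow> f s = f x"
        using right[OF local(1) True] by (auto simp: eventually_at_right_field)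
      then show thesis by (intro that[of "y - x"]) (auto simp: le_less)
    qed (use local in \<open>auto intro: that[of 1]\<close>)
    have "drop_regular f c d \<and> total_drop f c d = int (f c) - int (f d)"
      if cd: "c \<le> x" "x \<le> d" "d - c < min d1 d2" "a \<le> c" "d \<le> b" for c d
    proof -
      have right0: "left_drop f t = 0 \<and> (f \<longlongrightarrow> f x) (at_left t)" if "x < t" "t \<le> d" for t
      proof -
        have "eventually (\<lambda>s. f s = f x) (at_left t)"
          using eventually_at_left_interval[OF that(1)]
        proof eventually_elim
          case (elim s)
          then show ?case using d2(2)[of s] that cd by simp
        qed
        from left_drop_eq[OF this] show ?thesis using d2(2)[of t] that cd by auto
      qed
      have fd: "f d = f x" using d2(2)[of d] cd by auto
      show ?thesis
      proof (cases "c < x")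
        case False
        then have "drop_points f c d = {}" using right0 cd by (auto simp: drop_points_def)
        moreover have "c = x" using False cd by simp
        ultimately show ?thesis using right0 fd by (auto simp: drop_regular_def total_drop_def)
      next
        case True
        have left: "f s = f c" if "c \<le> s" "s < x" for s
          using d1(2)[of c s] cd that by auto
        have left0: "left_drop f t = 0 \<and> (f \<longlongrightarrow> f c) (at_left t)" if "c < t" "t < x" for t
        proof -
          have "eventually (\<lambda>s. f s = f c) (at_left t)"
            using eventually_at_left_interval[OF that(1)]
          proof eventually_elim
            case (elim s)
            then show ?case using left[of s] that by simp
          qed
          from left_drop_eq[OF this] show ?thesis using left[of t] that by auto
        qed
        have "eventually (\<lambda>s. f s = f c) (at_left x)"
          using eventually_at_left_interval[OF True]
        proof eventually_elim
          case (elim s)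
          then show ?case using left[of s] by simp
        qed
        note at_x = left_drop_eq[OF this]
        have le: "f x \<le> f c" using anti[of c x] cd by auto
        have cases3: "t < x \<or> t = x \<or> x < t" for t by auto
        have pts: "drop_points f c d = (if f x = f c then {} else {x})"
          proof -
          have "t \<in> drop_points f c d \<longleftrightarrow> t = x \<and> f x \<noteq> f c" for t
            using cases3[of t] left0[of t] right0[of t] at_x(1) cd True by (auto simp: drop_points_def)
          then show ?thesis by auto
        qed
        have "total_drop f c d = int (f c) - int (f d)"
          using at_x(1) fd by (simp add: total_drop_def pts)
        moreover have "drop_regular f c d"
          unfolding drop_regular_def
        proof (intro conjI allI impI)
          show "finite (drop_points f c d)" by (simp add: pts)
          fix t assume t: "c < t \<and> t \<le> d"
          show "\<exists>l. (f \<longlongrightarrow> l) (at_left t)" "0 \<le> left_drop f t"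
            using cases3[of t] left0[of t] right0[of t] at_x le t by auto
        qed
        ultimately show ?thesis by simp
      qed
    qed
    then show ?case using d1(1) d2(1) unfolding P_def by (intro exI[of _ "min d1 d2"]) simp
  qed
  then show ?thesis by (simp add: P_def)
qed

text \<open>
  The rank is the number of negative plus the number of positive eigenvalues. The former decreases and
  the latter increases with the parameter, and both are lower semicontinuous. So the number of
  positive eigenvalues is left-continuous and does not contribute to left drops, while the number of
  negative ones is right-continuous and contributes exactly its total loss.
\<close>

lemma total_drop_rank_nondecreasing:
  fixes Q :: "real \<Rightarrow> real^'m^'m"
  assumes ab: "a \<le> b" and cont: "continuous_on {a..b} Q"
    and sym: "\<And>s. s \<in> {a..b} \<Longrightarrow> transpose (Q s) = Q s"
    and mono: "\<And>s t v. a \<le> s \<Longrightarrow> s \<le> t \<Longrightarrow> t \<le> b \<Longrightarrow> v \<bullet> (Q s *v v) \<le> v \<bullet> (Q t *v v)"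
  shows "drop_regular (\<lambda>s. rank (Q s)) a b \<and>
    total_drop (\<lambda>s. rank (Q s)) a b = int (ind (Q a)) - int (ind (Q b))"
proof -
  have symm: "transpose (- Q s) = - Q s" if "s \<in> {a..b}" for s
    using sym[OF that] by (simp add: transpose_minus)
  have anti: "ind (Q t) \<le> ind (Q s)" if "a \<le> s" "s \<le> t" "t \<le> b" for s t
    using that by (intro ind_mono sym mono) auto
  have monom: "ind (- Q s) \<le> ind (- Q t)" if "a \<le> s" "s \<le> t" "t \<le> b" for s t
    using that mono[OF that] by (intro ind_mono symm) (auto simp: matrix_vector_minus_left)
  have lsc_r: "eventually (\<lambda>s. ind (Q s) = ind (Q t)) (at_right t)" if t: "a \<le> t" "t < b" for t
  proof -
    have "(Q \<longlongrightarrow> Q t) (at t within {a..b})"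
      using cont t by (auto simp: continuous_on_def)
    then have "(Q \<longlongrightarrow> Q t) (at_right t)"
      using t by (metis (no_types, lifting) at_within_Icc_at_right at_within_Icc_at filterlim_at_split order_le_less)
    moreover have ev: "eventually (\<lambda>s. t < s \<and> s < b) (at_right t)"
      using eventually_at_right_real[OF t(2)] by eventually_elim auto
    then have "eventually (\<lambda>s. transpose (Q s) = Q s) (at_right t)"
      by eventually_elim (use sym t in auto)
    ultimately have "eventually (\<lambda>s. ind (Q t) \<le> ind (Q s)) (at_right t)"
      using ind_lower_semicontinuous[of Q "Q t" "at_right t"] sym[of t] t by auto
    with ev show ?thesis by eventually_elim (use anti t in \<open>auto intro: antisym\<close>)
  qed
  have lsc_l: "eventually (\<lambda>s. ind (- Q s) = ind (- Q t)) (at_left t)" if t: "a < t" "t \<le> b" for t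
  proof -
    have "(Q \<longlongrightarrow> Q t) (at t within {a..b})"
      using cont t by (auto simp: continuous_on_def)
    then have "(Q \<longlongrightarrow> Q t) (at_left t)"
      using t by (metis (no_types, lifting) at_within_Icc_at_left at_within_Icc_at filterlim_at_split order_le_less)
    then have "((\<lambda>s. - Q s) \<longlongrightarrow> - Q t) (at_left t)" by (rule tendsto_minus)
    moreover have ev: "eventually (\<lambda>s. a < s \<and> s < t) (at_left t)"
      using eventually_at_left_interval[OF t(1)] .
    then have "eventually (\<lambda>s. transpose (- Q s) = - Q s) (at_left t)"
      by eventually_elim (use symm t in auto)
    ultimately have "eventually (\<lambda>s. ind (- Q t) \<le> ind (- Q s)) (at_left t)"
      using ind_lower_semicontinuous[of "\<lambda>s. - Q s" "- Q t" "at_left t"] symm[of t] t by auto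
    with ev show ?thesis by eventually_elim (use monom t in \<open>auto intro: antisym\<close>)
  qed
  have main: "drop_regular (\<lambda>s. ind (Q s)) a b \<and> total_drop (\<lambda>s. ind (Q s)) a b = int (ind (Q a)) - int (ind (Q b))"
    using total_drop_antitone[OF ab anti lsc_r] by simp
  have "\<exists>p. rank (Q t) = ind (Q t) + p \<and> eventually (\<lambda>s. rank (Q s) = ind (Q s) + p) (at_left t)"
    if t: "a < t" "t \<le> b" for t
  proof (intro exI[of _ "ind (- Q t)"] conjI)
    show "rank (Q t) = ind (Q t) + ind (- Q t)"
      using t by (intro rank_eq_ind_add_ind_uminus sym) auto
    show "eventually (\<lambda>s. rank (Q s) = ind (Q s) + ind (- Q t)) (at_left t)"
      using lsc_l[OF t] eventually_at_left_interval[OF t(1)]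
      by eventually_elim (use t sym in \<open>auto simp: rank_eq_ind_add_ind_uminus\<close>)
  qed
  from drop_cong[OF conjunct1[OF main] this] main show ?thesis by simp
qed

section \<open>Monotone Lagrangian paths and the comparative index\<close>

lemma bounded_bilinear_matrix_mult:
  "bounded_bilinear ((**) :: real^'n^'m \<Rightarrow> real^'p^'n \<Rightarrow> real^'p^'m)"
  unfolding bilinear_conv_bounded_bilinear[symmetric] bilinear_def
  by (auto intro!: linearI simp: matrix_add_ldistrib matrix_add_rdistrib matrix_scalar_ac
      scalar_matrix_assoc[symmetric])

lemma bounded_bilinear_matrix_vector_mult:
  "bounded_bilinear ((*v) :: real^'n^'m \<Rightarrow> real^'n \<Rightarrow> real^'m)"
  unfolding bilinear_conv_bounded_bilinear[symmetric] bilinear_def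
  by (auto intro!: linearI simp: matrix_vector_linear scaleR_matrix_vector_assoc)

lemmas matrix_tendsto = bounded_bilinear.tendsto[OF bounded_bilinear_matrix_mult]
  bounded_bilinear.tendsto[OF bounded_bilinear_matrix_vector_mult]
lemmas matrix_continuous_on = bounded_bilinear.continuous_on[OF bounded_bilinear_matrix_mult]
  bounded_bilinear.continuous_on[OF bounded_bilinear_matrix_vector_mult]

lemma continuous_on_det:
  fixes f :: "'a::topological_space \<Rightarrow> real^'n^'n"
  assumes "continuous_on S f"
  shows "continuous_on S (\<lambda>s. det (f s))"
  unfolding det_def by (intro continuous_intros assms)

text \<open>
  Cramer's rule for the columns of the identity; it exhibits the inverse as a continuous function.
\<close>

lemma matrix_inv_nth:
  fixes A :: "real^'n^'n"
  assumes "invertible A"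
  shows "matrix_inv A $ i $ j = det (\<chi> i' j'. if j' = i then axis j 1 $ i' else A $ i' $ j') / det A"
proof -
  have d: "det A \<noteq> 0" using assms invertible_det_nz by blast
  have "A *v (matrix_inv A *v axis j 1) = axis j 1"
    by (simp add: matrix_vector_mul_assoc matrix_inv_cancel[OF assms])
  then have "matrix_inv A *v axis j 1 = (\<chi> k. det (\<chi> i j'. if j' = k then axis j 1 $ i else A $ i $ j') / det A)"
    using cramer[OF d] by blast
  moreover have "(matrix_inv A *v axis j 1) $ i = matrix_inv A $ i $ j"
    by (simp add: matrix_vector_mult_basis column_def)
  ultimately show ?thesis by simp
qed

lemma continuous_on_matrix_inv:
  fixes f :: "'a::topological_space \<Rightarrow> real^'n^'n"
  assumes f: "continuous_on S f" and inv: "\<And>s. s \<in> S \<Longrightarrow> invertible (f s)"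
  shows "continuous_on S (\<lambda>s. matrix_inv (f s))"
proof -
  have "continuous_on S (\<lambda>s. matrix_inv (f s) $ i $ j)" for i j
  proof -
    have "continuous_on S (\<lambda>s. \<chi> i' j'. if j' = i then axis j 1 $ i' else f s $ i' $ j')"
    proof (intro continuous_on_vec_lambda)
      fix i' j'
      show "continuous_on S (\<lambda>s. if j' = i then axis j 1 $ i' else f s $ i' $ j')"
        by (cases "j' = i") (auto intro!: continuous_intros f)
    qed
    then have "continuous_on S (\<lambda>s. det (\<chi> i' j'. if j' = i then axis j 1 $ i' else f s $ i' $ j') / det (f s))"
      by (intro continuous_on_divide continuous_on_det[OF f] continuous_on_det) (use inv invertible_det_nz in blast)+
    then show ?thesis
      by (rule continuous_on_eq) (simp add: matrix_inv_nth inv)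
  qed
  then have "continuous_on S (\<lambda>s. \<chi> i j. matrix_inv (f s) $ i $ j)"
    by (intro continuous_on_vec_lambda)
  then show ?thesis by simp
qed

lemma rank_mult_invertible:
  fixes A :: "real^'n^'m"
  shows "invertible (C :: real^'n^'n) \<Longrightarrow> rank (A ** C) = rank A"
    and "invertible (B :: real^'m^'m) \<Longrightarrow> rank (B ** A) = rank A"
proof -
  show "rank (A ** C) = rank A" if "invertible C" for C :: "real^'n^'n"
    by (metis matrix_inv_cancel(1)[OF that] le_antisym matrix_mul_assoc matrix_mul_rid rank_mul_le_left)
  show "rank (B ** A) = rank A" if "invertible B" for B :: "real^'m^'m"
    by (metis matrix_inv_cancel(2)[OF that] le_antisym matrix_mul_assoc matrix_mul_lid rank_mul_le_right)
qed

lemma sum_UNIV_Plus: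
  "(\<Sum>k\<in>UNIV. g k) = (\<Sum>k\<in>UNIV. g (Inl k)) + (\<Sum>k\<in>UNIV. g (Inr k))"
  for g :: "'a::finite + 'b::finite \<Rightarrow> 'c::comm_monoid_add"
  by (simp add: UNIV_Plus_UNIV[symmetric] sum.Plus del: UNIV_Plus_UNIV)

lemma transpose_mult_blocks:
  fixes Y :: "real^'p^('m::finite + 'k::finite)" and Y' :: "real^'q^('m + 'k)"
  shows "transpose Y ** Y' = transpose (upper Y) ** upper Y' + transpose (lower Y) ** lower Y'"
  by (simp add: vec_eq_iff matrix_matrix_mult_def transpose_def upper_def lower_def sum_UNIV_Plus)

lemma upper_vstack [simp]: "upper (vstack A B) = A"
  and lower_vstack [simp]: "lower (vstack A B) = B"
  by (simp_all add: vec_eq_iff upper_def lower_def vstack_def)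

lemma Jmat_mult:
  fixes Y :: "real^'p^('m::finite + 'm)"
  shows "upper (Jmat ** Y) = lower Y" "lower (Jmat ** Y) = - upper Y"
proof -
  have 1: "(\<Sum>k\<in>UNIV. (if i = k then 1 else 0) * f k) = f i" for f :: "'m \<Rightarrow> real" and i
    by (simp add: if_distrib[where f = "\<lambda>x. x * _"] cong: if_cong)
  have 2: "(\<Sum>k\<in>UNIV. - (if i = k then 1 else 0) * f k) = - f i" for f :: "'m \<Rightarrow> real" and i
    using 1[of i f] by (simp add: sum_negf)
  show "upper (Jmat ** Y) = lower Y" "lower (Jmat ** Y) = - upper Y"
    using 1 2
    by (simp_all add: vec_eq_iff upper_def lower_def matrix_matrix_mult_def sum_UNIV_Plus Jmat_def
        vstack_def hstack_def mat_def)
qed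

lemma transpose_Jmat: "transpose (Jmat :: real^('m::finite + 'm)^('m + 'm)) = - Jmat"
proof -
  have "transpose Jmat $ i $ j = (- Jmat :: real^('m::finite + 'm)^('m + 'm)) $ i $ j" for i j
    by (cases i; cases j) (auto simp: transpose_def Jmat_def vstack_def hstack_def mat_def)
  then show ?thesis by (simp add: vec_eq_iff)
qed

lemma symplectic_form_blocks:
  fixes Y :: "real^'p^('m::finite + 'm)" and Y' :: "real^'q^('m + 'm)"
  shows "transpose Y ** Jmat ** Y' = transpose (upper Y) ** lower Y' - transpose (lower Y) ** upper Y'"
proof -
  have "transpose Y ** Jmat ** Y' = transpose Y ** (Jmat ** Y')"
    by (simp only: matrix_mul_assoc)
  then show ?thesis by (simp add: transpose_mult_blocks Jmat_mult matrix_minus_right)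
qed

definition lagrangian :: "real^'m^('m::finite + 'm) \<Rightarrow> bool" where
  "lagrangian Y \<longleftrightarrow> transpose Y ** Jmat ** Y = 0 \<and> (\<forall>v. Y *v v = 0 \<longrightarrow> v = 0)"

text \<open>
  \<open>(X; U) \<mapsto> (X; U + c X)\<close> is a symplectic change of coordinates that fixes the
  vertical subspace \<open>X = 0\<close>, the matrix \<open>X\<close> and all symplectic products.
\<close>

definition shear :: "real \<Rightarrow> real^'m^('m::finite + 'm) \<Rightarrow> real^'m^'m" where
  "shear c Y = lower Y + c *\<^sub>R upper Y"

text \<open>
  The local coordinate of a Lagrangian subspace: it is the graph of \<open>slope c Y\<close> over the
  vertical subspace, in sheared coordinates.
\<close>

definition slope :: "real \<Rightarrow> real^'m^('m::finite + 'm) \<Rightarrow> real^'m^'m" where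
  "slope c Y = upper Y ** matrix_inv (shear c Y)"

lemma symplectic_form_shear:
  "transpose Y ** Jmat ** Y' = transpose (upper Y) ** shear c Y' - transpose (shear c Y) ** upper Y'"
  by (simp add: symplectic_form_blocks shear_def matrix_add_ldistrib matrix_add_rdistrib transpose_add
      transpose_scalar matrix_scalar_ac scalar_matrix_assoc)

lemma lagrangian_shear:
  assumes "lagrangian Y"
  shows "transpose (upper Y) ** shear c Y = transpose (shear c Y) ** upper Y"
  using assms symplectic_form_shear[of Y Y c] by (simp add: lagrangian_def)

lemma matrix_vector_blocks:
  "upper (Y :: real^'p^('m::finite + 'k::finite)) *v v = 0 \<Longrightarrow> lower Y *v v = 0 \<Longrightarrow> Y *v v = 0"
proof -
  assume 0: "upper Y *v v = 0" "lower Y *v v = 0"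
  have "(Y *v v) $ i = 0" for i
  proof (cases i)
    case (Inl k)
    then have "(Y *v v) $ i = (upper Y *v v) $ k" by (simp add: upper_def matrix_vector_mult_def)
    then show ?thesis using 0 by simp
  next
    case (Inr k)
    then have "(Y *v v) $ i = (lower Y *v v) $ k" by (simp add: lower_def matrix_vector_mult_def)
    then show ?thesis using 0 by simp
  qed
  then show "Y *v v = 0" by (simp add: vec_eq_iff)
qed

text \<open>
  If \<open>U v = - c X v\<close> and \<open>U w = - d X w\<close> with \<open>c \<noteq> d\<close>,
  then isotropy forces \<open>X v \<bottom> X w\<close>; nonzero pairwise orthogonal vectors are
  finite in number. One shear can therefore serve two Lagrangian subspaces at once.
\<close>

lemma finite_singular_shears:
  fixes Y :: "real^'m^('m::finite + 'm)"
  assumes Y: "lagrangian Y"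
  shows "finite {c. \<not> invertible (shear c Y)}"
proof -
  define C where "C = {c. \<not> invertible (shear c Y)}"
  have "\<exists>v. v \<noteq> 0 \<and> shear c Y *v v = 0" if "c \<in> C" for c
    using that unfolding C_def invertible_left_inverse matrix_left_invertible_ker by auto
  then obtain v where v: "\<And>c. c \<in> C \<Longrightarrow> v c \<noteq> 0 \<and> shear c Y *v v c = 0"
    by metis
  define x where "x c = upper Y *v v c" for c
  have U: "lower Y *v v c = - c *\<^sub>R x c" if "c \<in> C" for c
    using v[OF that]
    by (simp add: x_def shear_def matrix_vector_mult_add_rdistrib eq_neg_iff_add_eq_0 scaleR_matrix_vector_assoc[symmetric])
  have x0: "x c \<noteq> 0" if "c \<in> C" for c
  proof
    assume "x c = 0"
    then have "Y *v v c = 0" using U[OF that] by (intro matrix_vector_blocks) (auto simp: x_def)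
    then show False using v[OF that] Y by (auto simp: lagrangian_def)
  qed
  have iso: "transpose (upper Y) ** lower Y = transpose (lower Y) ** upper Y"
    using Y by (simp add: lagrangian_def symplectic_form_blocks)
  have orth: "x c \<bullet> x d = 0" if "c \<in> C" "d \<in> C" "c \<noteq> d" for c d
    using isotropic_dot[OF iso, of "v c" "v d"] U[OF that(1)] U[OF that(2)] that(3)
    by (simp add: x_def[symmetric])
  have inj: "inj_on x C"
    using orth x0 by (intro inj_onI) (metis inner_eq_zero_iff)
  have "pairwise orthogonal (x ` C)"
    using orth by (auto simp: pairwise_def orthogonal_def)
  then have "finite (x ` C)" by (rule pairwise_orthogonal_imp_finite)
  then show ?thesis using inj finite_imageD C_def by blast
qed

lemma common_regular_shear:
  assumes "lagrangian Y" "lagrangian Y'"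
  obtains c where "invertible (shear c Y)" "invertible (shear c Y')"
proof -
  have "finite ({c. \<not> invertible (shear c Y)} \<union> {c. \<not> invertible (shear c Y')})"
    using finite_singular_shears[OF assms(1)] finite_singular_shears[OF assms(2)] by simp
  then have "\<exists>c::real. c \<notin> {c. \<not> invertible (shear c Y)} \<union> {c. \<not> invertible (shear c Y')}"
    by (rule ex_new_if_finite[OF infinite_UNIV_char_0])
  then show thesis using that by blast
qed

lemma slope_symmetric:
  assumes "lagrangian Y" "invertible (shear c Y)"
  shows "transpose (slope c Y) = slope c Y"
  unfolding slope_def using isotropic_quotient_symmetric lagrangian_shear assms by blast

lemma rank_upper_eq_rank_slope:
  assumes "invertible (shear c Y)"
  shows "rank (upper Y) = rank (slope c Y)"
proof -
  have "slope c Y ** shear c Y = upper Y"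
    by (simp add: slope_def matrix_mul_assoc[symmetric] matrix_inv_cancel[OF assms])
  then show ?thesis using rank_mult_invertible(1)[OF assms] by metis
qed

lemma rank_symplectic_form_eq_rank_slope_diff:
  assumes "lagrangian Y" "invertible (shear c Y)" "invertible (shear c Y')"
  shows "rank (transpose Y ** Jmat ** Y') = rank (slope c Y - slope c Y')"
proof -
  have Q: "slope c Y ** shear c Y = upper Y" "slope c Y' ** shear c Y' = upper Y'"
    using assms by (simp_all add: slope_def matrix_mul_assoc[symmetric] matrix_inv_cancel)
  then have "transpose (upper Y) = transpose (shear c Y) ** slope c Y"
    by (metis assms(1,2) matrix_transpose_mul slope_symmetric)
  then have "transpose Y ** Jmat ** Y' = transpose (shear c Y) ** ((slope c Y - slope c Y') ** shear c Y')"
    unfolding symplectic_form_shear[of Y Y' c]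
    by (simp add: matrix_diff_ldistrib matrix_diff_rdistrib Q matrix_mul_assoc[symmetric])
  then show ?thesis
    using assms by (simp add: rank_mult_invertible transpose_invertible)
qed

text \<open>
  The comparative index depends on \<open>X\<close>, \<open>X'\<close> and the symplectic product
  only, so a shear does not change it and the Schur complement formula applies to the sheared frames.
\<close>

lemma mu_inertia:
  assumes "lagrangian Y" "lagrangian Y'" "invertible (shear c Y)" "invertible (shear c Y')"
  shows "mu Y Y' + ind (slope c Y) = ind (slope c Y - slope c Y') + ind (slope c Y')"
  using generalized_schur_inertia[OF lagrangian_shear[OF assms(1)] lagrangian_shear[OF assms(2)] assms(3,4)]
  unfolding mu_def Let_def symplectic_form_shear[of Y Y' c] slope_def .

lemma nondecreasing_if_deriv_nonneg_except_finite:
  fixes g :: "real \<Rightarrow> real"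
  assumes "c \<le> d" "continuous_on {c..d} g" "finite K"
    and der: "\<And>s. s \<in> {c<..<d} - K \<Longrightarrow> \<exists>D\<ge>0. (g has_real_derivative D) (at s)"
  shows "g c \<le> g d"
proof -
  obtain g' where g': "\<And>s. s \<in> {c<..<d} - K \<Longrightarrow> 0 \<le> g' s \<and> (g has_real_derivative g' s) (at s)"
    using der by metis
  define h where "h s = (if s \<in> {c<..<d} - K then g' s else 0)" for s
  \<comment> \<open>The derivative is completed by zero at the exceptional points.\<close>
  have "(h has_integral (g d - g c)) {c..d}"
    using assms(1-3) g'
    by (intro fundamental_theorem_of_calculus_interior_strong[OF assms(3)])
      (auto simp: h_def has_real_derivative_iff_has_vector_derivative[symmetric])
  moreover have "0 \<le> h s" for s using g' by (auto simp: h_def)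
  ultimately have "0 \<le> g d - g c" using has_integral_nonneg by blast
  then show ?thesis by simp
qed

text \<open>
  For a square symplectic \<open>Y\<close> the form \<open>Y\<^sup>T J\<^sup>T D\<close> is congruent
  to \<open>\<Psi>\<close>. The rectangular shape covers both fundamental matrices and the frames
  derived from them.
\<close>

definition nonneg_derivative_at :: "(real \<Rightarrow> real^'p^('m::finite + 'm)) \<Rightarrow> real \<Rightarrow> bool" where
  "nonneg_derivative_at Y s \<longleftrightarrow> (\<exists>D. (Y has_vector_derivative D) (at s) \<and>
     (\<forall>v. 0 \<le> v \<bullet> ((transpose (Y s) ** transpose Jmat ** D) *v v)))"

definition monotone_path :: "(real \<Rightarrow> real^'p^('m::finite + 'm)) \<Rightarrow> bool" where
  "monotone_path Y \<longleftrightarrow> continuous_on UNIV Y \<and>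
     (\<forall>a b. \<exists>K. finite K \<and> (\<forall>s\<in>{a..b} - K. nonneg_derivative_at Y s))"

lemma bounded_linear_upper: "bounded_linear (upper :: real^'p^('m::finite + 'k::finite) \<Rightarrow> real^'p^'m)"
  and bounded_linear_lower: "bounded_linear (lower :: real^'p^('m::finite + 'k::finite) \<Rightarrow> real^'p^'k)"
  by (auto simp: linear_conv_bounded_linear[symmetric] upper_def lower_def vec_eq_iff intro!: linearI)

lemma continuous_on_shear:
  "continuous_on S Y \<Longrightarrow> continuous_on S (\<lambda>s. shear c (Y s))"
  unfolding shear_def
  by (intro continuous_intros bounded_linear.continuous_on[OF bounded_linear_upper]
      bounded_linear.continuous_on[OF bounded_linear_lower])

lemma continuous_on_slope:
  "continuous_on S Y \<Longrightarrow> (\<And>s. s \<in> S \<Longrightarrow> invertible (shear c (Y s))) \<Longrightarrow> continuous_on S (\<lambda>s. slope c (Y s))"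
  unfolding slope_def
  by (intro matrix_continuous_on continuous_on_matrix_inv continuous_on_shear
      bounded_linear.continuous_on[OF bounded_linear_upper])

text \<open>
  Since \<open>Y\<close> is isotropic, the factor \<open>Y\<^sup>T J\<^sup>T Y'\<close> vanishes at
  \<open>Y' = Y\<close>. For the derivative of the slope it is therefore enough that the remaining
  factor, the inverse of \<open>shear c Y'\<close>, is continuous; its derivative does not enter.
\<close>

lemma slope_difference:
  assumes Y: "lagrangian Y" and inv: "invertible (shear c Y)" "invertible (shear c Y')"
  shows "v \<bullet> (slope c Y' *v v) - v \<bullet> (slope c Y *v v)
    = (matrix_inv (shear c Y) *v v) \<bullet> ((transpose Y ** transpose Jmat ** Y') *v (matrix_inv (shear c Y') *v v))"
proof -
  let ?z = "matrix_inv (shear c Y) *v v" and ?h = "matrix_inv (shear c Y') *v v"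
  have z: "shear c Y *v ?z = v" and h: "shear c Y' *v ?h = v"
    by (simp_all add: matrix_vector_mul_assoc matrix_inv_cancel inv)
  have "v \<bullet> (slope c Y' *v v) = (shear c Y *v ?z) \<bullet> (upper Y' *v ?h)"
    unfolding z by (simp add: slope_def matrix_vector_mul_assoc)
  also have "\<dots> = ?z \<bullet> ((transpose (shear c Y) ** upper Y') *v ?h)"
    by (metis dot_matrix_transpose matrix_vector_mul_assoc transpose_transpose)
  finally have 1: "v \<bullet> (slope c Y' *v v) = ?z \<bullet> ((transpose (shear c Y) ** upper Y') *v ?h)" .
  have "v \<bullet> (slope c Y *v v) = (upper Y *v ?z) \<bullet> (shear c Y' *v ?h)"
    unfolding h by (simp add: slope_def matrix_vector_mul_assoc inner_commute)
  also have "\<dots> = ?z \<bullet> ((transpose (upper Y) ** shear c Y') *v ?h)"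
    by (metis dot_matrix_transpose matrix_vector_mul_assoc transpose_transpose)
  finally have 2: "v \<bullet> (slope c Y *v v) = ?z \<bullet> ((transpose (upper Y) ** shear c Y') *v ?h)" .
  have "transpose Y ** transpose Jmat ** Y' = transpose (shear c Y) ** upper Y' - transpose (upper Y) ** shear c Y'"
    using symplectic_form_shear[of Y Y' c]
    by (simp add: transpose_Jmat matrix_minus_left matrix_minus_right)
  then show ?thesis
    using 1 2 by (simp add: matrix_vector_linear inner_diff_right)
qed

lemma has_vector_derivative_quotient:
  fixes f :: "real \<Rightarrow> real^'n^'m"
  assumes "(f has_vector_derivative D) (at r)"
  shows "((\<lambda>s. (1 / (s - r)) *\<^sub>R (f s - f r)) \<longlongrightarrow> D) (at r)"
proof (intro vec_tendstoI)
  fix i j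
  have "((\<lambda>s. f s $ i $ j) has_vector_derivative D $ i $ j) (at r)"
    by (intro bounded_linear.has_vector_derivative[OF bounded_linear_vec_nth] assms)
  then have "((\<lambda>s. (f s $ i $ j - f r $ i $ j) / (s - r)) \<longlongrightarrow> D $ i $ j) (at r)"
    by (simp add: has_real_derivative_iff_has_vector_derivative[symmetric] has_field_derivative_iff)
  then show "((\<lambda>s. ((1 / (s - r)) *\<^sub>R (f s - f r)) $ i $ j) \<longlongrightarrow> D $ i $ j) (at r)"
    by (simp add: divide_inverse mult.commute)
qed

lemma slope_nondecreasing:
  fixes Y :: "real \<Rightarrow> real^'m^('m::finite + 'm)"
  assumes Y: "monotone_path Y" "\<And>s. lagrangian (Y s)" and "c \<le> d"
    and inv: "\<And>s. s \<in> {c..d} \<Longrightarrow> invertible (shear k (Y s))"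
  shows "v \<bullet> (slope k (Y c) *v v) \<le> v \<bullet> (slope k (Y d) *v v)"
proof -
  obtain K where K: "finite K" "\<And>s. s \<in> {c..d} - K \<Longrightarrow> nonneg_derivative_at Y s"
    using Y(1) unfolding monotone_path_def by blast
  have contY: "continuous_on {c..d} Y"
    using Y(1) continuous_on_subset unfolding monotone_path_def by blast
  have contQ: "continuous_on {c..d} (\<lambda>s. v \<bullet> (slope k (Y s) *v v))"
    by (intro continuous_intros matrix_continuous_on continuous_on_slope contY inv)
  have conth: "continuous_on {c..d} (\<lambda>s. matrix_inv (shear k (Y s)) *v v)"
    by (intro continuous_intros matrix_continuous_on continuous_on_matrix_inv continuous_on_shear contY inv)
  show ?thesis
  proof (rule nondecreasing_if_deriv_nonneg_except_finite[OF assms(3) contQ K(1)])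
    fix r assume r: "r \<in> {c<..<d} - K"
    obtain D where D: "(Y has_vector_derivative D) (at r)"
      "\<And>v. 0 \<le> v \<bullet> ((transpose (Y r) ** transpose Jmat ** D) *v v)"
      using K(2)[of r] r unfolding nonneg_derivative_at_def by auto
    define A where "A = transpose (Y r) ** transpose Jmat"
    define z where "z = matrix_inv (shear k (Y r)) *v v"
    have AY: "A ** Y r = 0"
      using Y(2)[of r] by (simp add: A_def lagrangian_def transpose_Jmat matrix_minus_left matrix_minus_right)
    have inv_r: "invertible (shear k (Y r))" using r by (intro inv) auto
    have ev: "eventually (\<lambda>s. s \<in> {c<..<d} \<and> s \<noteq> r) (at r)"
      using r eventually_at_in_open[of "{c<..<d}" r] by simp
    have "isCont (\<lambda>s. matrix_inv (shear k (Y s)) *v v) r"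
      using conth r by (intro continuous_on_interior) auto
    then have "((\<lambda>s. matrix_inv (shear k (Y s)) *v v) \<longlongrightarrow> z) (at r)"
      unfolding isCont_def z_def .
    then have "((\<lambda>s. z \<bullet> ((A ** ((1 / (s - r)) *\<^sub>R (Y s - Y r))) *v (matrix_inv (shear k (Y s)) *v v)))
        \<longlongrightarrow> z \<bullet> ((A ** D) *v z)) (at r)"
      by (intro tendsto_intros matrix_tendsto has_vector_derivative_quotient D)
    moreover have "eventually (\<lambda>s. z \<bullet> ((A ** ((1 / (s - r)) *\<^sub>R (Y s - Y r))) *v (matrix_inv (shear k (Y s)) *v v))
        = (v \<bullet> (slope k (Y s) *v v) - v \<bullet> (slope k (Y r) *v v)) / (s - r)) (at r)"
      using ev
    proof eventually_elim
      case (elim s)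
      have inv_s: "invertible (shear k (Y s))" using elim by (intro inv) auto
      show ?case
        unfolding slope_difference[OF Y(2) inv_r inv_s] A_def[symmetric] z_def[symmetric]
        by (simp add: matrix_scalar_ac matrix_diff_ldistrib AY scaleR_matrix_vector_assoc[symmetric]
            scalar_matrix_assoc[symmetric])
    qed
    ultimately have "((\<lambda>s. (v \<bullet> (slope k (Y s) *v v) - v \<bullet> (slope k (Y r) *v v)) / (s - r))
        \<longlongrightarrow> z \<bullet> ((A ** D) *v z)) (at r)"
      using tendsto_cong by force
    then show "\<exists>D\<ge>0. ((\<lambda>s. v \<bullet> (slope k (Y s) *v v)) has_real_derivative D) (at r)"
      using D(2)[of z] by (intro exI[of _ "z \<bullet> ((A ** D) *v z)"]) (auto simp: A_def has_field_derivative_iff)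
  qed
qed

lemma chart_total_drop:
  fixes Y :: "real \<Rightarrow> real^'m^('m::finite + 'm)"
  assumes Y: "monotone_path Y" "\<And>s. lagrangian (Y s)" and "c \<le> d"
    and inv: "\<And>s. s \<in> {c..d} \<Longrightarrow> invertible (shear k (Y s))" and B: "transpose B = B"
  shows "drop_regular (\<lambda>s. rank (slope k (Y s) - B)) c d \<and>
    total_drop (\<lambda>s. rank (slope k (Y s) - B)) c d
      = int (ind (slope k (Y c) - B)) - int (ind (slope k (Y d) - B))"
proof (rule total_drop_rank_nondecreasing[OF assms(3)])
  have "continuous_on {c..d} Y"
    using Y(1) continuous_on_subset unfolding monotone_path_def by blast
  then show "continuous_on {c..d} (\<lambda>s. slope k (Y s) - B)"
    by (intro continuous_intros continuous_on_slope inv)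
  show "transpose (slope k (Y s) - B) = slope k (Y s) - B" if "s \<in> {c..d}" for s
    using slope_symmetric[OF Y(2) inv[OF that]] B by (simp add: transpose_diff)
  show "v \<bullet> ((slope k (Y s) - B) *v v) \<le> v \<bullet> ((slope k (Y t) - B) *v v)"
    if "c \<le> s" "s \<le> t" "t \<le> d" for s t v
    using slope_nondecreasing[OF Y that(2), of k v] inv that
    by (simp add: matrix_vector_linear inner_diff_right)
qed

lemma drop_cong_interval:
  assumes "drop_regular r a b" "\<And>s. s \<in> {a..b} \<Longrightarrow> r' s = r s + p"
  shows "drop_regular r' a b" "total_drop r' a b = total_drop r a b"
proof -
  have "\<exists>p. r' t = r t + p \<and> eventually (\<lambda>s. r' s = r s + p) (at_left t)" if "a < t" "t \<le> b" for t
    using eventually_at_left_interval[OF that(1)] that assms(2)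
    by (intro exI[of _ p] conjI) (auto elim!: eventually_mono)
  from drop_cong[OF assms(1) this] show "drop_regular r' a b" "total_drop r' a b = total_drop r a b"
    by auto
qed

lemma chart_upper_total_drop:
  fixes Y :: "real \<Rightarrow> real^'m^('m::finite + 'm)"
  assumes Y: "monotone_path Y" "\<And>s. lagrangian (Y s)" and "c \<le> d"
    and inv: "\<And>s. s \<in> {c..d} \<Longrightarrow> invertible (shear k (Y s))"
  shows "drop_regular (\<lambda>s. rank (upper (Y s))) c d \<and>
    total_drop (\<lambda>s. rank (upper (Y s))) c d = int (ind (slope k (Y c))) - int (ind (slope k (Y d)))"
proof -
  have "transpose 0 = (0 :: real^'m^'m)" by (simp add: transpose_def vec_eq_iff)
  from chart_total_drop[OF Y assms(3) inv this]
  have *: "drop_regular (\<lambda>s. rank (slope k (Y s))) c d"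
    "total_drop (\<lambda>s. rank (slope k (Y s))) c d = int (ind (slope k (Y c))) - int (ind (slope k (Y d)))"
    by simp_all
  have "rank (upper (Y s)) = rank (slope k (Y s)) + 0" if "s \<in> {c..d}" for s
    using rank_upper_eq_rank_slope[OF inv[OF that]] by simp
  from drop_cong_interval[OF *(1) this] *(2) show ?thesis by simp
qed

lemma chart_form_total_drop:
  fixes Y :: "real \<Rightarrow> real^'m^('m::finite + 'm)"
  assumes Y: "monotone_path Y" "\<And>s. lagrangian (Y s)" and "c \<le> d"
    and inv: "\<And>s. s \<in> {c..d} \<Longrightarrow> invertible (shear k (Y s))"
    and Y': "lagrangian Y'" "invertible (shear k Y')"
  shows "drop_regular (\<lambda>s. rank (transpose (Y s) ** Jmat ** Y')) c d \<and>
    total_drop (\<lambda>s. rank (transpose (Y s) ** Jmat ** Y')) c d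
      = int (ind (slope k (Y c) - slope k Y')) - int (ind (slope k (Y d) - slope k Y'))"
proof -
  note * = chart_total_drop[OF Y assms(3) inv slope_symmetric[OF Y']]
  have "rank (transpose (Y s) ** Jmat ** Y') = rank (slope k (Y s) - slope k Y') + 0" if "s \<in> {c..d}" for s
    using rank_symplectic_form_eq_rank_slope_diff[OF Y(2) inv[OF that] Y'(2)] by simp
  from drop_cong_interval[OF conjunct1[OF *] this] * show ?thesis by simp
qed

lemma eventually_invertible_shear:
  fixes Y :: "'a::metric_space \<Rightarrow> real^'m^('m::finite + 'm)"
  assumes "continuous_on UNIV Y" "invertible (shear k (Y x))"
  obtains e where "e > 0" "\<And>s. dist s x < e \<Longrightarrow> invertible (shear k (Y s))"
proof -
  have "continuous_on UNIV (\<lambda>s. det (shear k (Y s)))"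
    by (intro continuous_on_det continuous_on_shear assms)
  then have "open ((\<lambda>s. det (shear k (Y s))) -` (- {0}))"
    by (intro open_vimage) auto
  moreover have "x \<in> (\<lambda>s. det (shear k (Y s))) -` (- {0})"
    using assms(2) invertible_det_nz by auto
  ultimately obtain e where e: "e > 0" "ball x e \<subseteq> (\<lambda>s. det (shear k (Y s))) -` (- {0})"
    using open_contains_ball by blast
  have "invertible (shear k (Y s))" if "dist s x < e" for s
  proof -
    have "s \<in> ball x e" using that by (simp add: dist_commute)
    then have "det (shear k (Y s)) \<noteq> 0" using e(2) by auto
    then show ?thesis using invertible_det_nz by blast
  qed
  then show thesis using that e(1) by blast
qed

text \<open>
  Counting the contacts of a monotone path with the vertical subspace and with \<open>Y'\<close> gives
  results that differ by the change of the comparative index. In a chart this is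
  \<open>mu_inertia\<close> at the two end points; since the statement is additive in the interval and
  does not mention the chart, bisection extends it to all intervals.
\<close>

theorem total_drop_comparison:
  fixes Y :: "real \<Rightarrow> real^'m^('m::finite + 'm)"
  assumes Y: "monotone_path Y" "\<And>s. lagrangian (Y s)" and Y': "lagrangian Y'" and ab: "a \<le> b"
  shows "drop_regular (\<lambda>s. rank (upper (Y s))) a b \<and>
    drop_regular (\<lambda>s. rank (transpose (Y s) ** Jmat ** Y')) a b \<and>
    total_drop (\<lambda>s. rank (upper (Y s))) a b + int (mu (Y a) Y')
      = int (mu (Y b) Y') + total_drop (\<lambda>s. rank (transpose (Y s) ** Jmat ** Y')) a b"
  using ab
proof (induction rule: Bolzano)
  case (trans x y z)
  then show ?case
    using drop_regular_combine[of _ x y z] by (smt (verit, best))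
next
  case (local x)
  obtain k where k: "invertible (shear k (Y x))" "invertible (shear k Y')"
    using common_regular_shear[OF Y(2) Y'] by blast
  obtain e where e: "e > 0" "\<And>s. dist s x < e \<Longrightarrow> invertible (shear k (Y s))"
    using eventually_invertible_shear[of Y k x] Y(1) k(1) unfolding monotone_path_def by blast
  show ?case
  proof (intro exI[of _ e] conjI allI impI e(1), goal_cases)
    case (1 c d)
    then have inv: "invertible (shear k (Y s))" if "s \<in> {c..d}" for s
      using that by (intro e(2)) (auto simp: dist_real_def)
    have cd: "c \<le> d" using 1 by simp
    from chart_upper_total_drop[OF Y cd inv] show ?case by simp
  next
    case (2 c d)
    then have inv: "invertible (shear k (Y s))" if "s \<in> {c..d}" for s
      using that by (intro e(2)) (auto simp: dist_real_def)
    have cd: "c \<le> d" using 2 by simp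
    from chart_form_total_drop[OF Y cd inv Y' k(2)] show ?case by simp
  next
    case (3 c d)
    then have inv: "invertible (shear k (Y s))" if "s \<in> {c..d}" for s
      using that by (intro e(2)) (auto simp: dist_real_def)
    have cd: "c \<le> d" using 3 by simp
    have "mu (Y s) Y' + ind (slope k (Y s)) = ind (slope k (Y s) - slope k Y') + ind (slope k Y')"
      if "s \<in> {c..d}" for s
      by (rule mu_inertia[OF Y(2) Y' inv[OF that] k(2)])
    from this[of c] this[of d]
    show ?case
      using chart_upper_total_drop[OF Y cd inv] chart_form_total_drop[OF Y cd inv Y' k(2)] cd by simp
  qed
qed

section \<open>Two-parameter deformations of symplectic paths\<close>

text \<open>
  A family of Lagrangian frames with two parameters that is monotone in each of them and along the
  diagonal. The aim is to replace the diagonal path by two sides of a square.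
\<close>

context
  fixes F :: "real \<times> real \<Rightarrow> real^'m^('m::finite + 'm)"
  assumes lag: "\<And>z. lagrangian (F z)" and cont: "continuous_on UNIV F"
    and mono1: "\<And>t. monotone_path (\<lambda>s. F (s, t))"
    and mono2: "\<And>s. monotone_path (\<lambda>t. F (s, t))"
    and mono_diag: "monotone_path (\<lambda>s. F (s, s))"
begin

abbreviation upper_rank :: "real \<Rightarrow> real \<Rightarrow> nat" where "upper_rank s t \<equiv> rank (upper (F (s, t)))"

lemma horizontal_regular: "c \<le> d \<Longrightarrow> drop_regular (\<lambda>s. upper_rank s t) c d"
  using total_drop_comparison[OF mono1[of t] lag lag] by blast

lemma vertical_regular: "c \<le> d \<Longrightarrow> drop_regular (upper_rank s) c d"
  using total_drop_comparison[OF mono2[of s] lag lag] by blast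

lemma diagonal_regular: "c \<le> d \<Longrightarrow> drop_regular (\<lambda>s. upper_rank s s) c d"
  using total_drop_comparison[OF mono_diag lag lag] by blast

lemma chart_box:
  obtains e k where "e > 0"
    "\<And>s t. \<bar>s - x\<bar> < e \<Longrightarrow> \<bar>t - y\<bar> < e \<Longrightarrow> invertible (shear k (F (s, t)))"
proof -
  obtain k where k: "invertible (shear k (F (x, y)))"
    using common_regular_shear[OF lag lag] by blast
  obtain e where e: "e > 0" "\<And>z. dist z (x, y) < e \<Longrightarrow> invertible (shear k (F z))"
    using eventually_invertible_shear[OF cont k] by blast
  have "invertible (shear k (F (s, t)))" if "\<bar>s - x\<bar> < e/2" "\<bar>t - y\<bar> < e/2" for s t
  proof (rule e(2))
    have "dist (s, t) (x, y) \<le> dist s x + dist t y"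
      unfolding dist_Pair_Pair by (intro order_trans[OF sqrt_sum_squares_le_sum_abs]) auto
    then show "dist (s, t) (x, y) < e" using that by (simp add: dist_real_def)
  qed
  then show thesis using that[of "e/2" k] e(1) by simp
qed

text \<open>
  Within a chart each side contributes the difference of \<open>ind (slope k F)\<close> at its end
  points, so the contributions around a rectangle cancel. Bisection in \<open>t\<close> stacks
  finitely many such rectangles, with one width \<open>e\<close> that suits all of them.
\<close>

lemma thin_rectangle:
  assumes "t1 \<le> t2"
  shows "\<exists>e>0. \<forall>s1 s2. s1 \<le> x \<and> x \<le> s2 \<and> s2 - s1 < e \<longrightarrow>
    total_drop (\<lambda>s. upper_rank s t1) s1 s2 + total_drop (upper_rank s2) t1 t2
      = total_drop (upper_rank s1) t1 t2 + total_drop (\<lambda>s. upper_rank s t2) s1 s2"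
  using assms
proof (induction rule: Bolzano)
  case (trans t1 t2 t3)
  obtain e where e: "e > 0" "\<And>s1 s2. s1 \<le> x \<Longrightarrow> x \<le> s2 \<Longrightarrow> s2 - s1 < e \<Longrightarrow>
    total_drop (\<lambda>s. upper_rank s t1) s1 s2 + total_drop (upper_rank s2) t1 t2
      = total_drop (upper_rank s1) t1 t2 + total_drop (\<lambda>s. upper_rank s t2) s1 s2"
    using trans(1) by blast
  obtain e' where e': "e' > 0" "\<And>s1 s2. s1 \<le> x \<Longrightarrow> x \<le> s2 \<Longrightarrow> s2 - s1 < e' \<Longrightarrow>
    total_drop (\<lambda>s. upper_rank s t2) s1 s2 + total_drop (upper_rank s2) t2 t3
      = total_drop (upper_rank s1) t2 t3 + total_drop (\<lambda>s. upper_rank s t3) s1 s2"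
    using trans(2) by blast
  have add: "total_drop (upper_rank s) t1 t3 = total_drop (upper_rank s) t1 t2 + total_drop (upper_rank s) t2 t3" for s
    using drop_regular_combine(2)[OF vertical_regular vertical_regular] trans(3,4) by blast
  show ?case
  proof (intro exI[of _ "min e e'"] conjI allI impI)
    fix s1 s2 assume s: "s1 \<le> x \<and> x \<le> s2 \<and> s2 - s1 < min e e'"
    show "total_drop (\<lambda>s. upper_rank s t1) s1 s2 + total_drop (upper_rank s2) t1 t3
      = total_drop (upper_rank s1) t1 t3 + total_drop (\<lambda>s. upper_rank s t3) s1 s2"
      using e(2)[of s1 s2] e'(2)[of s1 s2] add[of s1] add[of s2] s by simp
  qed (use e e' in simp)
next
  case (local y)
  obtain e k where e: "e > 0"
    and inv: "\<And>s t. \<bar>s - x\<bar> < e \<Longrightarrow> \<bar>t - y\<bar> < e \<Longrightarrow> invertible (shear k (F (s, t)))"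
    using chart_box[of x y] by blast
  show ?case
  proof (intro exI[of _ e] conjI allI impI e, goal_cases)
    case (1 t1 t2 s1 s2)
    then have s12: "s1 \<le> s2" and t12: "t1 \<le> t2" by auto
    have i: "invertible (shear k (F (s, t)))" if "s \<in> {s1..s2}" "t \<in> {t1..t2}" for s t
      using 1 that by (intro inv) auto
    have h: "total_drop (\<lambda>s. upper_rank s t) s1 s2 = int (ind (slope k (F (s1, t)))) - int (ind (slope k (F (s2, t))))"
      if "t \<in> {t1..t2}" for t
      using chart_upper_total_drop[OF mono1 lag s12, of k t] i that by blast
    have v: "total_drop (upper_rank s) t1 t2 = int (ind (slope k (F (s, t1)))) - int (ind (slope k (F (s, t2))))"
      if "s \<in> {s1..s2}" for s
      using chart_upper_total_drop[OF mono2 lag t12, of k s] i that by blast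
    show ?case using h[of t1] h[of t2] v[of s1] v[of s2] s12 t12 by simp
  qed
qed

lemma rectangle:
  assumes "s1 \<le> s2" "t1 \<le> t2"
  shows "total_drop (\<lambda>s. upper_rank s t1) s1 s2 + total_drop (upper_rank s2) t1 t2
      = total_drop (upper_rank s1) t1 t2 + total_drop (\<lambda>s. upper_rank s t2) s1 s2"
  using assms(1)
proof (induction rule: Bolzano)
  case (trans s1 s2 s3)
  have "total_drop (\<lambda>s. upper_rank s t) s1 s3 = total_drop (\<lambda>s. upper_rank s t) s1 s2 + total_drop (\<lambda>s. upper_rank s t) s2 s3" for t
    using drop_regular_combine(2)[OF horizontal_regular horizontal_regular] trans(3,4) by blast
  then show ?case using trans(1,2) by simp
next
  case (local x)
  then show ?case using thin_rectangle[OF assms(2), of x] by blast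
qed

text \<open>
  Bisection along the diagonal. The two small squares on the diagonal leave an off-diagonal rectangle
  between them, which is what \<open>rectangle\<close> accounts for.
\<close>

lemma total_drop_diagonal:
  assumes "c \<le> d"
  shows "total_drop (\<lambda>s. upper_rank s s) c d = total_drop (\<lambda>s. upper_rank s c) c d + total_drop (upper_rank d) c d"
  using assms
proof (induction rule: Bolzano)
  case (trans x y z)
  have "total_drop (\<lambda>s. upper_rank s s) x z = total_drop (\<lambda>s. upper_rank s s) x y + total_drop (\<lambda>s. upper_rank s s) y z"
    using drop_regular_combine(2)[OF diagonal_regular diagonal_regular] trans(3,4) by blast
  moreover have "total_drop (\<lambda>s. upper_rank s x) x z = total_drop (\<lambda>s. upper_rank s x) x y + total_drop (\<lambda>s. upper_rank s x) y z"
    using drop_regular_combine(2)[OF horizontal_regular horizontal_regular] trans(3,4) by blast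
  moreover have "total_drop (upper_rank z) x z = total_drop (upper_rank z) x y + total_drop (upper_rank z) y z"
    using drop_regular_combine(2)[OF vertical_regular vertical_regular] trans(3,4) by blast
  ultimately show ?case
    using trans(1,2) rectangle[OF trans(4,3)] by simp
next
  case (local x)
  obtain e k where e: "e > 0"
    and inv: "\<And>s t. \<bar>s - x\<bar> < e \<Longrightarrow> \<bar>t - x\<bar> < e \<Longrightarrow> invertible (shear k (F (s, t)))"
    using chart_box[of x x] by blast
  show ?case
  proof (intro exI[of _ e] conjI allI impI e, goal_cases)
    case (1 c d)
    then have cd: "c \<le> d" by auto
    have i: "invertible (shear k (F (s, t)))" if "s \<in> {c..d}" "t \<in> {c..d}" for s t
      using 1 that by (intro inv) auto
    have h: "total_drop (\<lambda>s. upper_rank s c) c d = int (ind (slope k (F (c, c)))) - int (ind (slope k (F (d, c))))"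
      using chart_upper_total_drop[OF mono1 lag cd, of k c] i cd by simp
    have v: "total_drop (upper_rank d) c d = int (ind (slope k (F (d, c)))) - int (ind (slope k (F (d, d))))"
      using chart_upper_total_drop[OF mono2 lag cd, of k d] i cd by simp
    have "total_drop (\<lambda>s. upper_rank s s) c d = int (ind (slope k (F (c, c)))) - int (ind (slope k (F (d, d))))"
      using chart_upper_total_drop[OF mono_diag lag cd, of k] i by simp
    then show ?case using h v by simp
  qed
qed

lemma total_drop_diagonal':
  assumes "c \<le> d"
  shows "total_drop (\<lambda>s. upper_rank s s) c d = total_drop (upper_rank c) c d + total_drop (\<lambda>s. upper_rank s d) c d"
  using total_drop_diagonal[OF assms] rectangle[OF assms assms] by simp

end

lemma dot_congruence:
  fixes A :: "real^'n^'n" and R :: "real^'p^'n"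
  shows "v \<bullet> ((transpose R ** A ** R) *v v) = (R *v v) \<bullet> (A *v (R *v v))"
  by (metis dot_matrix_transpose matrix_mul_assoc matrix_vector_mul_assoc transpose_transpose)

lemma symplectic_neg_form:
  "symplectic S \<Longrightarrow> transpose S ** transpose Jmat ** S = transpose Jmat"
  by (simp add: symplectic_def transpose_Jmat matrix_minus_left matrix_minus_right)

lemma symplectic_mult:
  assumes "symplectic A" "symplectic B"
  shows "symplectic (A ** B)"
proof -
  have "transpose (A ** B) ** Jmat ** (A ** B) = transpose B ** (transpose A ** Jmat ** A) ** B"
    by (simp add: matrix_transpose_mul matrix_mul_assoc)
  then show ?thesis using assms by (simp add: symplectic_def)
qed

lemma symplectic_matrix_inv:
  assumes "symplectic A"
  shows "symplectic (matrix_inv A)"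
proof -
  let ?B = "matrix_inv A"
  have AB: "A ** ?B = mat 1" by (rule matrix_inv_cancel[OF symplectic_invertible[OF assms]])
  then have BA: "transpose ?B ** transpose A = mat 1"
    by (metis matrix_transpose_mul transpose_mat)
  have "transpose ?B ** Jmat ** ?B = transpose ?B ** (transpose A ** Jmat ** A) ** ?B"
    using assms by (simp add: symplectic_def)
  also have "\<dots> = (transpose ?B ** transpose A) ** Jmat ** (A ** ?B)"
    by (simp add: matrix_mul_assoc)
  finally show ?thesis by (simp add: symplectic_def AB BA)
qed

lemma symplectic_mat_1 [simp]: "symplectic (mat 1)"
  by (simp add: symplectic_def)

text \<open>
  By the product rule and \<open>Z\<^sup>T J\<^sup>T Z = J\<^sup>T\<close>, the form of a product
  \<open>Z Y\<close> is the form of \<open>Y\<close> plus a form congruent to that of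
  \<open>Z\<close>.
\<close>

lemma nonneg_derivative_at_mult:
  fixes Z :: "real \<Rightarrow> real^('m::finite + 'm)^('m + 'm)" and Y :: "real \<Rightarrow> real^'p^('m + 'm)"
  assumes "nonneg_derivative_at Z s" "nonneg_derivative_at Y s" "symplectic (Z s)"
  shows "nonneg_derivative_at (\<lambda>s. Z s ** Y s) s"
proof -
  obtain D where D: "(Z has_vector_derivative D) (at s)"
     "\<And>v. 0 \<le> v \<bullet> ((transpose (Z s) ** transpose Jmat ** D) *v v)"
    using assms(1) unfolding nonneg_derivative_at_def by blast
  obtain E where E: "(Y has_vector_derivative E) (at s)"
     "\<And>v. 0 \<le> v \<bullet> ((transpose (Y s) ** transpose Jmat ** E) *v v)"
    using assms(2) unfolding nonneg_derivative_at_def by blast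
  have "((\<lambda>s. Z s ** Y s) has_vector_derivative (Z s ** E + D ** Y s)) (at s)"
    by (rule bounded_bilinear.has_vector_derivative[OF bounded_bilinear_matrix_mult D(1) E(1)])
  moreover have "0 \<le> v \<bullet> ((transpose (Z s ** Y s) ** transpose Jmat ** (Z s ** E + D ** Y s)) *v v)" for v
  proof -
    have "transpose (Z s ** Y s) ** transpose Jmat ** (Z s ** E + D ** Y s)
       = transpose (Y s) ** (transpose (Z s) ** transpose Jmat ** Z s) ** E
         + transpose (Y s) ** (transpose (Z s) ** transpose Jmat ** D) ** Y s"
      by (simp add: matrix_transpose_mul matrix_mul_assoc matrix_add_ldistrib)
    then show ?thesis
      using E(2)[of v] D(2)[of "Y s *v v"] symplectic_neg_form[OF assms(3)]
      by (simp add: matrix_vector_linear inner_add_right dot_congruence)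
  qed
  ultimately show ?thesis unfolding nonneg_derivative_at_def by blast
qed

lemma monotone_path_const: "monotone_path (\<lambda>s. Y)"
proof -
  have "nonneg_derivative_at (\<lambda>s. Y) s" for s
    unfolding nonneg_derivative_at_def by (intro exI[of _ 0]) auto
  then show ?thesis unfolding monotone_path_def by (auto intro: exI[of _ "{}"])
qed

lemma monotone_path_mult:
  fixes Z :: "real \<Rightarrow> real^('m::finite + 'm)^('m + 'm)" and Y :: "real \<Rightarrow> real^'p^('m + 'm)"
  assumes Z: "monotone_path Z" "\<And>s. symplectic (Z s)" and Y: "monotone_path Y"
  shows "monotone_path (\<lambda>s. Z s ** Y s)"
  unfolding monotone_path_def
proof (intro conjI allI)
  show "continuous_on UNIV (\<lambda>s. Z s ** Y s)"
    using Z(1) Y by (intro matrix_continuous_on) (auto simp: monotone_path_def)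
  fix a b
  obtain K K' where "finite K" "\<forall>s\<in>{a..b} - K. nonneg_derivative_at Z s"
      "finite K'" "\<forall>s\<in>{a..b} - K'. nonneg_derivative_at Y s"
    using Z(1) Y unfolding monotone_path_def by meson
  moreover have "nonneg_derivative_at Z s \<Longrightarrow> nonneg_derivative_at Y s \<Longrightarrow>
      nonneg_derivative_at (\<lambda>s. Z s ** Y s) s" for s
    by (rule nonneg_derivative_at_mult[OF _ _ Z(2)])
  ultimately show "\<exists>K. finite K \<and> (\<forall>s\<in>{a..b} - K. nonneg_derivative_at (\<lambda>s. Z s ** Y s) s)"
    by (intro exI[of _ "K \<union> K'"]) auto
qed

lemma monotone_path_mult_right:
  fixes Z :: "real \<Rightarrow> real^('m::finite + 'm)^('m + 'm)" and R :: "real^'p^('m + 'm)"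
  assumes Z: "monotone_path Z" "\<And>s. symplectic (Z s)"
  shows "monotone_path (\<lambda>s. Z s ** R)"
  by (rule monotone_path_mult[OF Z monotone_path_const])

lemma monotone_path_mult_left:
  fixes Y :: "real \<Rightarrow> real^'p^('m::finite + 'm)"
  assumes "monotone_path Y" "symplectic A"
  shows "monotone_path (\<lambda>s. A ** Y s)"
  by (rule monotone_path_mult[OF monotone_path_const assms(2) assms(1)])

text \<open>
  At a point of differentiability \<open>S\<^sup>T J\<^sup>T S' = S\<^sup>T \<Psi> S\<close> for the
  derivative \<open>S'\<close>, so the sign of \<open>\<Psi>\<close> carries over.
\<close>

lemma monotone_path_if_C1p:
  fixes S :: "real \<Rightarrow> real^('m::finite + 'm)^('m + 'm)"
  assumes C1p: "C1p S" and sym: "\<And>t. symplectic (S t)"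
    and Psi: "\<And>t. S differentiable (at t) \<Longrightarrow> nonneg_def (Psi S t)"
  shows "monotone_path S"
  unfolding monotone_path_def
proof (intro conjI allI)
  have pw: "S piecewise_C1_differentiable_on {a..b}" for a b
    using C1p by (simp add: C1p_def)
  have "isCont S t" for t
  proof -
    have "continuous_on {t-1..t+1} S"
      using pw unfolding piecewise_C1_differentiable_on_def by blast
    then show ?thesis by (intro continuous_on_interior[of "{t-1..t+1}"]) auto
  qed
  then show "continuous_on UNIV S" by (simp add: continuous_on_eq_continuous_at)
  fix a b
  obtain K where K: "finite K" "S C1_differentiable_on ({a..b} - K)"
    using pw unfolding piecewise_C1_differentiable_on_def by blast
  have "nonneg_derivative_at S s" if "s \<in> {a..b} - K" for s
  proof -
    have diff: "S differentiable (at s)" using K(2) that by (auto simp: C1_differentiable_on_eq)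
    have "0 \<le> v \<bullet> ((transpose (S s) ** transpose Jmat ** vector_derivative S (at s)) *v v)" for v
    proof -
      have "matrix_inv (S s) ** S s = mat 1"
        by (rule matrix_inv_cancel[OF symplectic_invertible[OF sym]])
      then have "transpose (S s) ** transpose Jmat ** vector_derivative S (at s)
          = transpose (S s) ** Psi S s ** S s"
        unfolding Psi_def by (metis matrix_mul_assoc matrix_mul_rid)
      then show ?thesis
        using Psi[OF diff] by (simp add: dot_congruence nonneg_def_def)
    qed
    then show ?thesis
      using diff unfolding nonneg_derivative_at_def vector_derivative_works by blast
  qed
  then show "\<exists>K. finite K \<and> (\<forall>s\<in>{a..b} - K. nonneg_derivative_at S s)" using K(1) by blast
qed

lemma upper_right_eq: "upper_right Z = upper (Z ** vstack 0 (mat 1))"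
  by (simp add: vec_eq_iff upper_right_def upper_def matrix_matrix_mult_def sum_UNIV_Plus vstack_def
      mat_def if_distrib[where f = "\<lambda>x. _ * x"] cong: if_cong)

text \<open>
  The vertical subspace is the image of \<open>x = 0\<close>, the Dirichlet condition; multiplied by a
  fundamental matrix it becomes a principal solution.
\<close>

lemma lagrangian_vertical: "lagrangian (vstack 0 (mat 1) :: real^'m^('m::finite + 'm))"
proof -
  have "transpose 0 = (0 :: real^'m^'m)" by (simp add: transpose_def vec_eq_iff)
  moreover have "v = 0" if "vstack 0 (mat 1) *v v = (0 :: real^('m::finite + 'm))" for v :: "real^'m"
  proof -
    have "(vstack 0 (mat 1) *v v :: real^('m::finite + 'm)) $ Inr i = (mat 1 *v v) $ i" for i
      by (simp add: matrix_vector_mult_def vstack_def)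
    then show ?thesis using that by (simp add: vec_eq_iff)
  qed
  ultimately show ?thesis by (simp add: lagrangian_def symplectic_form_blocks)
qed

lemma lagrangian_symplectic_mult:
  assumes "symplectic Z" "lagrangian Y"
  shows "lagrangian (Z ** Y)"
proof -
  have "transpose (Z ** Y) ** Jmat ** (Z ** Y) = transpose Y ** (transpose Z ** Jmat ** Z) ** Y"
    by (simp add: matrix_transpose_mul matrix_mul_assoc)
  moreover have "v = 0" if "(Z ** Y) *v v = 0" for v
  proof -
    have "(matrix_inv Z ** Z) *v (Y *v v) = 0"
      using that by (metis matrix_vector_mul_assoc matrix_vector_mult_0_right)
    then have "Y *v v = 0"
      using matrix_inv_cancel[OF symplectic_invertible[OF assms(1)]] by simp
    then show ?thesis using assms(2) by (simp add: lagrangian_def)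
  qed
  ultimately show ?thesis using assms by (simp add: lagrangian_def symplectic_def)
qed

text \<open>
  Two monotone factors may be moved one after the other, in either order, instead of simultaneously.
\<close>

theorem total_drop_product:
  fixes A B :: "real \<Rightarrow> real^('m::finite + 'm)^('m + 'm)"
  assumes A: "monotone_path A" "\<And>s. symplectic (A s)" and B: "monotone_path B" "\<And>s. symplectic (B s)"
    and ab: "a \<le> b"
  shows "total_drop (\<lambda>s. rank (upper_right (A s ** B s))) a b
      = total_drop (\<lambda>s. rank (upper_right (A s ** B a))) a b + total_drop (\<lambda>s. rank (upper_right (A b ** B s))) a b"
    and "total_drop (\<lambda>s. rank (upper_right (A s ** B s))) a b
      = total_drop (\<lambda>s. rank (upper_right (A a ** B s))) a b + total_drop (\<lambda>s. rank (upper_right (A s ** B b))) a b"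
proof -
  define F where "F z = A (fst z) ** B (snd z) ** vstack 0 (mat 1)" for z
  have lag: "lagrangian (F z)" for z
    unfolding F_def using A B lagrangian_vertical lagrangian_symplectic_mult symplectic_mult by blast
  have "continuous_on UNIV (\<lambda>z. A (fst z))" "continuous_on UNIV (\<lambda>z. B (snd z))"
    using A(1) B(1) unfolding monotone_path_def
    by (auto intro!: continuous_on_compose2[of UNIV A] continuous_on_compose2[of UNIV B] continuous_intros)
  then have cont: "continuous_on UNIV F"
    unfolding F_def by (intro matrix_continuous_on continuous_on_const) auto
  have m1: "monotone_path (\<lambda>s. F (s, t))" for t
    unfolding F_def using monotone_path_mult_right[OF A, of "B t ** vstack 0 (mat 1)"]
    by (simp add: matrix_mul_assoc)
  have m2: "monotone_path (\<lambda>t. F (s, t))" for s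
    unfolding F_def using monotone_path_mult_left[OF monotone_path_mult_right[OF B, of "vstack 0 (mat 1)"] A(2)[of s]]
    by (simp add: matrix_mul_assoc)
  have m3: "monotone_path (\<lambda>s. F (s, s))"
    unfolding F_def using monotone_path_mult[OF A monotone_path_mult_right[OF B, of "vstack 0 (mat 1)"]]
    by (simp add: matrix_mul_assoc)
  have rk: "rank (upper_right (A s ** B t)) = rank (upper (F (s, t)))" for s t
    by (simp add: upper_right_eq F_def)
  show "total_drop (\<lambda>s. rank (upper_right (A s ** B s))) a b
      = total_drop (\<lambda>s. rank (upper_right (A s ** B a))) a b + total_drop (\<lambda>s. rank (upper_right (A b ** B s))) a b"
    unfolding rk by (rule total_drop_diagonal[OF lag cont m1 m2 m3 ab])
  show "total_drop (\<lambda>s. rank (upper_right (A s ** B s))) a b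
      = total_drop (\<lambda>s. rank (upper_right (A a ** B s))) a b + total_drop (\<lambda>s. rank (upper_right (A s ** B b))) a b"
    unfolding rk by (rule total_drop_diagonal'[OF lag cont m1 m2 m3 ab])
qed

lemma drop_regular_upper_right:
  assumes "monotone_path Z" "\<And>s. symplectic (Z s)" "a \<le> b"
  shows "drop_regular (\<lambda>s. rank (upper_right (Z s))) a b"
  unfolding upper_right_eq
  using total_drop_comparison[OF monotone_path_mult_right[OF assms(1,2)] lagrangian_symplectic_mult[OF assms(2) lagrangian_vertical]
    lagrangian_vertical assms(3)] by blast

section \<open>Graphs of symplectic matrices\<close>

lemma rank_nullity:
  fixes A :: "real^'n^'m"
  shows "rank A + dim {v. A *v v = 0} = CARD('n)"
proof -
  have "{v. A *v v = 0} = {y \<in> UNIV. \<forall>x \<in> range ((*v) (transpose A)). orthogonal x y}"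
  proof -
    have "A *v y = 0 \<longleftrightarrow> (\<forall>x. (transpose A *v x) \<bullet> y = 0)" for y
      using dot_matrix_transpose[of _ A y] by (metis inner_eq_zero_iff inner_zero_right)
    then show ?thesis by (auto simp: orthogonal_def)
  qed
  then have "dim {v. A *v v = 0} + dim (range ((*v) (transpose A))) = dim (UNIV :: (real^'n) set)"
    using dim_subspace_orthogonal_to_vectors[of "range ((*v) (transpose A))" UNIV]
    by (simp add: linear_subspace_image del: transpose_matrix_vector)
  then show ?thesis by (simp only: rank_dim_range[symmetric] rank_transpose) (simp add: DIM_cart)
qed

lemma upper_langle: "upper (langle S) = vstack (hstack (mat 1) 0) (upper S)"
  and lower_langle: "lower (langle S) = vstack (hstack 0 (- mat 1)) (lower S)"
  by (simp_all add: langle_def)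

text \<open>
  For \<open>S'\<close> symplectic the right-hand side is \<open>(S - S')\<^sup>T J S'\<close>, so
  contact of the graphs of \<open>S\<close> and \<open>S'\<close> is measured by the rank of \<open>S
  - S'\<close>.
\<close>

lemma symplectic_form_langle:
  fixes S S' :: "real^('n::finite + 'n)^('n + 'n)"
  shows "transpose (langle S) ** Jmat ** langle S' = transpose S ** Jmat ** S' - Jmat"
proof -
  have J: "transpose (hstack (mat 1) 0) ** hstack 0 (- mat 1) - transpose (hstack 0 (- mat 1)) ** hstack (mat 1) 0
      = - (Jmat :: real^('n + 'n)^('n + 'n))"
  proof -
    have "(transpose (hstack (mat 1 :: real^'n^'n) (0 :: real^'n^'n)) ** hstack 0 (- mat 1)
       - transpose (hstack 0 (- mat 1)) ** hstack (mat 1) 0) $ i $ j = (- (Jmat :: real^('n + 'n)^('n + 'n))) $ i $ j" for i j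
      by (cases i; cases j) (simp_all add: matrix_matrix_mult_def transpose_def hstack_def Jmat_def vstack_def mat_def
          if_distrib[where f = "\<lambda>x. x * _"] if_distrib[where f = "\<lambda>x. _ * x"] sum_negf cong: if_cong)
    then show ?thesis by (simp add: vec_eq_iff)
  qed
  have "transpose (langle S) ** Jmat ** langle S' =
     (transpose (hstack (mat 1) 0) ** hstack 0 (- mat 1) - transpose (hstack 0 (- mat 1)) ** hstack (mat 1) 0)
     + (transpose (upper S) ** lower S' - transpose (lower S) ** upper S')"
    unfolding symplectic_form_blocks upper_langle lower_langle
    by (simp add: transpose_mult_blocks)
  then show ?thesis unfolding J symplectic_form_blocks by simp
qed

lemma langle_vec:
  fixes S :: "real^('n::finite + 'n)^('n + 'n)"
  shows "(upper (langle S) *v v) $ Inl i = v $ Inl i" "(upper (langle S) *v v) $ Inr i = (upper S *v v) $ i"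
    "(lower (langle S) *v v) $ Inl i = - v $ Inr i"
  unfolding upper_langle lower_langle
  by (simp_all add: matrix_vector_mult_def vstack_def hstack_def sum_UNIV_Plus mat_def
     if_distrib[where f = "\<lambda>x. x * _"] sum_negf cong: if_cong)

lemma lagrangian_langle:
  assumes "symplectic S"
  shows "lagrangian (langle S)"
proof -
  have "v = 0" if "langle S *v v = 0" for v
  proof -
    have "(langle S *v v) $ Inl j = (upper (langle S) *v v) $ j" for j
      by (simp add: upper_def matrix_vector_mult_def)
    moreover have "(langle S *v v) $ Inr j = (lower (langle S) *v v) $ j" for j
      by (simp add: lower_def matrix_vector_mult_def)
    ultimately have "v $ Inl i = 0" "v $ Inr i = 0" for i
      using that langle_vec(1)[of S v i] langle_vec(3)[of S v i] by auto
    then have "v $ i = 0" for i by (cases i) auto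
    then show ?thesis by (simp add: vec_eq_iff)
  qed
  then show ?thesis
    using assms by (simp add: lagrangian_def symplectic_form_langle symplectic_def)
qed

text \<open>
  The kernel of \<open>(I, 0; A, B)\<close> consists of the vectors \<open>(0, w)\<close> with
  \<open>B w = 0\<close>. Contact of a graph with the vertical subspace of the doubled space is thus a
  loss of rank of the block \<open>B\<close>, up to a constant that no drop sees.
\<close>

lemma rank_upper_langle:
  fixes S :: "real^('n::finite + 'n)^('n + 'n)"
  shows "rank (upper (langle S)) = rank (upper_right S) + CARD('n)"
proof -
  define e :: "real^'n \<Rightarrow> real^('n + 'n)" where "e w = (\<chi> i. case i of Inl k \<Rightarrow> 0 | Inr k \<Rightarrow> w $ k)" for w
  have lin: "linear e"
    by (auto intro!: linearI simp: e_def vec_eq_iff split: sum.split)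
  have inj: "inj e"
    by (auto intro!: injI simp: e_def vec_eq_iff) (metis sum.case(2))
  have up: "upper S *v e w = upper_right S *v w" for w
    by (simp add: vec_eq_iff matrix_vector_mult_def upper_def upper_right_def e_def sum_UNIV_Plus)
  have "{v. upper (langle S) *v v = 0} = e ` {w. upper_right S *v w = 0}"
  proof (intro subset_antisym subsetI)
    fix v assume "v \<in> {v. upper (langle S) *v v = 0}"
    then have v: "upper (langle S) *v v = 0" by simp
    have l: "v $ Inl i = 0" for i using v langle_vec(1)[of S v i] by simp
    have "v = e (\<chi> k. v $ Inr k)"
      by (auto simp: e_def vec_eq_iff l split: sum.split)
    moreover have "upper S *v v = 0"
      using v langle_vec(2)[of S v] by (simp add: vec_eq_iff)
    ultimately show "v \<in> e ` {w. upper_right S *v w = 0}"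
      using up by (metis (mono_tags, lifting) imageI mem_Collect_eq)
  next
    fix v assume "v \<in> e ` {w. upper_right S *v w = 0}"
    then obtain w where w: "v = e w" "upper_right S *v w = 0" by auto
    have "(upper (langle S) *v v) $ i = 0" for i
      using w up[of w] by (cases i) (simp_all add: langle_vec, simp add: e_def)
    then show "v \<in> {v. upper (langle S) *v v = 0}" by (simp add: vec_eq_iff)
  qed
  then have "dim {v. upper (langle S) *v v = 0} = dim {w. upper_right S *v w = 0}"
    using dim_image_eq[OF lin] inj by (metis inj_on_subset subset_UNIV)
  then show ?thesis
    using rank_nullity[of "upper (langle S)"] rank_nullity[of "upper_right S"] by (simp add: card_UNIV_sum)
qed

lemma monotone_path_langle:
  fixes Z :: "real \<Rightarrow> real^('n::finite + 'n)^('n + 'n)"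
  assumes "monotone_path Z"
  shows "monotone_path (\<lambda>s. langle (Z s))"
proof -
  \<comment> \<open>\<open>langle\<close> is affine, with linear part \<open>lin\<close>.\<close>
  define lin :: "real^('n + 'n)^('n + 'n) \<Rightarrow> real^('n + 'n)^(('n + 'n) + ('n + 'n))"
    where "lin D = vstack (vstack 0 (upper D)) (vstack 0 (lower D))" for D
  have bl: "bounded_linear lin"
    unfolding linear_conv_bounded_linear[symmetric] lin_def
    by (auto intro!: linearI simp: vec_eq_iff vstack_def upper_def lower_def split: sum.split)
  have eq: "langle D = langle 0 + lin D" for D
    by (auto simp: lin_def langle_def vec_eq_iff vstack_def upper_def lower_def split: sum.split)
  have "nonneg_derivative_at (\<lambda>s. langle (Z s)) s" if Z: "nonneg_derivative_at Z s" for s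
  proof -
    obtain D where D: "(Z has_vector_derivative D) (at s)"
     "\<And>v. 0 \<le> v \<bullet> ((transpose (Z s) ** transpose Jmat ** D) *v v)"
      using Z unfolding nonneg_derivative_at_def by blast
    have "((\<lambda>s. langle 0 + lin (Z s)) has_vector_derivative lin D) (at s)"
      using has_vector_derivative_add[OF has_vector_derivative_const bounded_linear.has_vector_derivative[OF bl D(1)]]
      by simp
    then have "((\<lambda>s. langle (Z s)) has_vector_derivative lin D) (at s)"
      by (subst eq)
    moreover have "transpose (langle (Z s)) ** Jmat ** lin D = transpose (Z s) ** Jmat ** D"
      unfolding symplectic_form_blocks upper_langle lower_langle
      by (simp add: lin_def transpose_mult_blocks)
    ultimately show ?thesis
      using D(2) unfolding nonneg_derivative_at_def
      by (intro exI[of _ "lin D"]) (simp add: transpose_Jmat matrix_minus_left matrix_minus_right)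
  qed
  moreover have "continuous_on UNIV (\<lambda>s. langle (Z s))"
    using assms unfolding monotone_path_def
    by (subst eq) (intro continuous_intros bounded_linear.continuous_on[OF bl], blast)
  ultimately show ?thesis using assms unfolding monotone_path_def by blast
qed

lemma ind_zero: "ind (0 :: real^'m^'m) = 0"
proof -
  have "transpose 0 = (0 :: real^'m^'m)" by (simp add: transpose_def vec_eq_iff)
  then show ?thesis using rank_eq_ind_add_ind_uminus[of "0 :: real^'m^'m"] by simp
qed

lemma mu_self:
  assumes "lagrangian Y"
  shows "mu Y Y = 0"
proof -
  obtain c where "invertible (shear c Y)" using common_regular_shear[OF assms assms] by blast
  from mu_inertia[OF assms assms this this] show ?thesis by (simp add: ind_zero)
qed

lemma mu_le:
  fixes Y :: "real^'m^('m::finite + 'm)"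
  assumes "lagrangian Y" "lagrangian Y'"
  shows "mu Y Y' \<le> 2 * CARD('m)"
proof -
  obtain c where c: "invertible (shear c Y)" "invertible (shear c Y')"
    using common_regular_shear[OF assms] by blast
  have "transpose (slope c Y') = slope c Y'" "transpose (slope c Y - slope c Y') = slope c Y - slope c Y'"
    using slope_symmetric[OF assms(1) c(1)] slope_symmetric[OF assms(2) c(2)] by (simp_all add: transpose_diff)
  then show ?thesis
    using mu_inertia[OF assms c] ind_le_CARD[of "slope c Y'"] ind_le_CARD[of "slope c Y - slope c Y'"] by linarith
qed

text \<open>
  The comparison theorem for the graphs of \<open>L S(\<lambda>) R\<close> against the graph at
  \<open>\<lambda> = a\<close>, where the comparative index vanishes. The constant factors do not
  affect the rank of the difference, which makes the last summand independent of \<open>L\<close> and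
  \<open>R\<close>.
\<close>

theorem total_drop_upper_right:
  fixes S :: "real \<Rightarrow> real^('n::finite + 'n)^('n + 'n)"
  assumes S: "monotone_path S" "\<And>s. symplectic (S s)" and LR: "symplectic L" "symplectic R" and ab: "a \<le> b"
  shows "drop_regular (\<lambda>s. rank (S c - S s)) a b"
    and "total_drop (\<lambda>s. rank (upper_right (L ** S s ** R))) a b
      = int (mu (langle (L ** S b ** R)) (langle (L ** S a ** R))) + total_drop (\<lambda>s. rank (S a - S s)) a b"
proof -
  define Z where "Z s = L ** S s ** R" for s
  have symZ: "symplectic (Z s)" for s
    unfolding Z_def using S(2) LR symplectic_mult by blast
  have "monotone_path Z"
    unfolding Z_def using monotone_path_mult_right[OF monotone_path_mult_left[OF S(1) LR(1)]] symplectic_mult[OF LR(1) S(2)]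
    by blast
  note mZ = monotone_path_langle[OF this] and lZ = lagrangian_langle[OF symZ]
  have w: "rank (S c - S s) = rank (transpose (langle (Z s)) ** Jmat ** langle (Z c))" for s c
  proof -
    have "transpose (langle (Z s)) ** Jmat ** langle (Z c)
        = transpose (Z s) ** Jmat ** Z c - transpose (Z s) ** Jmat ** Z s"
      using symZ[of s] by (simp add: symplectic_form_langle symplectic_def)
    also have "\<dots> = transpose (Z s) ** (Jmat ** (L ** ((S c - S s) ** R)))"
      by (simp add: Z_def matrix_diff_ldistrib matrix_diff_rdistrib matrix_mul_assoc)
    finally have eq: "transpose (langle (Z s)) ** Jmat ** langle (Z c)
       = transpose (Z s) ** (Jmat ** (L ** ((S c - S s) ** R)))" .
    have "(transpose (Jmat :: real^('n + 'n)^('n + 'n)) ** Jmat) $ i $ j = mat 1 $ i $ j" for i j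
      by (cases i; cases j) (simp_all add: transpose_def matrix_matrix_mult_def sum_UNIV_Plus Jmat_def
          vstack_def hstack_def mat_def if_distrib[where f = "\<lambda>x. x * _"] sum_negf cong: if_cong)
    then have "transpose (Jmat :: real^('n + 'n)^('n + 'n)) ** Jmat = mat 1"
      by (simp add: vec_eq_iff)
    then have "invertible (Jmat :: real^('n + 'n)^('n + 'n))"
      using invertible_left_inverse by blast
    then show ?thesis
      unfolding eq using symplectic_invertible[OF LR(1)] symplectic_invertible[OF LR(2)]
        transpose_invertible[OF symplectic_invertible[OF symZ]]
      by (simp add: rank_mult_invertible)
  qed
  note main = total_drop_comparison[OF mZ lZ lZ ab]
  show "drop_regular (\<lambda>s. rank (S c - S s)) a b"
    using main[of c] by (simp add: w)
  have "rank (upper_right (Z s)) + CARD('n) = rank (upper (langle (Z s))) + 0" for s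
    by (simp add: rank_upper_langle)
  then have "total_drop (\<lambda>s. rank (upper_right (Z s)) + CARD('n)) a b = total_drop (\<lambda>s. rank (upper (langle (Z s)))) a b"
    by (intro drop_cong_interval(2)) (use main[of a] in auto)
  moreover have "total_drop (\<lambda>s. rank (upper_right (Z s)) + CARD('n)) a b = total_drop (\<lambda>s. rank (upper_right (Z s))) a b"
    by (rule drop_cong_interval(2)[OF drop_regular_upper_right[OF \<open>monotone_path Z\<close> symZ ab], where p = "CARD('n)"]) simp
  ultimately show "total_drop (\<lambda>s. rank (upper_right (L ** S s ** R))) a b
      = int (mu (langle (L ** S b ** R)) (langle (L ** S a ** R))) + total_drop (\<lambda>s. rank (S a - S s)) a b"
    using main[of a] mu_self[OF lZ[of a]] unfolding w by (simp add: Z_def)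
qed

section \<open>The symplectic difference system\<close>

lemma left_drop_const [simp]: "left_drop (\<lambda>s. c) t = 0"
  using left_drop_eq(1)[of "\<lambda>s. c" c t] by simp

lemma total_drop_const [simp]: "total_drop (\<lambda>s. c) a b = 0"
  by (simp add: total_drop_def)

lemma total_drop_nonneg: "drop_regular r a b \<Longrightarrow> 0 \<le> total_drop r a b"
  unfolding total_drop_def by (rule sum_nonneg) (auto simp: drop_regular_def drop_points_def)

lemma card_drop_points_le:
  assumes "drop_regular r a b"
  shows "int (card (drop_points r a b)) \<le> total_drop r a b"
proof -
  have "(\<Sum>t\<in>drop_points r a b. 1) \<le> total_drop r a b"
    unfolding total_drop_def using assms
    by (intro sum_mono) (force simp: drop_regular_def drop_points_def)
  then show ?thesis by simp
qed

lemma matrix_inv_unique: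
  fixes A B :: "real^'n^'n"
  assumes "A ** B = mat 1"
  shows "matrix_inv A = B"
proof -
  have "invertible A" using assms invertible_right_inverse by blast
  then show ?thesis
    by (metis assms matrix_inv_cancel(2) matrix_mul_assoc matrix_mul_lid matrix_mul_rid)
qed

lemma matrix_inv_mult_cancel:
  fixes A B :: "real^'n^'n"
  assumes "invertible A" "invertible B"
  shows "matrix_inv (A ** B) ** A = matrix_inv B"
proof -
  have "(A ** B) ** (matrix_inv B ** matrix_inv A) = A ** (B ** matrix_inv B) ** matrix_inv A"
    by (simp only: matrix_mul_assoc)
  also have "\<dots> = mat 1" using assms by (simp add: matrix_inv_cancel)
  finally have "matrix_inv (A ** B) = matrix_inv B ** matrix_inv A"
    by (rule matrix_inv_unique)
  then show ?thesis using assms by (simp add: matrix_mul_assoc[symmetric] matrix_inv_cancel)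
qed

lemma matrix_inv_mat_1: "matrix_inv (mat 1) = (mat 1 :: real^'n^'n)"
  by (rule matrix_inv_unique) simp

lemma fund_zero: "fund S 0 k t = transition S k t"
  by (simp add: fund_def matrix_inv_mat_1)

lemma theta_eq_left_drop:
  "theta S N t = left_drop (\<lambda>s. rank (upper_right (transition S (N + 1) s))) t"
  by (simp add: theta_def left_drop_def rank_left_def principal_def fund_zero upper_right_eq)

lemma rho_eq_left_drop: "rho S a t = left_drop (\<lambda>s. rank (S a - S s)) t"
  by (simp add: rho_def left_drop_def rank_left_def)

context
  fixes S :: "nat \<Rightarrow> real \<Rightarrow> real^('n::finite + 'n)^('n + 'n)" and N :: nat
  assumes all_monotone: "\<forall>k\<le>N. monotone_path (S k)"
    and all_symplectic: "\<forall>k\<le>N. \<forall>t. symplectic (S k t)"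
begin

lemmas monotone_coeff = all_monotone[rule_format] and symplectic_coeff = all_symplectic[rule_format]

lemma symplectic_transition: "j \<le> N + 1 \<Longrightarrow> symplectic (transition S j t)"
  by (induction j) (auto intro!: symplectic_mult symplectic_coeff)

lemma monotone_path_transition: "j \<le> N + 1 \<Longrightarrow> monotone_path (transition S j)"
proof (induction j)
  case 0
  then show ?case using monotone_path_const[of "mat 1"] by (simp add: fun_eq_iff[symmetric])
next
  case (Suc j)
  then have "monotone_path (\<lambda>t. S j t ** transition S j t)"
    by (intro monotone_path_mult monotone_coeff symplectic_coeff) auto
  then show ?case by (simp add: fun_eq_iff[symmetric])
qed

text \<open>
  The product \<open>S\<^sub>N \<dots> S\<^sub>j\<close>, in the shape in which it occurs in
  \<open>Ld\<close> and \<open>Ld_star\<close>.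
\<close>

definition backward :: "nat \<Rightarrow> real \<Rightarrow> real^('n + 'n)^('n + 'n)" where
  "backward j t = matrix_inv (fund S (N + 1) j t)"

lemma symplectic_fund: "j \<le> N + 1 \<Longrightarrow> symplectic (fund S (N + 1) j t)"
  unfolding fund_def by (intro symplectic_mult symplectic_matrix_inv symplectic_transition) auto

lemma symplectic_backward: "j \<le> N + 1 \<Longrightarrow> symplectic (backward j t)"
  unfolding backward_def by (intro symplectic_matrix_inv symplectic_fund)

lemma backward_Suc:
  assumes "j \<le> N"
  shows "backward (Suc j) t ** S j t = backward j t"
  unfolding backward_def fund_step
  using assms by (intro matrix_inv_mult_cancel symplectic_invertible symplectic_coeff symplectic_fund) auto

lemma backward_last: "backward (Suc N) t = mat 1"
  unfolding backward_def using fund_self[of "N + 1" S t] symplectic_coeff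
  by (simp add: matrix_inv_unique)

lemma deformation_factor:
  assumes "j \<le> N"
  shows "monotone_path (\<lambda>s. backward (Suc j) t ** S j s)" "symplectic (backward (Suc j) t ** S j s)"
  using assms
  by (auto intro!: monotone_path_mult_left symplectic_mult monotone_coeff symplectic_coeff symplectic_backward)

text \<open>
  The factors \<open>S\<^sub>N, \<dots>, S\<^sub>0\<close> are moved from \<open>a\<close> to
  \<open>b\<close> in this order: while \<open>S\<^sub>k\<close> moves, those on its left have already
  arrived at \<open>b\<close> and those on its right are still at \<open>a\<close>.
\<close>

lemma total_drop_transition_star:
  assumes ab: "a \<le> b"
  shows "total_drop (\<lambda>s. rank (upper_right (transition S (N + 1) s))) a b
    = (\<Sum>k\<le>N. total_drop (\<lambda>s. rank (upper_right (backward (Suc k) b ** S k s ** transition S k a))) a b)"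
proof -
  have "total_drop (\<lambda>s. rank (upper_right (backward j b ** transition S j s))) a b
    = (\<Sum>k<j. total_drop (\<lambda>s. rank (upper_right (backward (Suc k) b ** S k s ** transition S k a))) a b)"
    if "j \<le> N + 1" for j
    using that
  proof (induction j)
    case (Suc j)
    then have j: "j \<le> N" by simp
    show ?case
      using total_drop_product(1)[OF deformation_factor[OF j, of b] monotone_path_transition[of j]
          symplectic_transition[of j] ab] Suc j
      by (simp add: matrix_mul_assoc backward_Suc)
  qed simp
  from this[of "N + 1"] show ?thesis
    by (simp add: backward_last lessThan_Suc_atMost)
qed

text \<open>
  The same deformation with the factors moved in the opposite order.
\<close>

lemma total_drop_transition:
  assumes ab: "a \<le> b"
  shows "total_drop (\<lambda>s. rank (upper_right (transition S (N + 1) s))) a b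
    = (\<Sum>k\<le>N. total_drop (\<lambda>s. rank (upper_right (backward (Suc k) a ** S k s ** transition S k b))) a b)"
proof -
  have "total_drop (\<lambda>s. rank (upper_right (backward j a ** transition S j s))) a b
    = (\<Sum>k<j. total_drop (\<lambda>s. rank (upper_right (backward (Suc k) a ** S k s ** transition S k b))) a b)"
    if "j \<le> N + 1" for j
    using that
  proof (induction j)
    case (Suc j)
    then have j: "j \<le> N" by simp
    show ?case
      using total_drop_product(2)[OF deformation_factor[OF j, of a] monotone_path_transition[of j]
          symplectic_transition[of j] ab] Suc j
      by (simp add: matrix_mul_assoc backward_Suc)
  qed simp
  from this[of "N + 1"] show ?thesis
    by (simp add: backward_last lessThan_Suc_atMost)
qed

lemma drop_regular_difference:
  assumes "k \<le> N" "a \<le> b"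
  shows "drop_regular (\<lambda>s. rank (S k c - S k s)) a b"
  using total_drop_upper_right(1)[OF monotone_coeff[OF assms(1)] symplectic_coeff[OF assms(1)] symplectic_mat_1 symplectic_mat_1 assms(2)] .

lemma drop_regular_transition:
  "a \<le> b \<Longrightarrow> drop_regular (\<lambda>s. rank (upper_right (transition S (N + 1) s))) a b"
  by (intro drop_regular_upper_right monotone_path_transition symplectic_transition) auto

lemma
  assumes ab: "a \<le> b"
  shows finite_rho_support: "finite (rho_support S N a b)"
    and rho_sum_eq: "rho_sum S N a b = (\<Sum>k\<le>N. total_drop (\<lambda>s. rank (S k a - S k s)) a b)"
proof -
  let ?P = "\<lambda>k. drop_points (\<lambda>s. rank (S k a - S k s)) a b"
  have eq: "rho_support S N a b = (\<Union>k\<le>N. ?P k)"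
    by (auto simp: rho_support_def rho_eq_left_drop drop_points_def)
  have "finite (?P k)" if "k \<le> N" for k
    using drop_regular_difference[OF that ab] by (auto simp: drop_regular_def)
  then show fin: "finite (rho_support S N a b)" unfolding eq by blast
  have "rho_sum S N a b = (\<Sum>k\<le>N. \<Sum>t\<in>rho_support S N a b. rho (S k) a t)"
    unfolding rho_sum_def by (rule sum.swap)
  also have "\<dots> = (\<Sum>k\<le>N. total_drop (\<lambda>s. rank (S k a - S k s)) a b)"
    unfolding total_drop_def rho_eq_left_drop
  proof (rule sum.cong[OF refl], rule sum.mono_neutral_right[OF fin])
    fix k assume "k \<in> {..N}"
    then show "?P k \<subseteq> rho_support S N a b" unfolding eq by blast
  next
    fix k
    show "\<forall>t\<in>rho_support S N a b - ?P k. left_drop (\<lambda>s. rank (S k a - S k s)) t = 0"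
      by (auto simp: rho_support_def drop_points_def)
  qed
  finally show "rho_sum S N a b = (\<Sum>k\<le>N. total_drop (\<lambda>s. rank (S k a - S k s)) a b)" .
qed

lemma rho_sum_nonneg: "a \<le> b \<Longrightarrow> 0 \<le> rho_sum S N a b"
  by (simp add: rho_sum_eq) (intro sum_nonneg total_drop_nonneg drop_regular_difference; simp)

lemma finite_eigenvalues_eq:
  assumes ab: "a \<le> b"
  shows "{\<nu> \<in> finite_eigenvalues S N. a < \<nu> \<and> \<nu> \<le> b}
    = drop_points (\<lambda>s. rank (upper_right (transition S (N + 1) s))) a b"
  using drop_regular_transition[OF ab]
  by (force simp: finite_eigenvalues_def theta_eq_left_drop drop_points_def drop_regular_def)

lemma finite_eigenvalues_between:
  assumes ab: "a \<le> b"
  shows "finite {\<nu> \<in> finite_eigenvalues S N. a < \<nu> \<and> \<nu> \<le> b}"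
    and "(\<Sum>\<nu> | \<nu> \<in> finite_eigenvalues S N \<and> a < \<nu> \<and> \<nu> \<le> b. theta S N \<nu>)
      = total_drop (\<lambda>s. rank (upper_right (transition S (N + 1) s))) a b"
  unfolding finite_eigenvalues_eq[OF ab] total_drop_def theta_eq_left_drop
  using drop_regular_transition[OF ab] by (auto simp: drop_regular_def)

text \<open>
  The motion of \<open>S\<^sub>k\<close> leads from \<open>backward (k + 1) b ** transition S (k + 1)
  a\<close> to \<open>backward k b ** transition S k a\<close>, which are the two arguments of the
  \<open>k\<close>-th comparative index in \<open>Ld_star\<close>.
\<close>

lemma Ld_star_formula:
  assumes ab: "a \<le> b"
  shows "int (Ld_star (\<lambda>k. fund S 0 k a) (\<lambda>k. fund S (N + 1) k b) N) + rho_sum S N a b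
          = total_drop (\<lambda>s. rank (upper_right (transition S (N + 1) s))) a b"
proof -
  have "total_drop (\<lambda>s. rank (upper_right (backward (Suc k) b ** S k s ** transition S k a))) a b
    = int (mu (langle (backward k b ** transition S k a)) (langle (backward (Suc k) b ** transition S (Suc k) a)))
      + total_drop (\<lambda>s. rank (S k a - S k s)) a b" if "k \<le> N" for k
    using total_drop_upper_right(2)[OF monotone_coeff[OF that] symplectic_coeff[OF that] symplectic_backward[of "Suc k" b]
        symplectic_transition[of k a] ab] that
    by (simp add: backward_Suc matrix_mul_assoc)
  then show ?thesis
    unfolding total_drop_transition_star[OF ab] rho_sum_eq[OF ab]
    by (simp add: Ld_star_def fund_zero backward_def sum.distrib del: transition.simps)
qed

lemma Ld_formula:
  assumes ab: "a \<le> b"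
  shows "int (Ld (\<lambda>k. fund S 0 k b) (\<lambda>k. fund S (N + 1) k a) N) + rho_sum S N a b
          = total_drop (\<lambda>s. rank (upper_right (transition S (N + 1) s))) a b"
proof -
  have "total_drop (\<lambda>s. rank (upper_right (backward (Suc k) a ** S k s ** transition S k b))) a b
    = int (mu (langle (backward (Suc k) a ** transition S (Suc k) b)) (langle (backward k a ** transition S k b)))
      + total_drop (\<lambda>s. rank (S k a - S k s)) a b" if "k \<le> N" for k
    using total_drop_upper_right(2)[OF monotone_coeff[OF that] symplectic_coeff[OF that] symplectic_backward[of "Suc k" a]
        symplectic_transition[of k b] ab] that
    by (simp add: backward_Suc matrix_mul_assoc)
  then show ?thesis
    unfolding total_drop_transition[OF ab] rho_sum_eq[OF ab]
    by (simp add: Ld_def fund_zero backward_def sum.distrib del: transition.simps)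
qed

lemma Ld_star_le:
  "Ld_star (\<lambda>k. fund S 0 k a) (\<lambda>k. fund S (N + 1) k b) N \<le> (N + 1) * (2 * CARD('n + 'n))"
proof -
  have "symplectic (matrix_inv (fund S (N + 1) k b) ** fund S 0 k a)" if "k \<le> N + 1" for k
    unfolding fund_zero by (intro symplectic_mult symplectic_matrix_inv symplectic_fund symplectic_transition that)
  then have "Ld_star (\<lambda>k. fund S 0 k a) (\<lambda>k. fund S (N + 1) k b) N \<le> (\<Sum>k\<le>N. 2 * CARD('n + 'n))"
    unfolding Ld_star_def by (intro sum_mono mu_le lagrangian_langle) auto
  then show ?thesis by simp
qed

text \<open>
  A comparative index is nonnegative, so the drops of the rank of \<open>\<B>\<^sub>k\<close> dominate
  those that \<open>\<rho>\<^sub>k\<close> records, and the former do not occur to the left of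
  \<open>t0\<close>.
\<close>

lemma rho_sum_bounded:
  assumes t0: "\<And>t k. t \<le> t0 \<Longrightarrow> k \<le> N \<Longrightarrow> rank (upper_right (S k t)) = rank_left (\<lambda>s. upper_right (S k s)) t"
  obtains C where "\<And>a. a \<le> min t0 b \<Longrightarrow> \<bar>rho_sum S N a b\<bar> \<le> C"
proof -
  define m where "m = min t0 b"
  have "\<bar>rho_sum S N a b\<bar> \<le> (\<Sum>k\<le>N. total_drop (\<lambda>s. rank (upper_right (S k s))) m b)"
    if a: "a \<le> min t0 b" for a
  proof -
    have am: "a \<le> m" "m \<le> b" "a \<le> b" using a by (auto simp: m_def)
    have "total_drop (\<lambda>s. rank (S k a - S k s)) a b \<le> total_drop (\<lambda>s. rank (upper_right (S k s))) m b"
      if k: "k \<le> N" for k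
    proof -
      have "drop_points (\<lambda>s. rank (upper_right (S k s))) a m = {}"
        using t0 k by (auto simp: drop_points_def left_drop_def m_def rank_left_def)
      then have "total_drop (\<lambda>s. rank (upper_right (S k s))) a m = 0" by (simp add: total_drop_def)
      then have "total_drop (\<lambda>s. rank (upper_right (S k s))) a b = total_drop (\<lambda>s. rank (upper_right (S k s))) m b"
        using drop_regular_combine(2)[OF drop_regular_upper_right[OF monotone_coeff[OF k] symplectic_coeff[OF k] am(1)]
            drop_regular_upper_right[OF monotone_coeff[OF k] symplectic_coeff[OF k] am(2)] am(1,2)] by simp
      moreover have "total_drop (\<lambda>s. rank (S k a - S k s)) a b \<le> total_drop (\<lambda>s. rank (upper_right (S k s))) a b"
        using total_drop_upper_right(2)[OF monotone_coeff[OF k] symplectic_coeff[OF k] symplectic_mat_1 symplectic_mat_1 am(3)] by simp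
      ultimately show ?thesis by simp
    qed
    then have "rho_sum S N a b \<le> (\<Sum>k\<le>N. total_drop (\<lambda>s. rank (upper_right (S k s))) m b)"
      unfolding rho_sum_eq[OF am(3)] by (intro sum_mono) auto
    then show ?thesis using rho_sum_nonneg[OF am(3)] by simp
  qed
  then show thesis by (rule that)
qed

text \<open>
  By the formula, the number of finite eigenvalues in \<open>(a,b]\<close> is at most a bound for
  \<open>Ld_star\<close> plus a bound for the \<open>\<rho>\<close>-sum, and neither depends on
  \<open>a\<close>.
\<close>

lemma finite_eigenvalues_below:
  assumes t0: "\<And>t k. t \<le> t0 \<Longrightarrow> k \<le> N \<Longrightarrow> rank (upper_right (S k t)) = rank_left (\<lambda>s. upper_right (S k s)) t"
  shows "finite {\<nu> \<in> finite_eigenvalues S N. \<nu> \<le> b}"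
proof -
  obtain C where C: "\<And>a. a \<le> min t0 b \<Longrightarrow> \<bar>rho_sum S N a b\<bar> \<le> C"
    using rho_sum_bounded[OF t0] by blast
  define M where "M = nat (int ((N + 1) * (2 * CARD('n + 'n))) + C)"
  have "card G \<le> M" if G: "G \<subseteq> {\<nu> \<in> finite_eigenvalues S N. \<nu> \<le> b}" "finite G" for G
  proof -
    \<comment> \<open>Any \<open>a\<close> below \<open>t0\<close>, \<open>b\<close> and all of the finitely many
      points of \<open>G\<close> will do.\<close>
    define a where "a = min (min t0 b) (Min (insert b G) - 1)"
    have "a < \<nu>" if "\<nu> \<in> G" for \<nu>
    proof -
      have "Min (insert b G) \<le> \<nu>" using that G(2) by simp
      then show ?thesis by (simp add: a_def)
    qed
    then have sub: "G \<subseteq> {\<nu> \<in> finite_eigenvalues S N. a < \<nu> \<and> \<nu> \<le> b}" using G(1) by auto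
    have ab: "a \<le> b" by (simp add: a_def)
    have "card G \<le> card {\<nu> \<in> finite_eigenvalues S N. a < \<nu> \<and> \<nu> \<le> b}"
      using finite_eigenvalues_between(1)[OF ab] sub by (rule card_mono)
    then have "int (card G) \<le> total_drop (\<lambda>s. rank (upper_right (transition S (N + 1) s))) a b"
      using card_drop_points_le[OF drop_regular_transition[OF ab]] finite_eigenvalues_eq[OF ab] by simp
    also have "\<dots> = int (Ld_star (\<lambda>k. fund S 0 k a) (\<lambda>k. fund S (N + 1) k b) N) + rho_sum S N a b"
      using Ld_star_formula[OF ab] by simp
    also have "\<dots> \<le> int ((N + 1) * (2 * CARD('n + 'n))) + C"
    proof (rule add_mono)
      show "int (Ld_star (\<lambda>k. fund S 0 k a) (\<lambda>k. fund S (N + 1) k b) N) \<le> int ((N + 1) * (2 * CARD('n + 'n)))"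
        using Ld_star_le by (rule of_nat_mono)
      have "a \<le> min t0 b" unfolding a_def by (rule min.cobounded1)
      then show "rho_sum S N a b \<le> C" using C[of a] by linarith
    qed
    finally show ?thesis by (simp add: M_def)
  qed
  then show ?thesis using finite_if_finite_subsets_card_bdd by blast
qed

end

theorem theorem4p5:
  fixes S :: "nat \<Rightarrow> real \<Rightarrow> real^('n::finite + 'n)^('n + 'n)" and N :: nat
  assumes "\<And>k. k \<le> N \<Longrightarrow> C1p (S k)"
    and "\<And>k t. k \<le> N \<Longrightarrow> symplectic (S k t)"
    and "\<And>k t. k \<le> N \<Longrightarrow> S k differentiable (at t) \<Longrightarrow> nonneg_def (Psi (S k) t)"
  shows
    "(\<forall>a. \<forall>t. \<forall>k\<le>N. rank_left_exists (\<lambda>s. S k a - S k s) t) \<and>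
     (\<forall>a b. a < b \<longrightarrow>
        finite (rho_support S N a b) \<and>
        finite {\<nu>\<in>finite_eigenvalues S N. a < \<nu> \<and> \<nu> \<le> b} \<and>
        int (Ld_star (\<lambda>k. fund S 0 k a) (\<lambda>k. fund S (N + 1) k b) N) + rho_sum S N a b
          = (\<Sum>\<nu> | \<nu> \<in> finite_eigenvalues S N \<and> a < \<nu> \<and> \<nu> \<le> b. theta S N \<nu>) \<and>
        Ld_star (\<lambda>k. fund S 0 k a) (\<lambda>k. fund S (N + 1) k b) N
          = Ld (\<lambda>k. fund S 0 k b) (\<lambda>k. fund S (N + 1) k a) N) \<and>
     ((\<exists>t0. \<forall>t\<le>t0. \<forall>k\<le>N.
         rank (upper_right (S k t)) = rank_left (\<lambda>s. upper_right (S k s)) t) \<longrightarrow>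
        (\<forall>b. \<exists>C. \<forall>\<^sub>F a in at_bot. \<bar>rho_sum S N a b\<bar> \<le> C) \<and>
        (finite_eigenvalues S N \<noteq> {} \<longrightarrow>
           (\<exists>m\<in>finite_eigenvalues S N. \<forall>\<nu>\<in>finite_eigenvalues S N. m \<le> \<nu>)) \<and>
        (\<forall>a b. a < b \<and> (\<forall>\<nu>\<in>finite_eigenvalues S N. a < \<nu>) \<longrightarrow>
           finite {\<nu>\<in>finite_eigenvalues S N. \<nu> \<le> b} \<and>
           int (Ld_star (\<lambda>k. fund S 0 k a) (\<lambda>k. fund S (N + 1) k b) N) + rho_sum S N a b
             = (\<Sum>\<nu> | \<nu> \<in> finite_eigenvalues S N \<and> \<nu> \<le> b. theta S N \<nu>)))"
proof -
  have mono: "monotone_path (S k)" if "k \<le> N" for k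
    using that assms by (intro monotone_path_if_C1p) auto
  have facts: "\<forall>k\<le>N. monotone_path (S k)" "\<forall>k\<le>N. \<forall>t. symplectic (S k t)"
    using mono assms(2) by auto
  have limits: "rank_left_exists (\<lambda>s. S k a - S k s) t" if "k \<le> N" for a t k
    using drop_regular_difference[OF facts that, where a = "t - 1" and b = t and c = a]
    by (auto simp: rank_left_exists_def drop_regular_def)
  have formula: "int (Ld_star (\<lambda>k. fund S 0 k a) (\<lambda>k. fund S (N + 1) k b) N) + rho_sum S N a b
      = (\<Sum>\<nu> | \<nu> \<in> finite_eigenvalues S N \<and> a < \<nu> \<and> \<nu> \<le> b. theta S N \<nu>)" if "a < b" for a b
    using Ld_star_formula[OF facts, of a b] finite_eigenvalues_between(2)[OF facts, of a b] that by simp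
  have equal: "Ld_star (\<lambda>k. fund S 0 k a) (\<lambda>k. fund S (N + 1) k b) N
      = Ld (\<lambda>k. fund S 0 k b) (\<lambda>k. fund S (N + 1) k a) N" if "a < b" for a b
    using Ld_star_formula[OF facts, of a b] Ld_formula[OF facts, of a b] that by simp
  have below: "(\<forall>b. \<exists>C. \<forall>\<^sub>F a in at_bot. \<bar>rho_sum S N a b\<bar> \<le> C) \<and>
      (finite_eigenvalues S N \<noteq> {} \<longrightarrow>
         (\<exists>m\<in>finite_eigenvalues S N. \<forall>\<nu>\<in>finite_eigenvalues S N. m \<le> \<nu>))"
    if "\<forall>t\<le>t0. \<forall>k\<le>N. rank (upper_right (S k t)) = rank_left (\<lambda>s. upper_right (S k s)) t" for t0
  proof (intro conjI allI impI)
    have t0: "\<And>t k. t \<le> t0 \<Longrightarrow> k \<le> N \<Longrightarrow> rank (upper_right (S k t)) = rank_left (\<lambda>s. upper_right (S k s)) t"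
      using that by blast
    fix b
    obtain C where C: "\<And>a. a \<le> min t0 b \<Longrightarrow> \<bar>rho_sum S N a b\<bar> \<le> C"
      using rho_sum_bounded[OF facts t0] by metis
    have "\<forall>\<^sub>F a in at_bot. \<bar>rho_sum S N a b\<bar> \<le> C"
      by (rule eventually_mono[OF eventually_le_at_bot[of "min t0 b"] C])
    then show "\<exists>C. \<forall>\<^sub>F a in at_bot. \<bar>rho_sum S N a b\<bar> \<le> C" ..
  next
    assume "finite_eigenvalues S N \<noteq> {}"
    then obtain b where b: "b \<in> finite_eigenvalues S N" by blast
    define E where "E = {\<nu> \<in> finite_eigenvalues S N. \<nu> \<le> b}"
    have "finite E"
      unfolding E_def using that by (intro finite_eigenvalues_below[OF facts]) auto
    moreover have "E \<noteq> {}" using b by (auto simp: E_def)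
    ultimately have min: "Min E \<in> E" "\<And>\<nu>. \<nu> \<in> E \<Longrightarrow> Min E \<le> \<nu>" by auto
    have "Min E \<le> \<nu>" if "\<nu> \<in> finite_eigenvalues S N" for \<nu>
    proof (cases "\<nu> \<le> b")
      case True
      then show ?thesis using min(2) that by (simp add: E_def)
    next
      case False
      then show ?thesis using min(1) by (simp add: E_def)
    qed
    then show "\<exists>m\<in>finite_eigenvalues S N. \<forall>\<nu>\<in>finite_eigenvalues S N. m \<le> \<nu>"
      using min(1) by (auto simp: E_def)
  qed
  have all: "{\<nu> \<in> finite_eigenvalues S N. \<nu> \<le> b} = {\<nu> \<in> finite_eigenvalues S N. a < \<nu> \<and> \<nu> \<le> b}"
    if "\<forall>\<nu>\<in>finite_eigenvalues S N. a < \<nu>" for a b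
    using that by auto
  show ?thesis
    using limits formula equal below all finite_rho_support[OF facts] finite_eigenvalues_between(1)[OF facts]
    by (auto simp: less_imp_le)
qed

end
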